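(* Suppose that the following two assumptions are satisfied. (I) There is a constant $c<1$ such that $\|K_n^{0}\|\le c$ for all $n\ge 1$. (II) There is a set $M$ of probability measures on $\mathrm{SL}(m,\mathbb{R})$ which is compact with respect to weak convergence and such that: (a) $\nu_n\in M$ for all $n\ge 1$; (b) for every $\nu\in M$ the group $G_\nu$ does not preserve any probability measure on $\mathcal{S}$. Then there is a positive constant $\alpha<1$ such that for all $n\ge 2$ $$\|\hat{K}_{n-1}\hat{V}_{\mathfrak{g}_n}\hat{K}_{n}\hat{V}_{\mathfrak{g}_{n+1}}\|\le\alpha .$$
   Context: Let $m$ be a positive integer, $\mathcal{S}$ the unit sphere in $\mathbb{R}^m$ with normalized uniform (Lebesgue) probability measure $du$, and $\|\cdot\|$ the Euclidean norm of vectors and the corresponding operator norm of matrices. Markov chain. Let $(X,\mathcal{B})$ be a measurable space and $\xi=(\xi_n)_{n\ge1}$ a (not necessarily stationary) Markov chain with phase space $X$, initial distribution $\mu_1$ and transition kernels $k_n(x,B)=\mathbb{P}(\xi_{n+1}\in B\mid \xi_n=x)$, $B\in\mathcal{B}$. Let $\mu_n$ be the distribution of $\xi_n$. Let $H_n$ be the Hilbert space of real-valued $\mu_n$-square-integrable functions on $X$, and $H_n^0=\{f\in H_n:\int_X f\,d\mu_n=0\}$. Let $K_n:H_{n+1}\to H_n$, $(K_nf)(x)=\int_X k_n(x,dy)f(y)$. It maps $H_{n+1}^0$ into $H_n^0$, and $K_n^0:H_{n+1}^0\to H_n^0$ denotes its restriction; $\|K_n^0\|$ is its operator norm. Matrices.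 Let $\mathfrak{g}_n:X\to\mathrm{SL}(m,\mathbb{R})$, $n\ge1$, be $\mathcal{B}$-measurable functions and let $\nu_n$ be the distribution of $\mathfrak{g}_n(\xi_n)$ on $\mathrm{SL}(m,\mathbb{R})$. Groups. For a probability measure $\nu$ on $\mathrm{SL}(m,\mathbb{R})$, $G_\nu$ is the closed group generated by $\{g\tilde g^{-1}: g,\tilde g\in\mathrm{supp}(\nu)\}$. For $g\in\mathrm{SL}(m,\mathbb{R})$ and $u\in\mathcal{S}$ set $g.u=gu/\|gu\|$; $g$ preserves a probability measure $\kappa$ on $\mathcal{S}$ if the image of $\kappa$ under $u\mapsto g.u$ is $\kappa$, and a group preserves $\kappa$ if each of its elements does. Extended operators. Let $\mathbb{H}_n$ be the Hilbert space of real-valued functions on $X\times\mathcal{S}$ square-integrable with respect to $\mu_n(dx)\,du$. The operators $\hat K_n:\mathbb{H}_{n+1}\to\mathbb{H}_n$ and $\hat V_{\mathfrak{g}_n}:\mathbb{H}_n\to\mathbb{H}_n$ (the latter unitary) are $$(\hat K_nf)(x,u)=\int_X k_n(x,dy)f(y,u),\qquad (\hat V_{\mathfrak{g}_n}f)(x,u)=f(x,\mathfrak{g}_n(x).u)\,\|\mathfrak{g}_n(x)u\|^{-m/2}.$$ The norm in the claim is the operator norm from $\mathbb{H}_{n+1}$ to $\mathbb{H}_{n-1}$. *)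

theory Defs
  imports "HOL-Probability.Probability" "HOL-Algebra.Group"
begin

text \<open>Square-integrable functions. The Hilbert space is the quotient of \<open>L2 M\<close> by equality
  almost everywhere; we work with representatives, on which the norm and all operators below
  depend only up to null sets. The norm is \<open>\<infinity>\<close> outside \<open>L2 M\<close>, so a finite bound on an operator
  norm includes that the operator maps into the target space.\<close>

definition L2 :: "'a measure \<Rightarrow> ('a \<Rightarrow> real) set" where
  "L2 M = {f \<in> borel_measurable M. integrable M (\<lambda>x. (f x)\<^sup>2)}"

definition L2_zero :: "'a measure \<Rightarrow> ('a \<Rightarrow> real) set" where
  "L2_zero M = {f \<in> L2 M. (\<integral>x. f x \<partial>M) = 0}"

definition l2norm :: "'a measure \<Rightarrow> ('a \<Rightarrow> real) \<Rightarrow> ereal" where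
  "l2norm M f = (if f \<in> L2 M then ereal (sqrt (\<integral>x. (f x)\<^sup>2 \<partial>M)) else \<infinity>)"

text \<open>Operator norm of \<open>T\<close>, defined on the linear subspace \<open>D\<close> of \<open>L2 M\<close>, with values in \<open>L2 N\<close>.\<close>

definition op_norm ::
    "'a measure \<Rightarrow> ('a \<Rightarrow> real) set \<Rightarrow> 'b measure \<Rightarrow> (('a \<Rightarrow> real) \<Rightarrow> 'b \<Rightarrow> real) \<Rightarrow> ereal" where
  "op_norm M D N T = (SUP f \<in> {f \<in> D. l2norm M f \<le> 1}. l2norm N (T f))"

text \<open>Only the underlying measurable space of \<open>X\<close> is used. Indices start at 1.\<close>

definition past :: "'w measure \<Rightarrow> 'x measure \<Rightarrow> (nat \<Rightarrow> 'w \<Rightarrow> 'x) \<Rightarrow> nat \<Rightarrow> 'w measure" where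
  "past \<Omega> X \<xi> n = sigma (space \<Omega>) {\<xi> i -` B \<inter> space \<Omega> | i B. i \<in> {1..n} \<and> B \<in> sets X}"

definition markov_chain ::
    "'w measure \<Rightarrow> 'x measure \<Rightarrow> (nat \<Rightarrow> 'w \<Rightarrow> 'x) \<Rightarrow> (nat \<Rightarrow> 'x \<Rightarrow> 'x measure) \<Rightarrow> bool" where
  "markov_chain \<Omega> X \<xi> k \<longleftrightarrow>
     prob_space \<Omega> \<and>
     (\<forall>n\<ge>1. \<xi> n \<in> \<Omega> \<rightarrow>\<^sub>M X) \<and>
     (\<forall>n\<ge>1. k n \<in> X \<rightarrow>\<^sub>M prob_algebra X) \<and>
     (\<forall>n\<ge>1. \<forall>B\<in>sets X. AE \<omega> in \<Omega>.
        real_cond_exp \<Omega> (past \<Omega> X \<xi> n) (indicator (\<xi> (n + 1) -` B \<inter> space \<Omega>)) \<omega>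
          = measure (k n (\<xi> n \<omega>)) B)"

definition K_op :: "('x \<Rightarrow> 'x measure) \<Rightarrow> ('x \<Rightarrow> real) \<Rightarrow> 'x \<Rightarrow> real" where
  "K_op k f = (\<lambda>x. \<integral>y. f y \<partial>k x)"

definition SL :: "(real^'m^'m) set" where
  "SL = {g. det g = 1}"

definition SL_group :: "(real^'m^'m) monoid" where
  "SL_group = \<lparr>carrier = SL, monoid.mult = (**), one = mat 1\<rparr>"

lemma group_SL_group: "group (SL_group :: (real^'m^'m) monoid)"
proof (rule groupI)
  fix x :: "real^'m^'m"
  assume x: "x \<in> carrier SL_group"
  then have "invertible x"
    by (simp add: SL_group_def SL_def invertible_det_nz)
  then obtain y where xy: "y ** x = mat 1"
    by (auto simp: invertible_def)
  then have "det y * det x = 1"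
    by (metis det_I det_mul)
  with x xy show "\<exists>y\<in>carrier SL_group. y \<otimes>\<^bsub>SL_group\<^esub> x = \<one>\<^bsub>SL_group\<^esub>"
    by (intro bexI[of _ y]) (auto simp: SL_group_def SL_def)
qed (auto simp: SL_group_def SL_def det_mul matrix_mul_assoc)

text \<open>Borel probability measures on a subspace \<open>S\<close>, and their topology of weak convergence: the
  coarsest topology making \<open>\<nu> \<mapsto> \<integral>f d\<nu>\<close> continuous for all bounded continuous \<open>f\<close> on \<open>S\<close>.\<close>

definition prob_measures_on :: "'a::topological_space set \<Rightarrow> 'a measure set" where
  "prob_measures_on S = {\<nu>. prob_space \<nu> \<and> sets \<nu> = sets (restrict_space borel S)}"

definition weak_topology :: "'a::topological_space set \<Rightarrow> 'a measure topology" where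
  "weak_topology S = topology_generated_by
     {{\<nu> \<in> prob_measures_on S. (\<integral>x. f x \<partial>\<nu>) \<in> U} | (f :: 'a \<Rightarrow> real) U.
        continuous_on S f \<and> bounded (f ` S) \<and> open U}"

lemma topspace_weak_topology: "topspace (weak_topology S) = prob_measures_on S"
proof -
  have "prob_measures_on S \<in> {{\<nu> \<in> prob_measures_on S. (\<integral>x. f x \<partial>\<nu>) \<in> U} | (f :: 'a \<Rightarrow> real) U.
        continuous_on S f \<and> bounded (f ` S) \<and> open U}"
    by (rule CollectI, rule exI[of _ "\<lambda>_. 0"], rule exI[of _ UNIV])
       (auto intro: bounded_subset[of "{0}"])
  then show ?thesis
    unfolding weak_topology_def topology_generated_by_topspace by blast
qed

definition supp :: "'a::topological_space measure \<Rightarrow> 'a set" where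
  "supp \<nu> = {x \<in> space \<nu>. \<forall>U. open U \<and> x \<in> U \<longrightarrow> emeasure \<nu> (U \<inter> space \<nu>) > 0}"

definition G_of :: "(real^'m^'m) measure \<Rightarrow> (real^'m^'m) set" where
  "G_of \<nu> = \<Inter> {H. subgroup H SL_group \<and> closedin (top_of_set SL) H \<and>
                    {g ** matrix_inv h | g h. g \<in> supp \<nu> \<and> h \<in> supp \<nu>} \<subseteq> H}"

abbreviation unit_sphere :: "(real^'m) set" where
  "unit_sphere \<equiv> sphere 0 1"

definition sphere_act :: "real^'m^'m \<Rightarrow> real^'m \<Rightarrow> real^'m" where
  "sphere_act g u = (1 / norm (g *v u)) *\<^sub>R (g *v u)"

definition preserves :: "real^'m^'m \<Rightarrow> (real^'m) measure \<Rightarrow> bool" where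
  "preserves g \<kappa> \<longleftrightarrow> distr \<kappa> (restrict_space borel unit_sphere) (sphere_act g) = \<kappa>"

text \<open>The normalized surface measure on the sphere, as the radial projection of the uniform
  distribution on the unit ball (\<open>sgn x = x / \<parallel>x\<parallel>\<close>; the origin is a null set). For dimension 1
  this gives mass 1/2 to each of the two points.\<close>

definition sphere_measure :: "(real^'m) measure" where
  "sphere_measure =
     restrict_space (distr (uniform_measure lborel (ball 0 1)) borel sgn) unit_sphere"

lemma prob_space_sphere_measure: "prob_space (sphere_measure :: (real^'m) measure)"
proof -
  let ?B = "uniform_measure lborel (ball 0 1) :: (real^'m) measure"
  have B: "emeasure lborel (ball 0 1 :: (real^'m) set) \<noteq> 0"
          "emeasure lborel (ball 0 1 :: (real^'m) set) < \<infinity>"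
    using emeasure_bounded_finite[of "ball 0 1 :: (real^'m) set"]
    using unit_ball_vol_pos[of "real CARD('m)"]
    by (auto simp: emeasure_ball simp del: unit_ball_vol_pos)
  interpret prob_space ?B
    using B by (intro prob_space_uniform_measure) auto
  have sgn: "sgn \<in> borel_measurable (borel :: (real^'m) measure)"
    by (simp add: sgn_div_norm[abs_def])
  have *: "AE x in ?B. sgn x \<in> unit_sphere"
  proof (rule AE_uniform_measureI)
    have "AE x in lborel. x \<noteq> (0 :: real^'m)"
      by (rule AE_lborel_singleton)
    then show "AE x in lborel. x \<in> ball 0 1 \<longrightarrow> sgn x \<in> (unit_sphere :: (real^'m) set)"
      by eventually_elim (auto simp: norm_sgn)
  qed simp
  interpret D: prob_space "distr ?B borel sgn"
    by (rule prob_space_distr) (simp add: sgn)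
  have "AE x in distr ?B borel sgn. x \<in> unit_sphere"
    using * by (subst AE_distr_iff) (auto simp: sgn)
  then show ?thesis
    unfolding sphere_measure_def by (intro prob_space_restrict_space D.emeasure_eq_1_AE) auto
qed

definition ext_measure :: "'x measure \<Rightarrow> ('x \<times> (real^'m)) measure" where
  "ext_measure \<mu> = \<mu> \<Otimes>\<^sub>M sphere_measure"

definition hat_K :: "('x \<Rightarrow> 'x measure) \<Rightarrow> ('x \<times> (real^'m) \<Rightarrow> real) \<Rightarrow> 'x \<times> (real^'m) \<Rightarrow> real" where
  "hat_K k f = (\<lambda>(x, u). \<integral>y. f (y, u) \<partial>k x)"

definition hat_V ::
    "('x \<Rightarrow> real^'m^'m) \<Rightarrow> ('x \<times> (real^'m) \<Rightarrow> real) \<Rightarrow> 'x \<times> (real^'m) \<Rightarrow> real" where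
  "hat_V g f = (\<lambda>(x, u). f (x, sphere_act (g x) u) * norm (g x *v u) powr (- (real CARD('m) / 2)))"

end

theory Submission imports Defs begin

text \<open>
  Split a function of \<open>(x, u)\<close> into its mean over \<open>x\<close>, a function of \<open>u\<close> alone, and the fluctuation,
  whose mean over \<open>x\<close> vanishes for every \<open>u\<close>. The operators \<open>hat_K\<close> fix the mean and, by (I),
  contract the fluctuation by the factor \<open>c\<close>; the operators \<open>hat_V\<close> are isometric. So a product of
  two steps can fail to lose norm only if there is almost no fluctuation when the first \<open>hat_K\<close>
  is applied, and the \<open>hat_V\<close> after it creates almost none from the mean. On a function \<open>\<phi>\<close> of \<open>u\<close>
  alone, \<open>hat_V\<close> followed by the mean is the averaging operator of the distribution \<open>\<nu>\<^sub>n\<close> of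
  \<open>g\<^sub>n(\<xi>\<^sub>n)\<close>: it takes \<open>\<phi>\<close> to the \<open>\<nu>\<^sub>n\<close>-average of the functions
  \<open>twist g \<phi>\<close>. All that is needed is that the norms of these averaging operators
  on the sphere are bounded by a constant \<open>\<beta> < 1\<close> for all \<open>\<nu>\<close> in \<open>M\<close>; the lemmas
  \<open>two_step_bound\<close> and \<open>two_step_contraction\<close> combine \<open>c\<close> and \<open>\<beta>\<close> into \<open>\<alpha>\<close>.

  The bound \<open>\<beta>\<close> is \<open>uniform_contraction\<close>. The functions that are averaged have the norm of \<open>\<phi>\<close>,
  so the average is shorter than \<open>\<phi>\<close> exactly by the amount by which they differ from each other
  (\<open>average_deficit\<close>). Their squares are the densities of the images of the measure \<open>\<phi>\<^sup>2 du\<close> under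
  \<open>g\<inverse>\<close> (\<open>sphere_change_of_variables\<close>, \<open>integral_mult_twist\<close>). If for \<open>g\<close>, \<open>h\<close> in the support
  of \<open>\<nu>\<close> they hardly differed, then \<open>\<phi>\<^sup>2 du\<close> would be almost invariant under \<open>g h\<inverse>\<close>, and a
  limit of such measures would be invariant under \<open>G_of \<nu>\<close>, which (II) excludes. Compactness is
  used twice. That of the space of probability measures on the sphere, proved here by the
  representation of positive functionals, reduces non-invariance to finitely many continuous
  tests with a uniform margin (\<open>finite_separating_tests\<close>). These tests involve only finitely many
  points of the support and persist for all measures in a weak neighbourhood of \<open>\<nu>\<close>
  (\<open>neighbourhood_contraction\<close>), so that compactness of \<open>M\<close> makes the bound uniform.
\<close>

section \<open>Positive functionals on a compact metric space\<close>

lemma open_positivity_function: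
  fixes U :: "'a::metric_space set"
  assumes "open U"
  shows "\<exists>d :: 'a \<Rightarrow> real. continuous_on UNIV d \<and> (\<forall>x. 0 \<le> d x) \<and> (\<forall>x. 0 < d x \<longleftrightarrow> x \<in> U)"
proof (cases "U = UNIV")
  case True
  then show ?thesis by (intro exI[of _ "\<lambda>_. 1"]) auto
next
  case False
  have "infdist x (- U) = 0 \<longleftrightarrow> x \<in> - U" for x
    using assms False by (subst in_closed_iff_infdist_zero) auto
  moreover have "0 \<le> infdist x (- U)" for x by (rule infdist_nonneg)
  ultimately show ?thesis
    by (intro exI[of _ "\<lambda>x. infdist x (- U)"])
       (auto intro!: continuous_intros simp: less_le)
qed

text \<open>A normalized positive linear functional on the continuous functions on a compact metric space \<open>S\<close>.
  The functions are total on the ambient type, but \<open>mono\<close> makes \<open>L\<close> depend on their values on \<open>S\<close>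
  only. Such a functional is integration against a probability measure: this is where the invariant
  measure that contradicts assumption (II) will come from.\<close>

locale positive_functional =
  fixes S :: "'a::metric_space set" and L :: "('a \<Rightarrow> real) \<Rightarrow> real"
  assumes compact: "compact S"
    and add: "continuous_on S f \<Longrightarrow> continuous_on S h \<Longrightarrow> L (\<lambda>x. f x + h x) = L f + L h"
    and scale: "continuous_on S f \<Longrightarrow> L (\<lambda>x. c * f x) = c * L f"
    and mono: "continuous_on S f \<Longrightarrow> continuous_on S h \<Longrightarrow> (\<And>x. x \<in> S \<Longrightarrow> f x \<le> h x) \<Longrightarrow> L f \<le> L h"
    and one: "L (\<lambda>_. 1) = 1"
begin

definition tests :: "'a set \<Rightarrow> ('a \<Rightarrow> real) set" where
  "tests U = {f. continuous_on S f \<and> (\<forall>x\<in>S. 0 \<le> f x \<and> f x \<le> 1) \<and> (\<forall>x\<in>S - U. f x = 0)}"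

definition content :: "'a set \<Rightarrow> ennreal" where
  "content U = (SUP f\<in>tests U. ennreal (L f))"

text \<open>The classical route: \<open>content\<close> measures open sets from inside by test functions and \<open>outer\<close>
  extends it to all subsets of \<open>S\<close>; Caratheodory's construction does the rest. A test function of
  \<open>U\<close> only has to vanish outside \<open>U\<close>. Compact support is recovered where needed by passing from
  \<open>f\<close> to \<open>max (f - e) 0\<close>, which costs at most \<open>e\<close>.\<close>

definition outer :: "'a set \<Rightarrow> ennreal" where
  "outer A = (INF U\<in>{U. open U \<and> A \<subseteq> U}. content U)"

lemma L_const: "L (\<lambda>_. c) = c"
  using scale[of "\<lambda>_. 1" c] one by simp

lemma L_diff: "continuous_on S f \<Longrightarrow> continuous_on S h \<Longrightarrow> L (\<lambda>x. f x - h x) = L f - L h"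
  using add[of f "\<lambda>x. (-1) * h x"] scale[of h "-1"] by (simp add: continuous_intros)

lemma L_sum:
  "(\<And>i. i \<in> I \<Longrightarrow> continuous_on S (f i)) \<Longrightarrow> L (\<lambda>x. \<Sum>i\<in>I. f i x) = (\<Sum>i\<in>I. L (f i))"
proof (induction I rule: infinite_finite_induct)
  case (insert i I)
  then have "L (\<lambda>x. f i x + (\<Sum>j\<in>I. f j x)) = L (f i) + L (\<lambda>x. \<Sum>j\<in>I. f j x)"
    by (intro add continuous_on_sum) auto
  with insert show ?case by simp
qed (auto simp: L_const)

lemma zero_tests: "(\<lambda>_. 0) \<in> tests U"
  by (auto simp: tests_def)

lemma tests_L: "f \<in> tests U \<Longrightarrow> 0 \<le> L f" "f \<in> tests U \<Longrightarrow> L f \<le> 1"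
  using mono[of "\<lambda>_. 0" f] mono[of f "\<lambda>_. 1"] by (auto simp: tests_def L_const)

lemma content_upper: "f \<in> tests U \<Longrightarrow> ennreal (L f) \<le> content U"
  unfolding content_def by (rule SUP_upper)

lemma content_le_1: "content U \<le> 1"
  unfolding content_def by (rule SUP_least) (use tests_L in auto)

lemma content_mono: "S \<inter> U \<subseteq> V \<Longrightarrow> content U \<le> content V"
  unfolding content_def by (rule SUP_subset_mono) (auto simp: tests_def)

lemma content_empty: "content {} = 0"
proof -
  have "L f \<le> 0" if "f \<in> tests {}" for f
    using mono[of f "\<lambda>_. 0"] that by (auto simp: tests_def L_const)
  then show ?thesis
    unfolding content_def by (auto simp: SUP_eq_iff[of "tests {}"] ennreal_neg intro!: antisym SUP_least)
qed

lemma content_UNIV: "content UNIV = 1"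
  using content_upper[of "\<lambda>_. 1" UNIV] content_le_1[of UNIV]
  by (auto simp: one tests_def intro: antisym)

lemma outer_mono: "A \<subseteq> B \<Longrightarrow> outer A \<le> outer B"
  unfolding outer_def by (rule INF_superset_mono) auto

lemma outer_lower: "open U \<Longrightarrow> A \<subseteq> U \<Longrightarrow> outer A \<le> content U"
  unfolding outer_def by (rule INF_lower) auto

lemma outer_open: "open U \<Longrightarrow> outer (S \<inter> U) = content U"
  unfolding outer_def
  by (intro antisym INF_lower INF_greatest content_mono) auto

lemma outer_empty: "outer {} = 0"
  using outer_open[of "{}"] by (simp add: content_empty)

lemma outer_close:
  assumes "0 < e"
  obtains U where "open U" "A \<subseteq> U" "content U \<le> outer A + ennreal e"
proof -
  have fin: "outer A \<noteq> \<infinity>"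
    using outer_lower[of UNIV A] content_le_1[of UNIV] by (auto simp: top_unique)
  then have "outer A < outer A + ennreal e"
    using assms by (simp add: ennreal_add_left_cancel_less)
  then obtain U where "U \<in> {U. open U \<and> A \<subseteq> U}" "content U < outer A + ennreal e"
    unfolding outer_def INF_less_iff by blast
  then show ?thesis using that by auto
qed

text \<open>By compactness, a test function \<open>f\<close> of the union is at least \<open>e\<close> only on a compact set covered by
  finitely many \<open>U i\<close>. A partition of unity can be avoided: truncating \<open>f\<close> at a large multiple of a
  function that is positive exactly on \<open>U i\<close> gives a test function of \<open>U i\<close>, and since the minimum is
  subadditive in its second argument, these truncations sum up to at least \<open>f - e\<close>.\<close>

lemma content_countably_subadditive:
  assumes U: "\<And>i::nat. open (U i)"
  shows "content (\<Union>i. U i) \<le> (\<Sum>i. content (U i))"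
  unfolding content_def[of "\<Union>i. U i"]
proof (rule SUP_least)
  fix f assume f: "f \<in> tests (\<Union>i. U i)"
  then have cf: "continuous_on S f" and f01: "\<And>x. x \<in> S \<Longrightarrow> 0 \<le> f x \<and> f x \<le> 1"
    and f0: "\<And>x. x \<in> S \<Longrightarrow> x \<notin> (\<Union>i. U i) \<Longrightarrow> f x = 0"
    by (auto simp: tests_def)
  have "\<forall>i. \<exists>d :: 'a \<Rightarrow> real. continuous_on UNIV d \<and> (\<forall>x. 0 \<le> d x) \<and> (\<forall>x. 0 < d x \<longleftrightarrow> x \<in> U i)"
    by (intro allI open_positivity_function U)
  from choice[OF this] obtain d :: "nat \<Rightarrow> 'a \<Rightarrow> real"
    where d: "\<forall>i. continuous_on UNIV (d i) \<and> (\<forall>x. 0 \<le> d i x) \<and> (\<forall>x. 0 < d i x \<longleftrightarrow> x \<in> U i)"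
    by (elim exE)
  then have cd: "\<And>i. continuous_on UNIV (d i)" and d0: "\<And>i x. 0 \<le> d i x"
    and dU: "\<And>i x. 0 < d i x \<longleftrightarrow> x \<in> U i"
    by blast+
  show "ennreal (L f) \<le> (\<Sum>i. content (U i))"
  proof (rule ennreal_le_epsilon)
    fix e :: real assume e: "0 < e"
    define K where "K = {x \<in> S. e \<le> f x}"
    have "closedin (top_of_set S) (S \<inter> f -` {e..})"
      by (rule continuous_closedin_preimage[OF cf]) auto
    then have "compact (S \<inter> f -` {e..})"
      using closedin_compact[OF compact] by blast
    moreover have "S \<inter> f -` {e..} = K" by (auto simp: K_def)
    ultimately have K: "compact K" by simp
    \<comment> \<open>Increasing in \<open>n\<close>, so one of them contains all of \<open>K\<close>; \<open>n\<close> is both the number of sets and the factor.\<close>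
    define V where "V n = {x. 1 < real n * (\<Sum>i<n. d i x)}" for n
    have oV: "open (V n)" for n
      unfolding V_def by (intro open_Collect_less continuous_intros cd)
    have V_mono: "V a \<subseteq> V b" if "a \<le> b" for a b
    proof
      fix x assume "x \<in> V a"
      moreover have "real a * (\<Sum>i<a. d i x) \<le> real b * (\<Sum>i<b. d i x)"
        using that d0 by (intro mult_mono sum_mono2 sum_nonneg) auto
      ultimately show "x \<in> V b" by (auto simp: V_def)
    qed
    have "K \<subseteq> (\<Union>n. V n)"
    proof
      fix x assume x: "x \<in> K"
      then obtain i where i: "x \<in> U i" using f0[of x] e by (force simp: K_def)
      then have di: "0 < d i x" by (simp add: dU)
      obtain N where N: "1 / d i x < real N" using reals_Archimedean2 by blast
      define n where "n = max N (Suc i)"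
      have "1 / d i x < real n" using N by (auto simp: n_def)
      then have "1 < real n * d i x" using di by (simp add: field_simps)
      also have "d i x \<le> (\<Sum>j<n. d j x)"
        using d0 by (intro member_le_sum) (auto simp: n_def)
      finally have "x \<in> V n" by (simp add: V_def mult_left_mono)
      then show "x \<in> (\<Union>n. V n)" by blast
    qed
    then obtain C where C: "finite C" "K \<subseteq> (\<Union>n\<in>C. V n)"
      by (rule compactE_image[OF K oV])
    define n where "n = Max (insert 0 C)"
    have KV: "K \<subseteq> V n"
    proof
      fix x assume "x \<in> K"
      then obtain j where "j \<in> C" "x \<in> V j" using C by blast
      moreover from \<open>j \<in> C\<close> have "j \<le> n" unfolding n_def using C by (intro Max_ge) auto
      ultimately show "x \<in> V n" using V_mono by blast
    qed
    define q where "q i x = min (f x) (real n * d i x)" for i x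
    have cq: "continuous_on S (q i)" for i
      unfolding q_def by (intro continuous_intros cf continuous_on_subset[OF cd]) auto
    have "q i x = 0" if "x \<in> S" "x \<notin> U i" for i x
      using f01[OF that(1)] dU[of i x] d0[of i x] that(2) by (auto simp: q_def)
    then have qt: "q i \<in> tests (U i)" for i
      using cq[of i] f01 d0 by (auto simp: tests_def q_def min_le_iff_disj)
    have "f x \<le> e + (\<Sum>i<n. q i x)" if x: "x \<in> S" for x
    proof (cases "x \<in> K")
      case False
      have "0 \<le> (\<Sum>i<n. q i x)"
        using qt x by (intro sum_nonneg) (auto simp: tests_def)
      with False x show ?thesis by (auto simp: K_def)
    next
      case True
      with KV have *: "1 < real n * (\<Sum>i<n. d i x)" by (auto simp: V_def)
      have "f x \<le> (\<Sum>i<n. q i x)"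
      proof (cases "\<exists>i<n. f x \<le> real n * d i x")
        case True
        then obtain i where "i < n" "f x \<le> real n * d i x" by blast
        then have "f x = q i x" by (simp add: q_def)
        also have "\<dots> \<le> (\<Sum>i<n. q i x)"
          using qt x \<open>i < n\<close> by (intro member_le_sum) (auto simp: tests_def)
        finally show ?thesis .
      next
        case False
        then have "(\<Sum>i<n. q i x) = (\<Sum>i<n. real n * d i x)"
          by (intro sum.cong) (auto simp: q_def min_def)
        with * f01[OF x] show ?thesis by (simp add: sum_distrib_left)
      qed
      with e show ?thesis by simp
    qed
    then have "L f \<le> L (\<lambda>x. e + (\<Sum>i<n. q i x))"
      by (intro mono cf continuous_intros cq)
    also have "\<dots> = e + (\<Sum>i<n. L (q i))"
      by (subst add) (auto intro!: continuous_intros cq simp: L_const L_sum[OF cq])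
    finally have "ennreal (L f) \<le> ennreal (e + (\<Sum>i<n. L (q i)))" by (rule ennreal_leI)
    also have "\<dots> = ennreal e + (\<Sum>i<n. ennreal (L (q i)))"
      using e tests_L(1)[OF qt] by (simp add: sum_nonneg)
    also have "\<dots> \<le> ennreal e + (\<Sum>i<n. content (U i))"
      by (intro add_left_mono sum_mono content_upper qt)
    also have "\<dots> \<le> ennreal e + (\<Sum>i. content (U i))"
      by (intro add_left_mono sum_le_suminf) auto
    finally show "ennreal (L f) \<le> (\<Sum>i. content (U i)) + ennreal e" by (simp add: add.commute)
  qed
qed

lemma outer_measure_space_outer: "outer_measure_space (Pow S) outer"
  unfolding outer_measure_space_def
proof (intro conjI)
  show "positive (Pow S) outer" by (simp add: positive_def outer_empty)
  show "increasing (Pow S) outer" by (auto simp: increasing_def intro: outer_mono)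
  show "countably_subadditive (Pow S) outer"
    unfolding countably_subadditive_def
  proof safe
    fix A :: "nat \<Rightarrow> 'a set"
    show "outer (\<Union>i. A i) \<le> (\<Sum>i. outer (A i))"
    proof (rule ennreal_le_epsilon)
      fix e :: real assume e: "0 < e"
      have "\<exists>U. open U \<and> A i \<subseteq> U \<and> content U \<le> outer (A i) + ennreal (e * (1/2)^Suc i)" for i
        using outer_close[of "e * (1/2)^Suc i" "A i"] e by (metis mult_pos_pos zero_less_power half_gt_zero_iff zero_less_one)
      then obtain U where U: "\<And>i. open (U i)" "\<And>i. A i \<subseteq> U i"
        "\<And>i. content (U i) \<le> outer (A i) + ennreal (e * (1/2)^Suc i)" by metis
      have "outer (\<Union>i. A i) \<le> content (\<Union>i. U i)"
        using U by (intro outer_lower) auto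
      also have "\<dots> \<le> (\<Sum>i. content (U i))"
        by (rule content_countably_subadditive) (rule U)
      also have "\<dots> \<le> (\<Sum>i. outer (A i) + ennreal (e * (1/2)^Suc i))"
        by (intro suminf_le U) auto
      also have "\<dots> = (\<Sum>i. outer (A i)) + (\<Sum>i. ennreal (e * (1/2)^Suc i))"
        by (rule suminf_add[symmetric]) auto
      also have "(\<Sum>i. ennreal (e * (1/2)^Suc i)) = ennreal e"
      proof (rule suminf_ennreal_eq)
        show "(\<lambda>i. e * (1/2)^Suc i) sums e"
          using sums_mult[OF power_half_series, of e] by simp
      qed (use e in auto)
      finally show "outer (\<Union>i. A i) \<le> (\<Sum>i. outer (A i)) + ennreal e" .
    qed
  qed
qed

text \<open>Caratheodory's condition for open sets: the part of \<open>f\<close> above level \<open>e\<close> lives on a closed set \<open>K\<close>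
  inside \<open>A \<inter> U\<close>, so that it can be added to any test function of \<open>A - K\<close> without exceeding 1.\<close>

lemma content_split:
  assumes "open A" "open U"
  shows "content (A \<inter> U) + outer (S \<inter> (A - U)) \<le> content A"
proof -
  have "ennreal (L f) + outer (S \<inter> (A - U)) \<le> content A" if f: "f \<in> tests (A \<inter> U)" for f
  proof (rule ennreal_le_epsilon)
    fix e :: real assume e: "0 < e"
    have cf: "continuous_on S f" and f01: "\<And>x. x \<in> S \<Longrightarrow> 0 \<le> f x \<and> f x \<le> 1"
      and f0: "\<And>x. x \<in> S \<Longrightarrow> x \<notin> A \<inter> U \<Longrightarrow> f x = 0"
      using f by (auto simp: tests_def)
    define K where "K = S \<inter> f -` {e..}"
    have "closedin (top_of_set S) K"
      unfolding K_def by (rule continuous_closedin_preimage[OF cf]) auto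
    then have "closed K"
      using closedin_compact[OF compact] compact_imp_closed by blast
    then have oAK: "open (A - K)" using assms by auto
    have sub: "S \<inter> (A - U) \<subseteq> A - K" using f0 e by (auto simp: K_def)
    have "ennreal (L f) + ennreal (L h) \<le> content A + ennreal e" if h: "h \<in> tests (A - K)" for h
    proof -
      define p where "p x = max (f x - e) 0" for x
      have cp: "continuous_on S p" unfolding p_def by (intro continuous_intros cf)
      have ch: "continuous_on S h" using h by (simp add: tests_def)
      have "(\<lambda>x. p x + h x) \<in> tests A"
        unfolding tests_def
      proof (intro CollectI conjI ballI)
        show "continuous_on S (\<lambda>x. p x + h x)" by (intro continuous_intros cp ch)
        fix x assume x: "x \<in> S"
        have h01: "0 \<le> h x" "h x \<le> 1" using h x by (auto simp: tests_def)
        show "0 \<le> p x + h x" using h01 by (simp add: p_def)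
        show "p x + h x \<le> 1"
        proof (cases "x \<in> K")
          case True
          then have "h x = 0" using h x by (auto simp: tests_def)
          then show ?thesis using f01[OF x] e by (auto simp: p_def)
        next
          case False
          then show ?thesis using x h01 by (auto simp: p_def K_def)
        qed
      next
        fix x assume x: "x \<in> S - A"
        then show "p x + h x = 0" using h f0[of x] e by (auto simp: p_def tests_def)
      qed
      then have "ennreal (L p + L h) \<le> content A"
        using content_upper add[OF cp ch] by metis
      moreover have "L f \<le> L p + e"
      proof -
        have "L f \<le> L (\<lambda>x. p x + e)"
          by (intro mono cf continuous_intros cp) (auto simp: p_def)
        then show ?thesis using add[OF cp, of "\<lambda>_. e"] by (simp add: L_const)
      qed
      moreover have "0 \<le> L p"
        using mono[of "\<lambda>_. 0" p] cp by (auto simp: p_def L_const)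
      moreover have "0 \<le> L h" "0 \<le> L f" using tests_L(1) h f by auto
      ultimately have "ennreal (L f + L h) \<le> ennreal (L p + L h) + ennreal e"
        using e by (simp flip: ennreal_plus)
      also have "\<dots> \<le> content A + ennreal e"
        by (intro add_right_mono) fact
      finally show ?thesis using \<open>0 \<le> L h\<close> \<open>0 \<le> L f\<close> by simp
    qed
    then have "ennreal (L f) + content (A - K) \<le> content A + ennreal e"
      unfolding content_def[of "A - K"]
      using zero_tests[of "A - K"] by (subst ennreal_SUP_add_right) (auto intro!: SUP_least)
    then show "ennreal (L f) + outer (S \<inter> (A - U)) \<le> content A + ennreal e"
      using outer_lower[OF oAK sub] by (meson add_left_mono order_trans)
  qed
  then show ?thesis
    unfolding content_def[of "A \<inter> U"]
    using zero_tests[of "A \<inter> U"] by (subst ennreal_SUP_add_left[symmetric]) (auto intro!: SUP_least)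
qed

lemma open_in_lambda_system:
  assumes U: "open U"
  shows "S \<inter> U \<in> lambda_system S (Pow S) outer"
  unfolding lambda_system_def
proof (intro CollectI conjI ballI)
  show "S \<inter> U \<in> Pow S" by auto
  fix x assume "x \<in> Pow S"
  then have x: "x \<subseteq> S" by auto
  show "outer (S \<inter> U \<inter> x) + outer ((S - S \<inter> U) \<inter> x) = outer x"
  proof (rule antisym)
    show "outer (S \<inter> U \<inter> x) + outer ((S - S \<inter> U) \<inter> x) \<le> outer x"
      unfolding outer_def[of x]
    proof (rule INF_greatest)
      fix A assume "A \<in> {U. open U \<and> x \<subseteq> U}"
      then have A: "open A" "x \<subseteq> A" by auto
      have "outer (S \<inter> U \<inter> x) \<le> content (A \<inter> U)"
        using A U by (intro outer_lower) auto
      moreover have "outer ((S - S \<inter> U) \<inter> x) \<le> outer (S \<inter> (A - U))"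
        using A by (intro outer_mono) auto
      ultimately have "outer (S \<inter> U \<inter> x) + outer ((S - S \<inter> U) \<inter> x)
          \<le> content (A \<inter> U) + outer (S \<inter> (A - U))" by (rule add_mono)
      also have "\<dots> \<le> content A" by (rule content_split[OF A(1) U])
      finally show "outer (S \<inter> U \<inter> x) + outer ((S - S \<inter> U) \<inter> x) \<le> content A" .
    qed
    interpret ring_of_sets S "Pow S" by (rule ring_of_sets_Pow)
    have "subadditive (Pow S) outer"
      using outer_measure_space_outer countably_subadditive_subadditive
      by (auto simp: outer_measure_space_def)
    then have "outer ((S \<inter> U \<inter> x) \<union> ((S - S \<inter> U) \<inter> x)) \<le> outer (S \<inter> U \<inter> x) + outer ((S - S \<inter> U) \<inter> x)"
      by (rule subadditiveD) auto
    moreover have "(S \<inter> U \<inter> x) \<union> ((S - S \<inter> U) \<inter> x) = x" using x by auto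
    ultimately show "outer x \<le> outer (S \<inter> U \<inter> x) + outer ((S - S \<inter> U) \<inter> x)" by simp
  qed
qed

text \<open>To see that the measure represents \<open>L\<close>, cut \<open>f\<close> with values in \<open>[0, 1]\<close> into \<open>n\<close> horizontal
  layers of height \<open>1 / n\<close>. Each layer, rescaled, is a test function of a superlevel set, which gives
  \<open>L f \<le> \<integral>f\<close> up to \<open>1 / n\<close>; the same for \<open>1 - f\<close> gives equality.\<close>

theorem representing_measure:
  obtains \<kappa> where "\<kappa> \<in> prob_measures_on S" "\<And>f. continuous_on S f \<Longrightarrow> (\<integral>x. f x \<partial>\<kappa>) = L f"
proof -
  interpret sigma_algebra S "Pow S" by (rule sigma_algebra_Pow)
  let ?\<Lambda> = "lambda_system S (Pow S) outer"
  let ?B = "restrict_space borel S :: 'a measure"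
  have ms: "measure_space S ?\<Lambda> outer"
    by (rule caratheodory_lemma[OF outer_measure_space_outer])
  then interpret L: sigma_algebra S ?\<Lambda> by (simp add: measure_space_def)
  have "S \<inter> A \<in> ?\<Lambda>" if "A \<in> sets borel" for A
  proof -
    have "A \<in> sigma_sets UNIV {U. open U}" using that by (simp add: borel_def)
    then show ?thesis
    proof induction
      case (Basic U)
      then show ?case using open_in_lambda_system by auto
    next
      case Empty
      show ?case by (simp add: L.empty_sets)
    next
      case (Compl A)
      have "S \<inter> (UNIV - A) = S - (S \<inter> A)" by auto
      with Compl show ?case by auto
    next
      case (Union A)
      have "S \<inter> (\<Union>i. A i) = (\<Union>i. S \<inter> A i)" by auto
      with Union show ?case using L.countable_nat_UN[of "\<lambda>i. S \<inter> A i"] by auto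
    qed
  qed
  then have sub: "sets ?B \<subseteq> ?\<Lambda>" by (auto simp: sets_restrict_space)
  have spB: "space ?B = S" by (simp add: space_restrict_space)
  define \<kappa> where "\<kappa> = measure_of S (sets ?B) outer"
  have setsB: "sigma_algebra S (sets ?B)" using sets.sigma_algebra_axioms[of ?B] by (simp add: spB)
  have ms': "measure_space S (sets ?B) outer"
    by (rule measure_down[OF ms setsB sub])
  have sp: "space \<kappa> = S" and sets: "sets \<kappa> = sets ?B"
    using setsB sigma_algebra.sets_measure_of_eq[OF setsB]
    by (auto simp: \<kappa>_def space_measure_of_conv)
  have em: "emeasure \<kappa> A = outer A" if "A \<in> sets ?B" for A
    unfolding \<kappa>_def using ms' that setsB
    by (intro emeasure_measure_of_sigma) (auto simp: measure_space_def)
  have em_open: "emeasure \<kappa> (S \<inter> U) = content U" if "open U" for U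
    using em[of "S \<inter> U"] outer_open[OF that] that by (auto simp: sets_restrict_space)
  have "emeasure \<kappa> (space \<kappa>) = 1"
    using em_open[of UNIV] by (simp add: sp content_UNIV)
  then interpret K: prob_space \<kappa> by (rule prob_spaceI)
  have meas: "f \<in> borel_measurable \<kappa>" if "continuous_on S f" for f :: "'a \<Rightarrow> real"
    using borel_measurable_continuous_on_restrict[OF that] measurable_cong_sets[OF sets refl, of borel] by auto
  have int: "integrable \<kappa> f" if cf: "continuous_on S f" for f :: "'a \<Rightarrow> real"
  proof -
    obtain B where B: "\<forall>x\<in>S. norm (f x) \<le> B"
      using compact_imp_bounded[OF compact_continuous_image[OF cf compact]]
      by (auto simp: bounded_iff)
    then show ?thesis
      by (intro K.integrable_const_bound[of _ B] meas cf) (auto simp: sp)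
  qed
  have le: "L f \<le> (\<integral>x. f x \<partial>\<kappa>)" if cf: "continuous_on S f" and f01: "\<And>x. x \<in> S \<Longrightarrow> 0 \<le> f x \<and> f x \<le> 1" for f
  proof (rule field_le_epsilon)
    fix e :: real assume e: "0 < e"
    obtain m where m: "inverse (real (Suc m)) < e" using reals_Archimedean[OF e] by blast
    define n where "n = Suc m"
    have n: "0 < real n" "1 / real n < e" using m by (auto simp: n_def inverse_eq_divide)
    define q where "q i x = min (max (f x - real i / n) 0) (1 / n)" for i x
    have cq: "continuous_on S (q i)" for i unfolding q_def by (intro continuous_intros cf)
    \<comment> \<open>The layers of \<open>f\<close> between the heights \<open>i / n\<close> and \<open>(i + 1) / n\<close> add up to \<open>f\<close>.\<close>
    have sum_q: "(\<Sum>i<j. q i x) = min (f x) (real j / n)" if "x \<in> S" for x j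
    proof (induction j)
      case 0
      then show ?case using f01[OF that] by simp
    next
      case (Suc j)
      have "min t b + min (max (t - b) 0) a = min t (a + b)" if "0 < a" for t a b :: real
        using that by (auto simp: min_def max_def)
      from this[of "1 / real n" "f x" "real j / real n"] Suc n show ?case
        by (simp add: q_def add_divide_distrib)
    qed
    have "\<exists>V. open V \<and> S \<inter> V = {x\<in>S. real i / n < f x}" for i
    proof -
      have "openin (top_of_set S) (S \<inter> f -` {real i / n <..})"
        by (rule continuous_openin_preimage_gen[OF cf]) auto
      then obtain V where "open V" "S \<inter> f -` {real i / n <..} = S \<inter> V"
        by (auto simp: openin_open)
      then show ?thesis by (intro exI[of _ V]) auto
    qed
    then obtain V where V: "\<And>i. open (V i)" "\<And>i. S \<inter> V i = {x\<in>S. real i / n < f x}" by metis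
    have Vs: "S \<inter> V i \<in> K.events" for i using V(1) by (auto simp: sets sets_restrict_space)
    have Lq: "L (q i) \<le> measure \<kappa> (S \<inter> V i) / n" for i
    proof -
      have "(\<lambda>x. real n * q i x) \<in> tests (V i)"
        unfolding tests_def
      proof (intro CollectI conjI ballI)
        show "continuous_on S (\<lambda>x. real n * q i x)" by (intro continuous_intros cq)
        fix x
        show "0 \<le> real n * q i x" using n by (auto simp: q_def)
        have "q i x \<le> 1 / n" by (auto simp: q_def)
        then show "real n * q i x \<le> 1" using n by (simp add: field_simps)
      next
        fix x assume x: "x \<in> S - V i"
        then have "x \<notin> {x\<in>S. real i / n < f x}" unfolding V(2)[symmetric] by blast
        with x have "f x \<le> real i / n" by simp
        then have "max (f x - real i / n) 0 = 0" by simp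
        then show "real n * q i x = 0" by (simp add: q_def)
      qed
      from content_upper[OF this] have "ennreal (real n * L (q i)) \<le> emeasure \<kappa> (S \<inter> V i)"
        by (simp add: em_open[OF V(1)] scale[OF cq])
      then have "real n * L (q i) \<le> measure \<kappa> (S \<inter> V i)"
        by (simp add: K.emeasure_eq_measure)
      then show ?thesis using n by (simp add: field_simps)
    qed
    have ind: "(\<Sum>i<j. if real i / n < t then 1 else 0 :: real) \<le> min (real j) (real n * t + 1)" if "0 \<le> t" for t j
    proof (induction j)
      case 0
      show ?case using that by simp
    next
      case (Suc j)
      show ?case
      proof (cases "real j / n < t")
        case True
        then have "real j < real n * t" using n by (simp add: field_simps)
        then show ?thesis using Suc True by auto
      qed (use Suc in auto)
    qed
    have "L f = L (\<lambda>x. \<Sum>i<n. q i x)"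
      using sum_q[of _ n] f01 n by (intro antisym mono cf continuous_intros cq) auto
    also have "\<dots> = (\<Sum>i<n. L (q i))" by (rule L_sum[OF cq])
    also have "\<dots> \<le> (\<Sum>i<n. measure \<kappa> (S \<inter> V i) / n)" by (intro sum_mono Lq)
    also have "\<dots> = (\<integral>x. (\<Sum>i<n. indicator (S \<inter> V i) x / n) \<partial>\<kappa>)"
      using Vs by (subst Bochner_Integration.integral_sum) (auto simp: K.emeasure_eq_measure)
    also have "\<dots> \<le> (\<integral>x. f x + 1 / n \<partial>\<kappa>)"
    proof (rule integral_mono)
      show "integrable \<kappa> (\<lambda>x. \<Sum>i<n. indicator (S \<inter> V i) x / n)"
        using Vs by (auto simp: K.emeasure_eq_measure)
      show "integrable \<kappa> (\<lambda>x. f x + 1 / n)" using int[OF cf] by auto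
      fix x assume "x \<in> space \<kappa>"
      then have x: "x \<in> S" by (simp add: sp)
      have "(\<Sum>i<n. indicator (S \<inter> V i) x / n) = (\<Sum>i<n. if real i / n < f x then 1 else 0) / n"
        unfolding V(2) using x by (auto simp: sum_divide_distrib indicator_def intro!: sum.cong)
      also have "\<dots> \<le> (real n * f x + 1) / real n"
        using ind[of "f x" n] f01[OF x] n by (intro divide_right_mono) auto
      also have "\<dots> = f x + 1 / n" using n by (simp add: field_simps)
      finally show "(\<Sum>i<n. indicator (S \<inter> V i) x / n) \<le> f x + 1 / n" .
    qed
    also have "\<dots> = (\<integral>x. f x \<partial>\<kappa>) + 1 / n"
      using int[OF cf] by (simp add: K.prob_space)
    finally show "L f \<le> (\<integral>x. f x \<partial>\<kappa>) + e" using n by simp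
  qed
  have eq01: "L f = (\<integral>x. f x \<partial>\<kappa>)" if cf: "continuous_on S f" and f01: "\<And>x. x \<in> S \<Longrightarrow> 0 \<le> f x \<and> f x \<le> 1" for f
  proof -
    have "L (\<lambda>x. 1 - f x) \<le> (\<integral>x. 1 - f x \<partial>\<kappa>)"
      using f01 by (intro le continuous_intros cf) auto
    then have "(\<integral>x. f x \<partial>\<kappa>) \<le> L f"
      using L_diff[of "\<lambda>_. 1" f] cf int[OF cf] by (simp add: L_const K.prob_space)
    with le[OF that] show ?thesis by simp
  qed
  have "(\<integral>x. f x \<partial>\<kappa>) = L f" if cf: "continuous_on S f" for f
  proof -
    obtain B where B0: "0 < B" and B: "\<forall>x\<in>S. norm (f x) \<le> B"
      using compact_imp_bounded[OF compact_continuous_image[OF cf compact]]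
      by (auto simp: bounded_pos)
    define h where "h x = (f x + B) / (2 * B)" for x
    have ch: "continuous_on S h" unfolding h_def using B0 by (intro continuous_intros cf) auto
    have f_eq: "f = (\<lambda>x. 2 * B * h x - B)" using B0 by (auto simp: h_def fun_eq_iff)
    have *: "L h = (\<integral>x. h x \<partial>\<kappa>)"
    proof (rule eq01[OF ch])
      fix x assume "x \<in> S"
      then have "\<bar>f x\<bar> \<le> B" using B by auto
      then show "0 \<le> h x \<and> h x \<le> 1" using B0 by (auto simp: h_def field_simps abs_le_iff)
    qed
    have "L f = 2 * B * L h - B"
      unfolding f_eq using L_diff[of "\<lambda>x. 2 * B * h x" "\<lambda>_. B"] scale[OF ch, of "2 * B"] ch
      by (simp add: L_const continuous_intros)
    moreover have "(\<integral>x. f x \<partial>\<kappa>) = 2 * B * (\<integral>x. h x \<partial>\<kappa>) - B"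
      unfolding f_eq using int[OF ch] by (simp add: K.prob_space)
    ultimately show ?thesis using * by simp
  qed
  moreover have "\<kappa> \<in> prob_measures_on S"
    using K.prob_space_axioms sets by (simp add: prob_measures_on_def)
  ultimately show ?thesis using that by blast
qed

end

section \<open>Compactness of the probability measures\<close>

lemma compact_bounded_functionals:
  fixes B :: "'i \<Rightarrow> real"
  shows "compact {L. \<forall>i. L i \<in> {- B i..B i}}"
proof -
  have "compactin (product_topology (\<lambda>i. euclideanreal) UNIV) (PiE UNIV (\<lambda>i. {- B i..B i}))"
    unfolding compactin_PiE by auto
  moreover have "PiE UNIV (\<lambda>i. {- B i..B i}) = {L. \<forall>i. L i \<in> {- B i..B i}}"
    by (auto simp: PiE_def)
  ultimately show ?thesis
    by (simp add: euclidean_product_topology)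
qed

text \<open>Weak compactness in the form in which it is needed: if every finite set of test functions can be
  almost annihilated by some probability measure, then one probability measure annihilates all of
  them. The functionals whose value at \<open>f\<close> respects a bound of \<open>f\<close> on \<open>S\<close> form a compact set in the
  product topology, the linear positive normalized ones a closed subset of it, and each condition
  \<open>\<bar>L f\<bar> \<le> e\<close> is closed as well; so the finite intersection property produces a functional, and
  \<open>representing_measure\<close> turns it into a measure.\<close>

theorem compactness_of_prob_measures:
  fixes S :: "'a::metric_space set"
    and C :: "('a \<Rightarrow> real) set"
  assumes S: "compact S" and C: "\<And>f. f \<in> C \<Longrightarrow> continuous_on S f"
    and fin: "\<And>F e. finite F \<Longrightarrow> F \<subseteq> C \<Longrightarrow> 0 < e \<Longrightarrow>
      \<exists>\<kappa>\<in>prob_measures_on S. \<forall>f\<in>F. \<bar>\<integral>x. f x \<partial>\<kappa>\<bar> \<le> e"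
  shows "\<exists>\<kappa>\<in>prob_measures_on S. \<forall>f\<in>C. (\<integral>x. f x \<partial>\<kappa>) = 0"
proof -
  let ?c = "\<lambda>f :: 'a \<Rightarrow> real. continuous_on S f"
  have "\<exists>B. ?c f \<longrightarrow> (\<forall>x\<in>S. \<bar>f x\<bar> \<le> B)" for f
    using compact_imp_bounded[OF compact_continuous_image[OF _ S], of f]
    by (auto simp: bounded_iff)
  then obtain B where B: "\<And>f x. ?c f \<Longrightarrow> x \<in> S \<Longrightarrow> \<bar>f x\<bar> \<le> B f" by metis
  define K where "K = {L. \<forall>f. L f \<in> {- \<bar>B f\<bar>..\<bar>B f\<bar>}}"
  define A where "A = {(f, h). ?c f \<and> ?c h}"
  define P where "P = {(f, h). ?c f \<and> ?c h \<and> (\<forall>x\<in>S. f x \<le> h x)}"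
  define K0 where "K0 = K \<inter> ((\<Inter>(f, h)\<in>A. {L. L (\<lambda>x. f x + h x) = L f + L h})
    \<inter> (\<Inter>(c, f)\<in>{(c, f). ?c f}. {L. L (\<lambda>x. c * f x) = c * L f})
    \<inter> (\<Inter>(f, h)\<in>P. {L. L f \<le> L h}) \<inter> {L. L (\<lambda>_. 1) = 1})"
  have [continuous_intros]: "continuous_on UNIV (\<lambda>L :: ('a \<Rightarrow> real) \<Rightarrow> real. L f)" for f
    by (rule continuous_on_product_coordinates)
  have K0: "compact K0"
    unfolding K0_def K_def
    by (intro compact_Int_closed compact_bounded_functionals closed_Int closed_INT ballI)
       (auto intro!: closed_Collect_eq closed_Collect_le continuous_intros)
  define T where "T \<kappa> f = (if ?c f then (\<integral>x. f x \<partial>\<kappa>) else 0)" for \<kappa> and f :: "'a \<Rightarrow> real"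
  have T: "T \<kappa> \<in> K0" if \<kappa>: "\<kappa> \<in> prob_measures_on S" for \<kappa>
  proof -
    interpret prob_space \<kappa> using \<kappa> by (simp add: prob_measures_on_def)
    have sets: "sets \<kappa> = sets (restrict_space borel S)" using \<kappa> by (simp add: prob_measures_on_def)
    have sp: "space \<kappa> = S" using sets_eq_imp_space_eq[OF sets] by (simp add: space_restrict_space)
    have int: "integrable \<kappa> f" if "?c f" for f
      using B[OF that] borel_measurable_continuous_on_restrict[OF that]
      by (intro integrable_const_bound[of _ "B f"])
         (auto simp: sp measurable_cong_sets[OF sets refl])
    have "\<bar>\<integral>x. f x \<partial>\<kappa>\<bar> \<le> \<bar>B f\<bar>" if "?c f" for f
    proof -
      have "\<bar>\<integral>x. f x \<partial>\<kappa>\<bar> \<le> (\<integral>x. \<bar>f x\<bar> \<partial>\<kappa>)" by (rule integral_abs_bound)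
      also have "\<dots> \<le> (\<integral>x. \<bar>B f\<bar> \<partial>\<kappa>)"
        using int[OF that] B[OF that] by (intro integral_mono) (auto simp: sp abs_le_iff order_trans[OF _ abs_ge_self])
      finally show ?thesis by (simp add: prob_space)
    qed
    then have "T \<kappa> \<in> K"
      unfolding K_def T_def by (auto simp: abs_le_iff) (smt (verit))+
    then show ?thesis
      by (auto simp: K0_def T_def A_def P_def sp prob_space[unfolded sp] int continuous_intros intro!: integral_mono)
  qed
  define G where "G = (\<lambda>(f :: 'a \<Rightarrow> real, e :: real). {L :: ('a \<Rightarrow> real) \<Rightarrow> real. \<bar>L f\<bar> \<le> e})"
  have "K0 \<inter> (\<Inter>i\<in>C \<times> {0<..}. G i) \<noteq> {}"
  proof (rule compact_imp_fip_image[OF K0])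
    fix i :: "('a \<Rightarrow> real) \<times> real"
    show "closed (G i)"
      by (cases i) (auto simp: G_def intro!: closed_Collect_le continuous_intros)
  next
    fix I' assume I': "finite I'" "I' \<subseteq> C \<times> {0::real<..}"
    define e where "e = Min (insert 1 (snd ` I'))"
    have "0 < e" using I' by (auto simp: e_def)
    then obtain \<kappa> where \<kappa>: "\<kappa> \<in> prob_measures_on S" "\<forall>f\<in>fst ` I'. \<bar>\<integral>x. f x \<partial>\<kappa>\<bar> \<le> e"
      using fin[of "fst ` I'" e] I' by fastforce
    have "\<bar>T \<kappa> f\<bar> \<le> a" if "(f, a) \<in> I'" for f a
    proof -
      have "e \<le> a" unfolding e_def using I' that by (intro Min_le) force+
      moreover have "\<bar>T \<kappa> f\<bar> \<le> e" using \<kappa>(2) that C[of f] I' by (force simp: T_def)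
      ultimately show ?thesis by simp
    qed
    then have "T \<kappa> \<in> K0 \<inter> (\<Inter>i\<in>I'. G i)" using T[OF \<kappa>(1)] by (auto simp: G_def)
    then show "K0 \<inter> (\<Inter>i\<in>I'. G i) \<noteq> {}" by blast
  qed
  then obtain L where L: "L \<in> K0" "\<And>f e. f \<in> C \<Longrightarrow> 0 < e \<Longrightarrow> \<bar>L f\<bar> \<le> e" unfolding G_def by blast
  interpret positive_functional S L
    using L(1) S by unfold_locales (auto simp: K0_def A_def P_def)
  obtain \<kappa> where \<kappa>: "\<kappa> \<in> prob_measures_on S" "\<And>f. ?c f \<Longrightarrow> (\<integral>x. f x \<partial>\<kappa>) = L f"
    using representing_measure by blast
  have "L f = 0" if "f \<in> C" for f
    using L(2)[OF that] by (meson abs_ge_zero abs_le_zero_iff dense_ge order_antisym)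
  then show ?thesis using \<kappa> C by (intro bexI[of _ \<kappa>]) simp_all
qed

section \<open>Probability measures on a subspace\<close>

lemma space_prob_measures_on: "\<kappa> \<in> prob_measures_on S \<Longrightarrow> space \<kappa> = S"
  using sets_eq_imp_space_eq[of \<kappa> "restrict_space borel S"]
  by (simp add: prob_measures_on_def space_restrict_space)

lemma measurable_prob_measures_on:
  assumes "\<kappa> \<in> prob_measures_on S" "continuous_on S f"
  shows "f \<in> borel_measurable \<kappa>"
  using borel_measurable_continuous_on_restrict[OF assms(2)] assms(1)
  by (simp add: prob_measures_on_def cong: measurable_cong_sets)

lemma integrable_prob_measures_on:
  fixes f :: "'a::topological_space \<Rightarrow> real"
  assumes \<kappa>: "\<kappa> \<in> prob_measures_on S" and S: "compact S" and f: "continuous_on S f"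
  shows "integrable \<kappa> f"
proof -
  interpret prob_space \<kappa> using \<kappa> by (simp add: prob_measures_on_def)
  obtain B where "\<forall>x\<in>S. norm (f x) \<le> B"
    using compact_imp_bounded[OF compact_continuous_image[OF f S]] by (auto simp: bounded_iff)
  then show ?thesis
    using measurable_prob_measures_on[OF \<kappa> f] space_prob_measures_on[OF \<kappa>]
    by (intro integrable_const_bound[of _ B]) auto
qed

text \<open>Closed sets generate the Borel sets, and the indicator of a closed set is the limit of the continuous
  functions \<open>max 0 (1 - n * infdist x C)\<close>.\<close>

lemma prob_measures_on_eqI:
  fixes S :: "'a::metric_space set"
  assumes k1: "\<kappa>\<^sub>1 \<in> prob_measures_on S" and k2: "\<kappa>\<^sub>2 \<in> prob_measures_on S"
    and eq: "\<And>f :: 'a \<Rightarrow> real. continuous_on S f \<Longrightarrow> (\<And>x. 0 \<le> f x \<and> f x \<le> 1) \<Longrightarrow>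
      (\<integral>x. f x \<partial>\<kappa>\<^sub>1) = (\<integral>x. f x \<partial>\<kappa>\<^sub>2)"
  shows "\<kappa>\<^sub>1 = \<kappa>\<^sub>2"
proof (rule measure_eqI_generator_eq[where E = "{S \<inter> C | C. closed C}" and \<Omega> = S and A = "\<lambda>_. S"])
  show "Int_stable {S \<inter> C | C. closed C}"
  proof (rule Int_stableI)
    fix a b assume "a \<in> {S \<inter> C | C. closed C}" "b \<in> {S \<inter> C | C. closed C}"
    then obtain C D where "a = S \<inter> C" "b = S \<inter> D" "closed C" "closed D" by blast
    then show "a \<inter> b \<in> {S \<inter> C | C. closed C}"
      by (intro CollectI exI[of _ "C \<inter> D"]) auto
  qed
  show "{S \<inter> C | C. closed C} \<subseteq> Pow S" by auto
  have "sets (restrict_space (borel :: 'a measure) S) = sigma_sets S ((\<inter>) S ` Collect closed)"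
  proof -
    have "sets (restrict_space (borel :: 'a measure) S)
        = {(\<lambda>x. x) -` A \<inter> S | A. A \<in> sigma_sets UNIV (Collect closed)}"
      by (auto simp: sets_restrict_space borel_eq_closed sets_measure_of)
    also have "\<dots> = sigma_sets S {(\<lambda>x. x) -` A \<inter> S | A. A \<in> Collect closed}"
      by (rule sigma_sets_vimage_commute) auto
    also have "{(\<lambda>x. x) -` A \<inter> S | A. A \<in> Collect closed} = (\<inter>) S ` Collect closed" by auto
    finally show ?thesis .
  qed
  moreover have "(\<inter>) S ` Collect closed = {S \<inter> C | C. closed C}" by auto
  ultimately have sets: "sets (restrict_space (borel :: 'a measure) S) = sigma_sets S {S \<inter> C | C. closed C}" by simp
  then show "sets \<kappa>\<^sub>1 = sigma_sets S {S \<inter> C | C. closed C}" "sets \<kappa>\<^sub>2 = sigma_sets S {S \<inter> C | C. closed C}"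
    using k1 k2 by (auto simp: prob_measures_on_def)
  interpret K1: prob_space \<kappa>\<^sub>1 using k1 by (simp add: prob_measures_on_def)
  interpret K2: prob_space \<kappa>\<^sub>2 using k2 by (simp add: prob_measures_on_def)
  have sp: "space \<kappa>\<^sub>1 = S" "space \<kappa>\<^sub>2 = S" using k1 k2 by (auto simp: space_prob_measures_on)
  show "(\<Union>i. S) = S" by simp
  show "range (\<lambda>_. S) \<subseteq> {S \<inter> C | C. closed C}" by (auto intro: exI[of _ UNIV])
  show "emeasure \<kappa>\<^sub>1 S \<noteq> \<infinity>" by simp
  fix X assume "X \<in> {S \<inter> C | C. closed C}"
  then obtain C where C: "closed C" and X: "X = S \<inter> C" by blast
  show "emeasure \<kappa>\<^sub>1 X = emeasure \<kappa>\<^sub>2 X"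
  proof (cases "C = {}")
    case False
    define f where "f n x = max 0 (1 - real n * infdist x C)" for n x
    have cf: "continuous_on S (f n)" for n unfolding f_def by (intro continuous_intros)
    have f01: "0 \<le> f n x \<and> f n x \<le> 1" for n x by (auto simp: f_def infdist_nonneg)
    have lim: "(\<lambda>n. f n x) \<longlonglongrightarrow> indicator C x" for x
    proof (cases "x \<in> C")
      case True
      then show ?thesis by (simp add: f_def)
    next
      case False
      then have "0 < infdist x C"
        using in_closed_iff_infdist_zero[OF C \<open>C \<noteq> {}\<close>, of x] infdist_nonneg[of x C] by linarith
      then obtain N where N: "1 < real N * infdist x C" using ex_less_of_nat_mult by blast
      have "f n x = 0" if "N \<le> n" for n
      proof -
        have "real N * infdist x C \<le> real n * infdist x C"
          using that infdist_nonneg by (intro mult_right_mono) auto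
        with N show ?thesis by (simp add: f_def)
      qed
      then show ?thesis
        using False by (intro tendsto_eventually) (auto simp: eventually_sequentially)
    qed
    have conv: "(\<lambda>n. \<integral>x. f n x \<partial>\<kappa>) \<longlonglongrightarrow> measure \<kappa> X" if k: "\<kappa> \<in> prob_measures_on S" for \<kappa>
    proof -
      interpret prob_space \<kappa> using k by (simp add: prob_measures_on_def)
      have sp: "space \<kappa> = S" by (rule space_prob_measures_on[OF k])
      have Xs: "X \<in> sets \<kappa>" using k C X by (auto simp: prob_measures_on_def sets_restrict_space)
      have "(\<lambda>n. \<integral>x. f n x \<partial>\<kappa>) \<longlonglongrightarrow> (\<integral>x. indicator X x \<partial>\<kappa>)"
      proof (rule integral_dominated_convergence[where w = "\<lambda>_. 1"])
        show "AE x in \<kappa>. (\<lambda>n. f n x) \<longlonglongrightarrow> indicator X x"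
        proof (rule AE_I2)
          fix x assume "x \<in> space \<kappa>"
          then have "indicator X x = (indicator C x :: real)" by (simp add: sp X indicator_def)
          then show "(\<lambda>n. f n x) \<longlonglongrightarrow> indicator X x" using lim[of x] by simp
        qed
      qed (use Xs f01 measurable_prob_measures_on[OF k cf] in auto)
      then show ?thesis using Xs by simp
    qed
    have "measure \<kappa>\<^sub>1 X = measure \<kappa>\<^sub>2 X"
      using conv[OF k1] conv[OF k2] eq[OF cf f01] by (auto intro: LIMSEQ_unique)
    then show ?thesis by (simp add: K1.emeasure_eq_measure K2.emeasure_eq_measure)
  qed (use X in simp)
qed

lemma uniform_on_compact_fibre:
  fixes F :: "'a::topological_space \<Rightarrow> 'b::topological_space \<Rightarrow> real"
  assumes "continuous_on (A \<times> S) (\<lambda>(g, u). F g u)" "compact S" "g \<in> A" "0 < e"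
  shows "\<exists>X. open X \<and> g \<in> X \<and> (\<forall>h\<in>X \<inter> A. \<forall>u\<in>S. \<bar>F h u - F g u\<bar> \<le> e)"
proof (rule continuous_on_prod_compactE[OF assms])
  fix X assume "g \<in> X" "open X"
    "\<forall>h\<in>X \<inter> A. \<forall>u\<in>S. dist (case (h, u) of (g, u) \<Rightarrow> F g u) (case (g, u) of (g, u) \<Rightarrow> F g u) \<le> e"
  then show ?thesis by (intro exI[of _ X]) (simp add: dist_real_def)
qed

section \<open>The action of the special linear group on the sphere\<close>

lemma matrix_inv_SL:
  fixes g :: "real^'m^'m"
  assumes "g \<in> SL"
  shows "g ** matrix_inv g = mat 1" "matrix_inv g ** g = mat 1" "matrix_inv g \<in> SL"
proof -
  have "invertible g" using assms by (simp add: SL_def invertible_det_nz)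
  then have *: "g ** matrix_inv g = mat 1 \<and> matrix_inv g ** g = mat 1"
    unfolding matrix_inv_def invertible_def by (rule someI_ex)
  then show "g ** matrix_inv g = mat 1" "matrix_inv g ** g = mat 1" by auto
  have "det (g ** matrix_inv g) = 1" using * by simp
  then show "matrix_inv g \<in> SL" using assms by (simp add: det_mul SL_def)
qed

lemma mult_SL: "g \<in> SL \<Longrightarrow> h \<in> SL \<Longrightarrow> g ** h \<in> SL"
  by (simp add: SL_def det_mul)

lemma SL_mult_vec_nonzero:
  fixes g :: "real^'m^'m"
  assumes "g \<in> SL" "u \<noteq> 0"
  shows "g *v u \<noteq> 0"
  using matrix_inv_SL(2)[OF assms(1)] assms(2)
  by (metis matrix_vector_mul_assoc matrix_vector_mul_lid matrix_vector_mult_0_right)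

lemma SL_mult_unit_nonzero: "g \<in> SL \<Longrightarrow> norm u = 1 \<Longrightarrow> g *v u \<noteq> 0"
  by (rule SL_mult_vec_nonzero) auto

lemma norm_sphere_act: "g \<in> SL \<Longrightarrow> norm u = 1 \<Longrightarrow> norm (sphere_act g u) = 1"
  using SL_mult_unit_nonzero[of g u] by (auto simp: sphere_act_def)

lemma sphere_act_mult:
  fixes g :: "real^'m^'m"
  assumes "g \<in> SL" "h \<in> SL" "norm u = 1"
  shows "sphere_act (g ** h) u = sphere_act g (sphere_act h u)"
proof -
  have "h *v u \<noteq> 0" by (rule SL_mult_unit_nonzero[OF assms(2,3)])
  moreover have "g *v (h *v u) \<noteq> 0" by (rule SL_mult_vec_nonzero[OF assms(1) calculation])
  ultimately show ?thesis
    by (simp add: sphere_act_def matrix_vector_mul_assoc[symmetric] matrix_vector_mult_scaleR)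
qed

lemma sphere_act_one: "norm u = 1 \<Longrightarrow> sphere_act (mat 1) u = u"
  by (simp add: sphere_act_def)

lemma sphere_act_inv:
  fixes g :: "real^'m^'m"
  assumes "g \<in> SL" "norm u = 1"
  shows "sphere_act (matrix_inv g) (sphere_act g u) = u" "sphere_act g (sphere_act (matrix_inv g) u) = u"
  using sphere_act_mult[of "matrix_inv g" g u] sphere_act_mult[of g "matrix_inv g" u]
    matrix_inv_SL[OF assms(1)] assms sphere_act_one[OF assms(2)] by auto

lemma continuous_on_matrix_vector_mult [continuous_intros]:
  fixes f :: "'a::topological_space \<Rightarrow> real^'n^'m"
  assumes "continuous_on A f" "continuous_on A h"
  shows "continuous_on A (\<lambda>x. f x *v h x)"
  unfolding matrix_vector_mult_def
  by (intro continuous_on_vec_lambda continuous_intros continuous_on_component assms)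

lemma continuous_on_sphere_act_pair:
  "continuous_on (SL \<times> unit_sphere) (\<lambda>(g :: real^'m^'m, u). sphere_act g u)"
  unfolding sphere_act_def case_prod_beta
  by (intro continuous_intros ballI) (auto simp: SL_mult_unit_nonzero)

lemma continuous_on_sphere_act:
  fixes g :: "real^'m^'m"
  assumes "g \<in> SL" shows "continuous_on unit_sphere (sphere_act g)"
proof -
  have "continuous_on unit_sphere (\<lambda>u. (\<lambda>(g, u). sphere_act g u) (g, u))"
    by (rule continuous_on_compose2[OF continuous_on_sphere_act_pair])
       (use assms in \<open>auto intro!: continuous_intros\<close>)
  then show ?thesis by simp
qed

lemma continuous_on_compose_act:
  fixes f :: "real^'m \<Rightarrow> real"
  assumes "g \<in> SL" "continuous_on unit_sphere f"
  shows "continuous_on unit_sphere (\<lambda>u. f (sphere_act g u))"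
  by (rule continuous_on_compose2[OF assms(2) continuous_on_sphere_act[OF assms(1)]])
     (auto simp: norm_sphere_act assms(1))

text \<open>Cramer's rule makes the entries of the inverse polynomials in the entries of \<open>g\<close>.\<close>

lemma continuous_on_matrix_inv: "continuous_on SL (matrix_inv :: real^'m^'m \<Rightarrow> real^'m^'m)"
proof -
  have entry: "matrix_inv g $ i $ j = det (\<chi> a b. if b = i then axis j 1 $ a else g $ a $ b)"
    if g: "g \<in> SL" for g :: "real^'m^'m" and i j
  proof -
    have "g *v (matrix_inv g *v axis j 1) = axis j 1"
      by (simp add: matrix_vector_mul_assoc matrix_inv_SL[OF g])
    then have "matrix_inv g *v axis j 1 = (\<chi> k. det (\<chi> a b. if b = k then axis j 1 $ a else g $ a $ b) / det g)"
      using g by (subst (asm) cramer) (auto simp: SL_def)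
    moreover have "(matrix_inv g *v axis j 1) $ i = matrix_inv g $ i $ j"
      by (simp add: matrix_vector_mul_component inner_axis)
    ultimately show ?thesis using g by (simp add: SL_def)
  qed
  have "continuous_on SL (\<lambda>g :: real^'m^'m. \<chi> i j. det (\<chi> a b. if b = i then axis j 1 $ a else g $ a $ b))"
  proof (intro continuous_on_vec_lambda)
    fix i j
    have *: "continuous_on SL (\<lambda>g :: real^'m^'m. if b = i then axis j 1 $ a else g $ a $ b)" for a b
      by (cases "b = i") (auto intro!: continuous_intros continuous_on_component)
    then show "continuous_on SL (\<lambda>g :: real^'m^'m. det (\<chi> a b. if b = i then axis j 1 $ a else g $ a $ b))"
      unfolding det_def by (simp only: vec_lambda_beta) (intro continuous_intros *)
  qed
  then show ?thesis
    by (rule continuous_on_eq) (simp add: vec_eq_iff entry)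
qed

lemma continuous_on_inverse_act:
  fixes f :: "real^'m \<Rightarrow> real"
  assumes f: "continuous_on unit_sphere f"
  shows "continuous_on (SL \<times> unit_sphere) (\<lambda>(g :: real^'m^'m, u). f (sphere_act (matrix_inv g) u))"
proof -
  have "continuous_on (SL \<times> unit_sphere)
      (\<lambda>x :: (real^'m^'m) \<times> (real^'m). (\<lambda>(g, u). sphere_act g u) (matrix_inv (fst x), snd x))"
    by (rule continuous_on_compose2[OF continuous_on_sphere_act_pair])
       (auto intro!: continuous_intros continuous_on_compose2[OF continuous_on_matrix_inv] simp: matrix_inv_SL)
  then show ?thesis
    unfolding case_prod_beta
    by (intro continuous_on_compose2[OF f]) (auto simp: matrix_inv_SL norm_sphere_act)
qed

lemma preserves_iff:
  fixes g :: "real^'m^'m"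
  assumes g: "g \<in> SL" and \<kappa>: "\<kappa> \<in> prob_measures_on unit_sphere"
  shows "preserves g \<kappa> \<longleftrightarrow> (\<forall>f :: real^'m \<Rightarrow> real. continuous_on unit_sphere f \<longrightarrow>
    (\<integral>u. f (sphere_act g u) \<partial>\<kappa>) = (\<integral>u. f u \<partial>\<kappa>))"
proof -
  let ?R = "restrict_space borel unit_sphere :: (real^'m) measure"
  interpret prob_space \<kappa> using \<kappa> by (simp add: prob_measures_on_def)
  have sets: "sets \<kappa> = sets ?R" using \<kappa> by (simp add: prob_measures_on_def)
  have meas: "sphere_act g \<in> measurable \<kappa> ?R"
    using measurable_prob_measures_on[OF \<kappa> continuous_on_sphere_act[OF g]] norm_sphere_act[OF g]
    by (intro measurable_restrict_space2) (auto simp: space_prob_measures_on[OF \<kappa>])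
  have d: "distr \<kappa> ?R (sphere_act g) \<in> prob_measures_on unit_sphere"
    using prob_space_distr[OF meas] by (simp add: prob_measures_on_def)
  have int: "(\<integral>u. f u \<partial>distr \<kappa> ?R (sphere_act g)) = (\<integral>u. f (sphere_act g u) \<partial>\<kappa>)"
    if "continuous_on unit_sphere f" for f :: "real^'m \<Rightarrow> real"
    by (rule integral_distr[OF meas]) (rule borel_measurable_continuous_on_restrict[OF that])
  show ?thesis
    unfolding preserves_def
    using int prob_measures_on_eqI[OF d \<kappa>] by auto
qed

text \<open>Since \<open>G_of \<nu>\<close> is the smallest closed subgroup containing the quotients of elements of the support,
  it preserves \<open>\<kappa>\<close> as soon as those quotients do.\<close>

lemma stabilizer_closed_subgroup:
  fixes \<kappa> :: "(real^'m) measure"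
  assumes \<kappa>: "\<kappa> \<in> prob_measures_on unit_sphere"
  defines "H \<equiv> {g \<in> SL. preserves g \<kappa>}"
  shows "subgroup H SL_group" "closedin (top_of_set SL) H"
proof -
  interpret G: group "SL_group :: (real^'m^'m) monoid" by (rule group_SL_group)
  interpret prob_space \<kappa> using \<kappa> by (simp add: prob_measures_on_def)
  have sp: "space \<kappa> = unit_sphere" by (rule space_prob_measures_on[OF \<kappa>])
  let ?S = "unit_sphere :: (real^'m) set"
  have H: "g \<in> H \<longleftrightarrow> g \<in> SL \<and> (\<forall>f :: real^'m \<Rightarrow> real. continuous_on ?S f \<longrightarrow>
    (\<integral>u. f (sphere_act g u) \<partial>\<kappa>) = (\<integral>u. f u \<partial>\<kappa>))" for g
    using preserves_iff[OF _ \<kappa>] by (auto simp: H_def)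
  have HD: "(\<integral>u. f (sphere_act g u) \<partial>\<kappa>) = (\<integral>u. f u \<partial>\<kappa>)"
    if "g \<in> H" "continuous_on ?S f" for g and f :: "real^'m \<Rightarrow> real"
    using that by (simp add: H)
  note comp = continuous_on_compose_act
  have cong: "(\<integral>u. f u \<partial>\<kappa>) = (\<integral>u. h u \<partial>\<kappa>)" if "\<And>u. u \<in> ?S \<Longrightarrow> f u = h u" for f h :: "real^'m \<Rightarrow> real"
    by (intro Bochner_Integration.integral_cong refl) (simp add: sp that)
  have mult: "g ** h \<in> H" if "g \<in> H" "h \<in> H" for g h
  proof -
    have SL: "g \<in> SL" "h \<in> SL" using that by (auto simp: H)
    have "(\<integral>u. f (sphere_act (g ** h) u) \<partial>\<kappa>) = (\<integral>u. f u \<partial>\<kappa>)" if f: "continuous_on ?S f" for f :: "real^'m \<Rightarrow> real"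
    proof -
      have "(\<integral>u. f (sphere_act (g ** h) u) \<partial>\<kappa>) = (\<integral>u. f (sphere_act g (sphere_act h u)) \<partial>\<kappa>)"
        by (rule cong) (simp add: sphere_act_mult SL)
      also have "\<dots> = (\<integral>u. f (sphere_act g u) \<partial>\<kappa>)"
        by (rule HD[OF \<open>h \<in> H\<close> comp[OF SL(1) f]])
      also have "\<dots> = (\<integral>u. f u \<partial>\<kappa>)" using \<open>g \<in> H\<close> f by (intro HD)
      finally show ?thesis .
    qed
    then show ?thesis using SL by (simp add: H mult_SL)
  qed
  have inv: "matrix_inv g \<in> H" if "g \<in> H" for g
  proof -
    have SL: "g \<in> SL" "matrix_inv g \<in> SL" using that matrix_inv_SL by (auto simp: H)
    have "(\<integral>u. f (sphere_act (matrix_inv g) u) \<partial>\<kappa>) = (\<integral>u. f u \<partial>\<kappa>)" if f: "continuous_on ?S f" for f :: "real^'m \<Rightarrow> real"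
    proof -
      have "(\<integral>u. f (sphere_act (matrix_inv g) u) \<partial>\<kappa>) = (\<integral>u. f (sphere_act (matrix_inv g) (sphere_act g u)) \<partial>\<kappa>)"
        by (rule HD[OF \<open>g \<in> H\<close> comp[OF SL(2) f], symmetric])
      also have "\<dots> = (\<integral>u. f u \<partial>\<kappa>)"
        by (rule cong) (simp add: sphere_act_inv SL)
      finally show ?thesis .
    qed
    then show ?thesis using SL by (simp add: H)
  qed
  have "mat 1 \<in> H"
    by (auto simp: H SL_def sphere_act_one intro!: cong)
  moreover have "inv\<^bsub>SL_group\<^esub> g = matrix_inv g" if "g \<in> H" for g
    using that matrix_inv_SL[of g] by (intro G.inv_equality) (auto simp: SL_group_def H)
  ultimately show "subgroup H SL_group"
    using mult inv by (intro subgroup.intro) (auto simp: SL_group_def H)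
  have "continuous_on SL (\<lambda>g. \<integral>u. f (sphere_act g u) \<partial>\<kappa>)" if f: "continuous_on ?S f" for f :: "real^'m \<Rightarrow> real"
    unfolding continuous_on_iff
  proof safe
    fix g :: "real^'m^'m" and e :: real assume g: "g \<in> SL" and e: "0 < e"
    have "continuous_on (SL \<times> ?S) (\<lambda>(g, u). f (sphere_act g u))"
      unfolding case_prod_beta
      by (rule continuous_on_compose2[OF f continuous_on_sphere_act_pair[unfolded case_prod_beta]])
         (auto simp: norm_sphere_act)
    from uniform_on_compact_fibre[OF this compact_sphere g half_gt_zero[OF e]]
    obtain X where X: "open X" "g \<in> X" "\<forall>h\<in>X \<inter> SL. \<forall>u\<in>?S. \<bar>f (sphere_act h u) - f (sphere_act g u)\<bar> \<le> e / 2"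
      by (elim exE conjE)
    then obtain d where d: "0 < d" "ball g d \<subseteq> X" by (meson openE)
    have "dist (\<integral>u. f (sphere_act h u) \<partial>\<kappa>) (\<integral>u. f (sphere_act g u) \<partial>\<kappa>) < e"
      if h: "h \<in> SL" "dist h g < d" for h
    proof -
      have hX: "h \<in> X \<inter> SL" using h d by (auto simp: dist_commute)
      note i = integrable_prob_measures_on[OF \<kappa> _ comp[OF _ f]]
      have "\<bar>(\<integral>u. f (sphere_act h u) \<partial>\<kappa>) - (\<integral>u. f (sphere_act g u) \<partial>\<kappa>)\<bar>
          = \<bar>\<integral>u. f (sphere_act h u) - f (sphere_act g u) \<partial>\<kappa>\<bar>"
        using i g h by simp
      also have "\<dots> \<le> (\<integral>u. \<bar>f (sphere_act h u) - f (sphere_act g u)\<bar> \<partial>\<kappa>)"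
        by (rule integral_abs_bound)
      also have "\<dots> \<le> (\<integral>u. e / 2 \<partial>\<kappa>)"
        using i g h hX X(3) by (intro integral_mono) (auto simp: sp)
      finally show ?thesis using e prob_space by (simp add: dist_real_def)
    qed
    with d show "\<exists>d>0. \<forall>h\<in>SL. dist h g < d \<longrightarrow>
      dist (\<integral>u. f (sphere_act h u) \<partial>\<kappa>) (\<integral>u. f (sphere_act g u) \<partial>\<kappa>) < e" by blast
  qed
  then have "closedin (top_of_set SL) {g \<in> SL. (\<integral>u. f (sphere_act g u) \<partial>\<kappa>) = (\<integral>u. f u \<partial>\<kappa>)}"
    if "f \<in> {f. continuous_on ?S f}" for f :: "real^'m \<Rightarrow> real"
    using that by (intro continuous_closedin_preimage_constant) auto
  then have "closedin (top_of_set SL)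
      (\<Inter>f\<in>{f :: real^'m \<Rightarrow> real. continuous_on ?S f}. {g \<in> SL. (\<integral>u. f (sphere_act g u) \<partial>\<kappa>) = (\<integral>u. f u \<partial>\<kappa>)})"
    by (intro closedin_INT) (auto intro: exI[of _ "\<lambda>_. 0"])
  also have "(\<Inter>f\<in>{f :: real^'m \<Rightarrow> real. continuous_on ?S f}. {g \<in> SL. (\<integral>u. f (sphere_act g u) \<partial>\<kappa>) = (\<integral>u. f u \<partial>\<kappa>)}) = H"
    using H continuous_on_const[of ?S "0::real"] by blast
  finally show "closedin (top_of_set SL) H" .
qed

text \<open>The hypothesis of no invariant measure, made quantitative. A measure \<open>\<kappa>\<close> with
  \<open>g\<inverse>\<kappa> = h\<inverse>\<kappa>\<close> for all \<open>g\<close>, \<open>h\<close> in the support is preserved by all the generators \<open>g h\<inverse>\<close>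
  of \<open>G_of \<nu>\<close>. So no \<open>\<kappa>\<close> annihilates all the functions \<open>u \<mapsto> f (g\<inverse>.u) - f (h\<inverse>.u)\<close>, and by
  compactness already finitely many of them detect, with a uniform margin, that \<open>\<kappa>\<close> is not
  invariant.\<close>

lemma finite_separating_tests:
  fixes \<nu> :: "(real^'m^'m) measure"
  assumes \<nu>: "\<nu> \<in> prob_measures_on SL"
    and no: "\<not> (\<exists>\<kappa>\<in>prob_measures_on unit_sphere. \<forall>h\<in>G_of \<nu>. preserves h \<kappa>)"
  shows "\<exists>T \<epsilon>. finite T \<and> T \<subseteq> supp \<nu> \<times> supp \<nu> \<times> {f :: real^'m \<Rightarrow> real. continuous_on unit_sphere f} \<and>
    0 < \<epsilon> \<and> (\<forall>\<kappa>\<in>prob_measures_on unit_sphere. \<exists>(g, h, f)\<in>T.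
       \<epsilon> < \<bar>\<integral>u. f (sphere_act (matrix_inv g) u) - f (sphere_act (matrix_inv h) u) \<partial>\<kappa>\<bar>)"
proof -
  let ?S = "unit_sphere :: (real^'m) set"
  let ?D = "\<lambda>(g, h, f) u. f (sphere_act (matrix_inv g) u) - f (sphere_act (matrix_inv h) u) :: real"
  let ?T = "supp \<nu> \<times> supp \<nu> \<times> {f :: real^'m \<Rightarrow> real. continuous_on ?S f}"
  have supp: "supp \<nu> \<subseteq> SL" using space_prob_measures_on[OF \<nu>] by (auto simp: supp_def)
  note comp = continuous_on_compose_act
  have cont: "continuous_on ?S d" if "d \<in> ?D ` ?T" for d
  proof -
    from that obtain g h f where d: "d = ?D (g, h, f)" "g \<in> supp \<nu>" "h \<in> supp \<nu>" "continuous_on ?S f"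
      by auto
    then have SL: "matrix_inv g \<in> SL" "matrix_inv h \<in> SL" using supp matrix_inv_SL(3) by auto
    show ?thesis
      unfolding d(1) prod.case by (intro continuous_on_diff comp SL d(4))
  qed
  have not_common: "\<not> (\<exists>\<kappa>\<in>prob_measures_on ?S. \<forall>d\<in>?D ` ?T. (\<integral>u. d u \<partial>\<kappa>) = 0)"
  proof
    assume "\<exists>\<kappa>\<in>prob_measures_on ?S. \<forall>d\<in>?D ` ?T. (\<integral>u. d u \<partial>\<kappa>) = 0"
    then obtain \<kappa> where \<kappa>: "\<kappa> \<in> prob_measures_on ?S" and zero: "\<And>d. d \<in> ?D ` ?T \<Longrightarrow> (\<integral>u. d u \<partial>\<kappa>) = 0" by blast
    have sp: "space \<kappa> = ?S" by (rule space_prob_measures_on[OF \<kappa>])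
    have zero': "(\<integral>u. f (sphere_act (matrix_inv g) u) - f (sphere_act (matrix_inv h) u) \<partial>\<kappa>) = 0"
      if "g \<in> supp \<nu>" "h \<in> supp \<nu>" "continuous_on ?S f" for g h and f :: "real^'m \<Rightarrow> real"
      using zero[OF imageI[of "(g, h, f)" ?T ?D]] that by simp
    have "preserves (g ** matrix_inv h) \<kappa>" if gh: "g \<in> supp \<nu>" "h \<in> supp \<nu>" for g h
    proof -
      have SL: "g \<in> SL" "h \<in> SL" "matrix_inv g \<in> SL" "matrix_inv h \<in> SL" using gh supp matrix_inv_SL by auto
      have "(\<integral>u. f (sphere_act (g ** matrix_inv h) u) \<partial>\<kappa>) = (\<integral>u. f u \<partial>\<kappa>)"
        if f: "continuous_on ?S f" for f :: "real^'m \<Rightarrow> real"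
      proof -
        let ?f = "\<lambda>u. f (sphere_act g u)"
        have cf: "continuous_on ?S ?f" by (rule comp[OF SL(1) f])
        have "(\<integral>u. ?f (sphere_act (matrix_inv g) u) - ?f (sphere_act (matrix_inv h) u) \<partial>\<kappa>) = 0"
          by (rule zero'[OF gh cf])
        then have "(\<integral>u. ?f (sphere_act (matrix_inv g) u) \<partial>\<kappa>) = (\<integral>u. ?f (sphere_act (matrix_inv h) u) \<partial>\<kappa>)"
          using integrable_prob_measures_on[OF \<kappa> _ comp[OF SL(3) cf]] integrable_prob_measures_on[OF \<kappa> _ comp[OF SL(4) cf]]
          by simp
        moreover have "(\<integral>u. ?f (sphere_act (matrix_inv g) u) \<partial>\<kappa>) = (\<integral>u. f u \<partial>\<kappa>)"
          by (intro Bochner_Integration.integral_cong refl) (simp add: sp sphere_act_inv SL)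
        moreover have "(\<integral>u. f (sphere_act (g ** matrix_inv h) u) \<partial>\<kappa>) = (\<integral>u. ?f (sphere_act (matrix_inv h) u) \<partial>\<kappa>)"
          by (intro Bochner_Integration.integral_cong refl) (simp add: sp sphere_act_mult SL)
        ultimately show ?thesis by simp
      qed
      then show ?thesis using preserves_iff[OF mult_SL[OF SL(1,4)] \<kappa>] by blast
    qed
    moreover have "g ** matrix_inv h \<in> SL" if "g \<in> supp \<nu>" "h \<in> supp \<nu>" for g h
      using that supp by (intro mult_SL matrix_inv_SL(3)) auto
    ultimately have "G_of \<nu> \<subseteq> {g \<in> SL. preserves g \<kappa>}"
      unfolding G_of_def using stabilizer_closed_subgroup[OF \<kappa>] by (intro Inter_lower) blast
    with \<kappa> no show False by blast
  qed
  have "\<exists>F e. finite F \<and> F \<subseteq> ?D ` ?T \<and> 0 < e \<and> (\<forall>\<kappa>\<in>prob_measures_on ?S. \<exists>d\<in>F. e < \<bar>\<integral>u. d u \<partial>\<kappa>\<bar>)"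
  proof (rule ccontr)
    assume neg: "\<not> ?thesis"
    have "\<exists>\<kappa>\<in>prob_measures_on ?S. \<forall>d\<in>?D ` ?T. (\<integral>u. d u \<partial>\<kappa>) = 0"
    proof (rule compactness_of_prob_measures[OF compact_sphere cont])
      fix F e assume "finite F" "F \<subseteq> ?D ` ?T" "0 < (e :: real)"
      then have "\<not> (\<forall>\<kappa>\<in>prob_measures_on ?S. \<exists>d\<in>F. e < \<bar>\<integral>u. d u \<partial>\<kappa>\<bar>)" using neg by blast
      then obtain \<kappa> where "\<kappa> \<in> prob_measures_on ?S" "\<forall>d\<in>F. \<not> e < \<bar>\<integral>u. d u \<partial>\<kappa>\<bar>" by blast
      then show "\<exists>\<kappa>\<in>prob_measures_on ?S. \<forall>d\<in>F. \<bar>\<integral>u. d u \<partial>\<kappa>\<bar> \<le> e"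
        by (intro bexI[of _ \<kappa>]) (simp_all add: not_less)
    qed
    with not_common show False by (rule notE)
  qed
  then obtain F e where F: "finite F" "F \<subseteq> ?D ` ?T" "0 < e"
    "\<And>\<kappa>. \<kappa> \<in> prob_measures_on ?S \<Longrightarrow> \<exists>d\<in>F. e < \<bar>\<integral>u. d u \<partial>\<kappa>\<bar>"
    by (elim exE conjE) blast
  obtain T where T: "T \<subseteq> ?T" "finite T" "F = ?D ` T"
    using finite_subset_image[OF F(1,2)] by blast
  show ?thesis
  proof (intro exI[of _ T] exI[of _ e] conjI T(2,1) F(3) ballI)
    fix \<kappa> assume "\<kappa> \<in> prob_measures_on ?S"
    then have "\<exists>d\<in>?D ` T. e < \<bar>\<integral>u. d u \<partial>\<kappa>\<bar>" unfolding T(3)[symmetric] by (rule F(4))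
    then obtain t where t: "t \<in> T" "e < \<bar>\<integral>u. ?D t u \<partial>\<kappa>\<bar>" by (elim bexE imageE) blast
    show "\<exists>(g, h, f)\<in>T. e < \<bar>\<integral>u. f (sphere_act (matrix_inv g) u) - f (sphere_act (matrix_inv h) u) \<partial>\<kappa>\<bar>"
      by (rule bexI[OF _ t(1)]) (use t(2) in \<open>simp add: case_prod_beta\<close>)
  qed
qed

section \<open>Lebesgue measure and linear maps\<close>

text \<open>Fubini in the direction \<open>b\<close>: for fixed other coordinates a shear is a translation of the line.\<close>

lemma nn_integral_lborel_shear:
  fixes F :: "'a::euclidean_space \<Rightarrow> ennreal" and \<phi> :: "'a \<Rightarrow> real"
  assumes F[measurable]: "F \<in> borel_measurable borel" and \<phi>[measurable]: "\<phi> \<in> borel_measurable borel"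
    and b: "b \<in> Basis" and inv: "\<And>x s. \<phi> (x + s *\<^sub>R b) = \<phi> x"
  shows "(\<integral>\<^sup>+x. F (x + \<phi> x *\<^sub>R b) \<partial>lborel) = (\<integral>\<^sup>+x. F x \<partial>lborel)"
proof -
  interpret product_sigma_finite "\<lambda>_ :: 'a. lborel :: real measure" by standard
  let ?I = "Basis - {b}"
  have ins: "insert b ?I = Basis" using b by auto
  have slice: "(\<integral>\<^sup>+x. G x \<partial>lborel) = (\<integral>\<^sup>+f. (\<integral>\<^sup>+y. G ((\<Sum>i\<in>?I. f i *\<^sub>R i) + y *\<^sub>R b) \<partial>lborel) \<partial>Pi\<^sub>M ?I (\<lambda>_. lborel))"
    if [measurable]: "G \<in> borel_measurable borel" for G :: "'a \<Rightarrow> ennreal"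
  proof -
    have "(\<integral>\<^sup>+x. G x \<partial>lborel) = (\<integral>\<^sup>+f. G (\<Sum>i\<in>Basis. f i *\<^sub>R i) \<partial>Pi\<^sub>M Basis (\<lambda>_. lborel))"
      by (subst lborel_eq) (simp add: nn_integral_distr)
    also have "\<dots> = (\<integral>\<^sup>+f. (\<integral>\<^sup>+y. G (\<Sum>i\<in>Basis. (f(b := y)) i *\<^sub>R i) \<partial>lborel) \<partial>Pi\<^sub>M ?I (\<lambda>_. lborel))"
      by (subst ins[symmetric], subst product_nn_integral_insert) (simp_all add: ins)
    also have "(\<lambda>f y. \<Sum>i\<in>Basis. (f(b := y)) i *\<^sub>R i) = (\<lambda>f y. (\<Sum>i\<in>?I. f i *\<^sub>R i) + y *\<^sub>R b)"
      using b by (auto simp: fun_eq_iff sum.remove[of Basis b] add.commute)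
    finally show ?thesis .
  qed
  have "(\<integral>\<^sup>+x. F (x + \<phi> x *\<^sub>R b) \<partial>lborel)
      = (\<integral>\<^sup>+f. (\<integral>\<^sup>+y. F ((\<Sum>i\<in>?I. f i *\<^sub>R i) + (\<phi> (\<Sum>i\<in>?I. f i *\<^sub>R i) + 1 * y) *\<^sub>R b) \<partial>lborel) \<partial>Pi\<^sub>M ?I (\<lambda>_. lborel))"
  proof (subst slice)
    have "(\<Sum>i\<in>?I. f i *\<^sub>R i) + y *\<^sub>R b + \<phi> ((\<Sum>i\<in>?I. f i *\<^sub>R i) + y *\<^sub>R b) *\<^sub>R b
        = (\<Sum>i\<in>?I. f i *\<^sub>R i) + (\<phi> (\<Sum>i\<in>?I. f i *\<^sub>R i) + 1 * y) *\<^sub>R b" for f y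
      by (simp add: inv scaleR_add_left)
    then show "(\<integral>\<^sup>+f. (\<integral>\<^sup>+y. F ((\<Sum>i\<in>?I. f i *\<^sub>R i) + y *\<^sub>R b + \<phi> ((\<Sum>i\<in>?I. f i *\<^sub>R i) + y *\<^sub>R b) *\<^sub>R b) \<partial>lborel) \<partial>Pi\<^sub>M ?I (\<lambda>_. lborel))
        = (\<integral>\<^sup>+f. (\<integral>\<^sup>+y. F ((\<Sum>i\<in>?I. f i *\<^sub>R i) + (\<phi> (\<Sum>i\<in>?I. f i *\<^sub>R i) + 1 * y) *\<^sub>R b) \<partial>lborel) \<partial>Pi\<^sub>M ?I (\<lambda>_. lborel))"
      by (simp only:)
  qed simp
  also have "\<dots> = (\<integral>\<^sup>+f. (\<integral>\<^sup>+y. F ((\<Sum>i\<in>?I. f i *\<^sub>R i) + y *\<^sub>R b) \<partial>lborel) \<partial>Pi\<^sub>M ?I (\<lambda>_. lborel))"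
  proof (rule nn_integral_cong)
    fix f :: "'a \<Rightarrow> real"
    show "(\<integral>\<^sup>+y. F ((\<Sum>i\<in>?I. f i *\<^sub>R i) + (\<phi> (\<Sum>i\<in>?I. f i *\<^sub>R i) + 1 * y) *\<^sub>R b) \<partial>lborel)
        = (\<integral>\<^sup>+y. F ((\<Sum>i\<in>?I. f i *\<^sub>R i) + y *\<^sub>R b) \<partial>lborel)"
      using nn_integral_real_affine[of "\<lambda>y. F ((\<Sum>i\<in>?I. f i *\<^sub>R i) + y *\<^sub>R b)" 1 "\<phi> (\<Sum>i\<in>?I. f i *\<^sub>R i)"]
      by simp
  qed
  also have "\<dots> = (\<integral>\<^sup>+x. F x \<partial>lborel)" by (rule slice[symmetric]) fact
  finally show ?thesis .
qed

lemma nn_integral_lborel_permute: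
  fixes F :: "real^'m \<Rightarrow> ennreal" and p :: "'m \<Rightarrow> 'm"
  assumes F[measurable]: "F \<in> borel_measurable borel" and p: "p permutes UNIV"
  shows "(\<integral>\<^sup>+x. F (\<chi> i. x $ p i) \<partial>lborel) = (\<integral>\<^sup>+x. F x \<partial>lborel)"
proof -
  let ?T = "\<lambda>x :: real^'m. \<chi> i. x $ p i"
  have T[measurable]: "?T \<in> borel \<rightarrow>\<^sub>M borel"
    by (intro borel_measurable_continuous_onI continuous_on_vec_lambda continuous_intros)
  have "distr lborel borel ?T = lborel"
  proof (rule lborel_eqI[symmetric])
    fix l u :: "real^'m" assume "\<And>b. b \<in> Basis \<Longrightarrow> l \<bullet> b \<le> u \<bullet> b"
    then have le: "l $ i \<le> u $ i" for i
      by (metis axis_in_Basis_iff cart_eq_inner_axis insertI1 Basis_real_def)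
    let ?q = "inv_into UNIV p"
    have q: "p (?q i) = i" "?q (p i) = i" for i using permutes_inverses[OF p] by auto
    have pre: "?T -` box l u = box (\<chi> i. l $ ?q i) (\<chi> i. u $ ?q i)"
      by (auto simp: mem_box_cart) (metis q)+
    have vol: "emeasure lborel (box a b) = ennreal (\<Prod>i\<in>UNIV. b $ i - a $ i)"
      if "\<And>i. a $ i \<le> b $ i" for a b :: "real^'m"
      using that by (simp add: emeasure_lborel_box_eq Basis_vec_def inner_axis cart_eq_inner_axis[symmetric]
         prod.UNION_disjoint axis_eq_axis)
    have "emeasure (distr lborel borel ?T) (box l u) = emeasure lborel (box (\<chi> i. l $ ?q i) (\<chi> i. u $ ?q i))"
      by (simp add: emeasure_distr pre)
    also have "\<dots> = ennreal (\<Prod>i\<in>UNIV. u $ ?q i - l $ ?q i)"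
      using le by (subst vol) auto
    also have "(\<Prod>i\<in>UNIV. u $ ?q i - l $ ?q i) = (\<Prod>i\<in>UNIV. u $ i - l $ i)"
      using prod.permute[OF permutes_inv[OF p], of "\<lambda>i. u $ i - l $ i"] by (simp add: o_def)
    also have "ennreal \<dots> = emeasure lborel (box l u)" using le by (subst vol) auto
    also have "\<dots> = (\<Prod>b\<in>Basis. (u - l) \<bullet> b)"
      using \<open>\<And>b. b \<in> Basis \<Longrightarrow> l \<bullet> b \<le> u \<bullet> b\<close> by (simp add: emeasure_lborel_box)
    finally show "emeasure (distr lborel borel ?T) (box l u) = (\<Prod>b\<in>Basis. (u - l) \<bullet> b)" .
  qed simp
  then have "(\<integral>\<^sup>+x. F x \<partial>lborel) = (\<integral>\<^sup>+x. F x \<partial>distr lborel borel ?T)" by simp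
  also have "\<dots> = (\<integral>\<^sup>+x. F (?T x) \<partial>lborel)" by (rule nn_integral_distr) simp_all
  finally show ?thesis by simp
qed

text \<open>By induction over products of elementary matrices. The index type is only assumed to be finite: a
  shear is handled by Fubini and its determinant by a row operation, so no order on the indices is
  involved.\<close>

lemma nn_integral_lborel_linear:
  fixes A :: "real^'m^'m" and F :: "real^'m \<Rightarrow> ennreal"
  assumes "det A \<noteq> 0" "F \<in> borel_measurable borel"
  shows "ennreal \<bar>det A\<bar> * (\<integral>\<^sup>+x. F (A *v x) \<partial>lborel) = (\<integral>\<^sup>+x. F x \<partial>lborel)"
proof -
  define Q where "Q A \<longleftrightarrow> det A \<noteq> 0 \<longrightarrow> (\<forall>F :: real^'m \<Rightarrow> ennreal. F \<in> borel_measurable borel \<longrightarrow>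
    ennreal \<bar>det A\<bar> * (\<integral>\<^sup>+x. F (A *v x) \<partial>lborel) = (\<integral>\<^sup>+x. F x \<partial>lborel))" for A :: "real^'m^'m"
  have QI: "Q A" if "\<And>F :: real^'m \<Rightarrow> ennreal. det A \<noteq> 0 \<Longrightarrow> F \<in> borel_measurable borel \<Longrightarrow>
    ennreal \<bar>det A\<bar> * (\<integral>\<^sup>+x. F (A *v x) \<partial>lborel) = (\<integral>\<^sup>+x. F x \<partial>lborel)" for A
    using that by (simp add: Q_def)
  have "Q A"
  proof (rule induct_matrix_elementary_alt[of Q]; rule QI)
    fix A B :: "real^'m^'m" and F :: "real^'m \<Rightarrow> ennreal"
    assume IH: "Q A" "Q B" and dAB: "det (A ** B) \<noteq> 0" and F: "F \<in> borel_measurable borel"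
    have AB: "det A \<noteq> 0" "det B \<noteq> 0" using dAB by (auto simp: det_mul)
    have FA: "(\<lambda>x. F (A *v x)) \<in> borel_measurable borel"
      by (intro measurable_compose[OF borel_measurable_continuous_onI F] continuous_intros)
    have "ennreal \<bar>det (A ** B)\<bar> * (\<integral>\<^sup>+x. F ((A ** B) *v x) \<partial>lborel)
        = ennreal \<bar>det A\<bar> * (ennreal \<bar>det B\<bar> * (\<integral>\<^sup>+x. F (A *v (B *v x)) \<partial>lborel))"
      by (simp add: det_mul abs_mult ennreal_mult mult.assoc matrix_vector_mul_assoc)
    also have "\<dots> = (\<integral>\<^sup>+x. F x \<partial>lborel)"
    proof -
      have "ennreal \<bar>det B\<bar> * (\<integral>\<^sup>+x. F (A *v (B *v x)) \<partial>lborel) = (\<integral>\<^sup>+x. F (A *v x) \<partial>lborel)"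
        using IH(2) AB(2) FA unfolding Q_def by (elim impE allE[of _ "\<lambda>x. F (A *v x)"])
      moreover have "ennreal \<bar>det A\<bar> * (\<integral>\<^sup>+x. F (A *v x) \<partial>lborel) = (\<integral>\<^sup>+x. F x \<partial>lborel)"
        using IH(1) AB(1) F unfolding Q_def by blast
      ultimately show ?thesis by simp
    qed
    finally show "ennreal \<bar>det (A ** B)\<bar> * (\<integral>\<^sup>+x. F ((A ** B) *v x) \<partial>lborel) = (\<integral>\<^sup>+x. F x \<partial>lborel)" .
  next
    fix A :: "real^'m^'m" and i and F :: "real^'m \<Rightarrow> ennreal"
    assume "row i A = 0" "det A \<noteq> 0"
    then show "ennreal \<bar>det A\<bar> * (\<integral>\<^sup>+x. F (A *v x) \<partial>lborel) = (\<integral>\<^sup>+x. F x \<partial>lborel)"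
      by (simp add: det_zero_row)
  next
    fix A :: "real^'m^'m" and F :: "real^'m \<Rightarrow> ennreal"
    assume diagonal: "\<And>i j. i \<noteq> j \<Longrightarrow> A $ i $ j = 0" and dA: "det A \<noteq> 0" and F: "F \<in> borel_measurable borel"
    have det: "det A = (\<Prod>i\<in>UNIV. A $ i $ i)" by (rule det_diagonal) (rule diagonal)
    then have nz: "A $ i $ i \<noteq> 0" for i using dA by auto
    define c where "c b = (A *v b) \<bullet> b" for b
    have c_axis: "c (axis i 1) = A $ i $ i" for i
      by (simp add: c_def inner_axis matrix_vector_mul_component)
    have cnz: "c b \<noteq> 0" if "b \<in> Basis" for b using that nz by (auto simp: Basis_vec_def c_axis)
    have T: "0 + (\<Sum>j\<in>Basis. (c j * (x \<bullet> j)) *\<^sub>R j) = A *v x" for x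
    proof (rule euclidean_eqI)
      fix b :: "real^'m" assume b: "b \<in> Basis"
      then obtain i where i: "b = axis i 1" by (auto simp: Basis_vec_def)
      have "(A *v x) $ i = (\<Sum>j\<in>UNIV. A $ i $ j * x $ j)" by (simp add: matrix_vector_mult_def)
      also have "\<dots> = A $ i $ i * x $ i"
        by (subst sum.remove[of _ i]) (auto simp: diagonal intro!: sum.neutral)
      finally have "(A *v x) \<bullet> b = c b * (x \<bullet> b)" by (simp add: i inner_axis c_axis)
      then show "(0 + (\<Sum>j\<in>Basis. (c j * (x \<bullet> j)) *\<^sub>R j)) \<bullet> b = (A *v x) \<bullet> b"
        using b by (simp add: inner_sum_left inner_Basis if_distrib cong: if_cong)
    qed
    have m: "(*v) A \<in> borel \<rightarrow>\<^sub>M borel" by (intro borel_measurable_continuous_onI continuous_intros)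
    have prod: "(\<Prod>j\<in>Basis. \<bar>c j\<bar>) = \<bar>det A\<bar>"
    proof -
      have "(\<Prod>j\<in>Basis. \<bar>c j\<bar>) = (\<Prod>i\<in>UNIV. \<bar>c (axis i 1)\<bar>)"
        by (simp add: Basis_vec_def prod.UNION_disjoint axis_eq_axis)
      then show ?thesis by (simp add: c_axis det abs_prod)
    qed
    have "(\<integral>\<^sup>+x. F x \<partial>lborel) = (\<integral>\<^sup>+x. F x \<partial>density (distr lborel borel ((*v) A)) (\<lambda>_. ennreal \<bar>det A\<bar>))"
      using lborel_affine_euclidean[of c 0, OF cnz] unfolding T prod by simp
    also have "\<dots> = ennreal \<bar>det A\<bar> * (\<integral>\<^sup>+x. F (A *v x) \<partial>lborel)"
      using F m by (simp add: nn_integral_density nn_integral_distr nn_integral_cmult)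
    finally show "ennreal \<bar>det A\<bar> * (\<integral>\<^sup>+x. F (A *v x) \<partial>lborel) = (\<integral>\<^sup>+x. F x \<partial>lborel)" by simp
  next
    fix m n :: 'm and F :: "real^'m \<Rightarrow> ennreal"
    assume "m \<noteq> n" and F: "F \<in> borel_measurable borel"
    let ?p = "Transposition.transpose m n"
    have p: "?p permutes UNIV" by (rule permutes_swap_id) auto
    have "(\<chi> i j. mat 1 $ i $ ?p j) *v x = (\<chi> i. x $ ?p i)" for x :: "real^'m"
    proof -
      have "(\<Sum>j\<in>UNIV. mat 1 $ i $ ?p j * x $ j) = (\<Sum>j\<in>UNIV. if j = ?p i then x $ j else 0)" for i
        by (intro sum.cong) (auto simp: mat_def)
      then show ?thesis by (simp add: matrix_vector_mult_def vec_eq_iff)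
    qed
    moreover have "\<bar>det (\<chi> i j. mat 1 $ i $ ?p j :: real^'m^'m)\<bar> = 1"
      using det_permute_columns[OF p, of "mat 1 :: real^'m^'m"] by (simp add: sign_def)
    ultimately show "ennreal \<bar>det (\<chi> i j. mat 1 $ i $ ?p j :: real^'m^'m)\<bar> * (\<integral>\<^sup>+x. F ((\<chi> i j. mat 1 $ i $ ?p j) *v x) \<partial>lborel)
        = (\<integral>\<^sup>+x. F x \<partial>lborel)"
      using nn_integral_lborel_permute[OF F p] by simp
  next
    fix m n :: 'm and F :: "real^'m \<Rightarrow> ennreal"
    assume mn: "m \<noteq> n" and F: "F \<in> borel_measurable borel"
    let ?A = "(\<chi> i j. of_bool (i = m \<and> j = n \<or> i = j)) :: real^'m^'m"
    have "?A = (\<chi> k. if k = m then row m (mat 1) + 1 *s row n (mat 1) else row k (mat 1))"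
      using mn by (auto simp: vec_eq_iff row_def mat_def)
    then have det: "det ?A = 1" using det_row_operation[OF mn, of "mat 1 :: real^'m^'m" 1] by simp
    have vec: "?A *v x = x + (x $ n) *\<^sub>R axis m 1" for x
    proof -
      have "(\<Sum>j\<in>UNIV. of_bool (i = m \<and> j = n \<or> i = j) * x $ j) = x $ i + x $ n * axis m 1 $ i" for i
      proof (cases "i = m")
        case True
        then have "(\<Sum>j\<in>UNIV. of_bool (i = m \<and> j = n \<or> i = j) * x $ j) = (\<Sum>j\<in>UNIV. (if j = n then x $ j else 0) + (if j = m then x $ j else 0))"
          using mn by (intro sum.cong) auto
        with True show ?thesis by (simp add: sum.distrib axis_def)
      next
        case False
        then have "(\<Sum>j\<in>UNIV. of_bool (i = m \<and> j = n \<or> i = j) * x $ j) = (\<Sum>j\<in>UNIV. if j = i then x $ j else 0)"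
          by (intro sum.cong) auto
        with False show ?thesis by (simp add: axis_def)
      qed
      then show ?thesis by (simp add: vec_eq_iff matrix_vector_mult_def)
    qed
    have "(\<integral>\<^sup>+x. F (x + (x $ n) *\<^sub>R axis m 1) \<partial>lborel) = (\<integral>\<^sup>+x. F x \<partial>lborel)"
      using mn
      by (intro nn_integral_lborel_shear F borel_measurable_continuous_onI continuous_intros)
         (auto simp: Basis_vec_def axis_def)
    then show "ennreal \<bar>det ?A\<bar> * (\<integral>\<^sup>+x. F (?A *v x) \<partial>lborel) = (\<integral>\<^sup>+x. F x \<partial>lborel)"
      by (simp only: det vec) simp
  qed
  then show ?thesis using assms by (simp add: Q_def)
qed

section \<open>Change of variables on the sphere\<close>

lemma ennreal_SUP_power:
  fixes f :: "nat \<Rightarrow> ennreal"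
  assumes "incseq f"
  shows "(SUP i. f i) ^ n = (SUP i. f i ^ n)"
proof (induction n)
  case (Suc n)
  have "(SUP i. f i) ^ Suc n = (SUP i. SUP j. f i * f j ^ n)"
    unfolding power_Suc Suc SUP_mult_right_ennreal by (simp only: SUP_mult_left_ennreal)
  also have "\<dots> = (SUP i. f i ^ Suc n)"
  proof (intro antisym SUP_least)
    fix i j
    have "f i * f j ^ n \<le> f (max i j) * f (max i j) ^ n"
      using assms by (intro mult_mono power_mono) (auto simp: incseq_def)
    then show "f i * f j ^ n \<le> (SUP i. f i ^ Suc n)"
      by (intro SUP_upper2[of "max i j"]) auto
  next
    fix i
    show "f i ^ Suc n \<le> (SUP i. SUP j. f i * f j ^ n)"
      by (intro SUP_upper2[of i]) auto
  qed
  finally show ?case .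
qed simp

lemma nn_integral_sgn_scale:
  fixes \<Phi> :: "'a::euclidean_space \<Rightarrow> ennreal" and c :: ennreal
  assumes [measurable]: "\<Phi> \<in> borel_measurable borel" and c: "c < \<infinity>"
  shows "(\<integral>\<^sup>+x. \<Phi> (sgn x) * indicator {x. ennreal (norm x) < c} x \<partial>lborel)
    = c ^ DIM('a) * (\<integral>\<^sup>+x. \<Phi> (sgn x) * indicator (ball 0 1) x \<partial>lborel)"
proof (cases "c = 0")
  case True
  then show ?thesis by (simp add: power_0_left)
next
  case False
  then obtain r where r: "c = ennreal r" "0 < r"
    using c by (cases c) (auto simp: order_less_le)
  have [measurable]: "sgn \<in> borel \<rightarrow>\<^sub>M (borel :: 'a measure)"
    by (simp add: sgn_div_norm[abs_def])
  have [measurable]: "ball (0 :: 'a) 1 \<in> sets borel" by simp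
  have "(\<integral>\<^sup>+x. \<Phi> (sgn x) * indicator {x. ennreal (norm x) < c} x \<partial>lborel)
      = (\<integral>\<^sup>+x. \<Phi> (sgn x) * indicator {x. ennreal (norm x) < c} x \<partial>density (distr lborel borel (\<lambda>x :: 'a. 0 + r *\<^sub>R x)) (\<lambda>_. ennreal (\<bar>r\<bar> ^ DIM('a))))"
    using r by (subst lborel_affine[of r 0]) auto
  also have "\<dots> = (\<integral>\<^sup>+x. ennreal (\<bar>r\<bar> ^ DIM('a)) * (\<Phi> (sgn (r *\<^sub>R x)) * indicator {x. ennreal (norm x) < c} (r *\<^sub>R x)) \<partial>lborel)"
    by (simp add: nn_integral_density nn_integral_distr)
  also have "\<dots> = (\<integral>\<^sup>+x. c ^ DIM('a) * (\<Phi> (sgn x) * indicator (ball 0 1) x) \<partial>lborel)"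
    using r by (intro nn_integral_cong)
      (auto simp: sgn_scaleR ennreal_power ennreal_less_iff indicator_def)
  also have "\<dots> = c ^ DIM('a) * (\<integral>\<^sup>+x. \<Phi> (sgn x) * indicator (ball 0 1) x \<partial>lborel)"
    by (rule nn_integral_cmult) simp
  finally show ?thesis .
qed

text \<open>Polar coordinates without the surface measure: over the star-shaped domain with radius \<open>r\<close>, the
  integral of a function that depends on the direction only is its integral over the unit ball,
  weighted with \<open>r\<close> to the power of the dimension. For constant \<open>r\<close> this is the scaling of Lebesgue
  measure; a simple function \<open>r\<close> splits the space into finitely many cones, and monotone convergence
  does the rest.\<close>

lemma nn_integral_star_domain:
  fixes \<Phi> r :: "'a::euclidean_space \<Rightarrow> ennreal"
  assumes [measurable]: "\<Phi> \<in> borel_measurable borel" and r[measurable]: "r \<in> borel_measurable borel"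
  shows "(\<integral>\<^sup>+x. \<Phi> (sgn x) * indicator {x. ennreal (norm x) < r (sgn x)} x \<partial>lborel)
    = (\<integral>\<^sup>+x. \<Phi> (sgn x) * r (sgn x) ^ DIM('a) * indicator (ball 0 1) x \<partial>lborel)"
proof -
  have [measurable]: "sgn \<in> borel \<rightarrow>\<^sub>M (borel :: 'a measure)"
    by (simp add: sgn_div_norm[abs_def])
  have [measurable]: "ball (0 :: 'a) 1 \<in> sets borel" by simp
  obtain s where s: "\<And>i. simple_function borel (s i)" "incseq s" "\<And>i x. s i x < \<infinity>" "\<And>x. (SUP i. s i x) = r x"
    using borel_measurable_implies_simple_function_sequence'[OF r] unfolding infinity_ennreal_def by metis
  have s_mono: "incseq (\<lambda>i. s i x)" for x using s(2) by (auto simp: incseq_def le_fun_def)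
  note [measurable] = borel_measurable_simple_function[OF s(1)]
  have simple: "(\<integral>\<^sup>+x. \<Phi> (sgn x) * indicator {x. ennreal (norm x) < s i (sgn x)} x \<partial>lborel)
    = (\<integral>\<^sup>+x. \<Phi> (sgn x) * s i (sgn x) ^ DIM('a) * indicator (ball 0 1) x \<partial>lborel)" for i
  proof -
    let ?R = "range (s i)"
    have fin: "finite ?R" using simple_functionD(1)[OF s(1)] by simp
    let ?\<Phi> = "\<lambda>c x. \<Phi> x * indicator (s i -` {c}) x"
    have [measurable]: "s i -` {c} \<in> sets borel" for c
      using simple_functionD(2)[OF s(1), where X = "{c}"] by simp
    have split: "\<Phi> y * h (s i y) = (\<Sum>c\<in>?R. ?\<Phi> c y * h c)" for y and h :: "ennreal \<Rightarrow> ennreal"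
      using fin by (subst sum.remove[of _ "s i y"]) (auto intro!: sum.neutral)
    have "(\<integral>\<^sup>+x. \<Phi> (sgn x) * indicator {x. ennreal (norm x) < s i (sgn x)} x \<partial>lborel)
        = (\<integral>\<^sup>+x. (\<Sum>c\<in>?R. ?\<Phi> c (sgn x) * indicator {x. ennreal (norm x) < c} x) \<partial>lborel)"
    proof (rule nn_integral_cong)
      fix x :: 'a
      have "\<Phi> (sgn x) * (if ennreal (norm x) < s i (sgn x) then 1 else 0)
          = (\<Sum>c\<in>?R. ?\<Phi> c (sgn x) * (if ennreal (norm x) < c then 1 else 0))"
        by (rule split)
      then show "\<Phi> (sgn x) * indicator {x. ennreal (norm x) < s i (sgn x)} x
          = (\<Sum>c\<in>?R. ?\<Phi> c (sgn x) * indicator {x. ennreal (norm x) < c} x)"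
        unfolding indicator_def of_bool_def mem_Collect_eq .
    qed
    also have "\<dots> = (\<Sum>c\<in>?R. \<integral>\<^sup>+x. ?\<Phi> c (sgn x) * indicator {x. ennreal (norm x) < c} x \<partial>lborel)"
      by (rule nn_integral_sum) measurable
    also have "\<dots> = (\<Sum>c\<in>?R. c ^ DIM('a) * (\<integral>\<^sup>+x. ?\<Phi> c (sgn x) * indicator (ball 0 1) x \<partial>lborel))"
      using s(3) by (intro sum.cong refl nn_integral_sgn_scale) auto
    also have "\<dots> = (\<Sum>c\<in>?R. \<integral>\<^sup>+x. c ^ DIM('a) * (?\<Phi> c (sgn x) * indicator (ball 0 1) x) \<partial>lborel)"
      by (intro sum.cong refl nn_integral_cmult[symmetric]) measurable
    also have "\<dots> = (\<integral>\<^sup>+x. (\<Sum>c\<in>?R. c ^ DIM('a) * (?\<Phi> c (sgn x) * indicator (ball 0 1) x)) \<partial>lborel)"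
      by (rule nn_integral_sum[symmetric]) measurable
    also have "\<dots> = (\<integral>\<^sup>+x. \<Phi> (sgn x) * s i (sgn x) ^ DIM('a) * indicator (ball 0 1) x \<partial>lborel)"
      by (intro nn_integral_cong) (subst split[of _ "\<lambda>c. c ^ DIM('a)"], simp add: sum_distrib_right sum_distrib_left mult_ac)
    finally show ?thesis .
  qed
  have "(\<integral>\<^sup>+x. \<Phi> (sgn x) * indicator {x. ennreal (norm x) < r (sgn x)} x \<partial>lborel)
      = (\<integral>\<^sup>+x. (SUP i. \<Phi> (sgn x) * indicator {x. ennreal (norm x) < s i (sgn x)} x) \<partial>lborel)"
  proof (rule nn_integral_cong)
    fix x :: 'a
    have "indicator {x. ennreal (norm x) < r (sgn x)} x = (SUP i. indicator {x. ennreal (norm x) < s i (sgn x)} x :: ennreal)"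
    proof (cases "ennreal (norm x) < r (sgn x)")
      case True
      then obtain i where i: "ennreal (norm x) < s i (sgn x)" unfolding s(4)[symmetric] less_SUP_iff by blast
      show ?thesis
        using True i by (intro antisym SUP_upper2[of i] SUP_least) (auto simp: indicator_def)
    next
      case False
      then have "\<not> ennreal (norm x) < s i (sgn x)" for i
        unfolding s(4)[symmetric] less_SUP_iff by blast
      with False show ?thesis by simp
    qed
    then show "\<Phi> (sgn x) * indicator {x. ennreal (norm x) < r (sgn x)} x
        = (SUP i. \<Phi> (sgn x) * indicator {x. ennreal (norm x) < s i (sgn x)} x)"
      by (simp add: SUP_mult_left_ennreal)
  qed
  also have "\<dots> = (SUP i. \<integral>\<^sup>+x. \<Phi> (sgn x) * indicator {x. ennreal (norm x) < s i (sgn x)} x \<partial>lborel)"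
  proof (rule nn_integral_monotone_convergence_SUP)
    show "incseq (\<lambda>i x. \<Phi> (sgn x) * indicator {x. ennreal (norm x) < s i (sgn x)} x)"
      using s_mono by (auto simp: incseq_def le_fun_def indicator_def intro!: mult_left_mono dest: order.strict_trans2)
  qed measurable
  also have "\<dots> = (SUP i. \<integral>\<^sup>+x. \<Phi> (sgn x) * s i (sgn x) ^ DIM('a) * indicator (ball 0 1) x \<partial>lborel)"
    by (simp only: simple)
  also have "\<dots> = (\<integral>\<^sup>+x. (SUP i. \<Phi> (sgn x) * s i (sgn x) ^ DIM('a) * indicator (ball 0 1) x) \<partial>lborel)"
  proof (rule nn_integral_monotone_convergence_SUP[symmetric])
    show "incseq (\<lambda>i x. \<Phi> (sgn x) * s i (sgn x) ^ DIM('a) * indicator (ball 0 1) x)"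
      using s_mono by (auto simp: incseq_def le_fun_def intro!: mult_left_mono mult_right_mono power_mono)
  qed measurable
  also have "\<dots> = (\<integral>\<^sup>+x. \<Phi> (sgn x) * r (sgn x) ^ DIM('a) * indicator (ball 0 1) x \<partial>lborel)"
    unfolding s(4)[symmetric] ennreal_SUP_power[OF s_mono]
    by (simp add: SUP_mult_left_ennreal SUP_mult_right_ennreal)
  finally show ?thesis .
qed

lemma nn_integral_sphere_measure:
  fixes F :: "real^'m \<Rightarrow> ennreal"
  assumes F: "F \<in> borel_measurable (restrict_space borel unit_sphere)"
  shows "(\<integral>\<^sup>+u. F u \<partial>sphere_measure) =
    (\<integral>\<^sup>+x. F (sgn x) * indicator unit_sphere (sgn x) * indicator (ball 0 1) x \<partial>lborel) / emeasure lborel (ball 0 1 :: (real^'m) set)"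
proof -
  have [measurable]: "sgn \<in> borel \<rightarrow>\<^sub>M (borel :: (real^'m) measure)"
    by (simp add: sgn_div_norm[abs_def])
  have [measurable]: "(\<lambda>u. F u * indicator unit_sphere u) \<in> borel_measurable borel"
    using F by (subst (asm) borel_measurable_restrict_space_iff_ennreal) auto
  have "(\<integral>\<^sup>+u. F u \<partial>sphere_measure)
      = (\<integral>\<^sup>+u. F u * indicator unit_sphere u \<partial>distr (uniform_measure lborel (ball 0 1)) borel sgn)"
    unfolding sphere_measure_def by (rule nn_integral_restrict_space) simp
  also have "\<dots> = (\<integral>\<^sup>+x. F (sgn x) * indicator unit_sphere (sgn x) \<partial>uniform_measure lborel (ball 0 1))"
    by (rule nn_integral_distr) simp_all
  also have "\<dots> = (\<integral>\<^sup>+x. F (sgn x) * indicator unit_sphere (sgn x) * indicator (ball 0 1) x \<partial>lborel) / emeasure lborel (ball 0 1 :: (real^'m) set)"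
  proof (rule nn_integral_uniform_measure)
    show "(\<lambda>x. F (sgn x) * indicator unit_sphere (sgn x)) \<in> borel_measurable lborel"
      using measurable_compose[OF \<open>sgn \<in> _\<close> \<open>(\<lambda>u. F u * indicator unit_sphere u) \<in> borel_measurable borel\<close>] by simp
  qed simp
  finally show ?thesis .
qed

text \<open>The radial projection turns the integral over the sphere into one over the unit ball. The density
  \<open>\<parallel>gu\<parallel>\<close> to the power \<open>-m\<close> is the one belonging to the star-shaped domain of radius \<open>1 / \<parallel>gu\<parallel>\<close> in
  direction \<open>u\<close>, that is, to the preimage of the unit ball under \<open>g\<close>; and \<open>g\<close> preserves Lebesgue
  measure.\<close>

theorem sphere_change_of_variables:
  fixes g :: "real^'m^'m" and F :: "real^'m \<Rightarrow> ennreal"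
  assumes g: "g \<in> SL" and F: "F \<in> borel_measurable (restrict_space borel unit_sphere)"
  shows "(\<integral>\<^sup>+u. F (sphere_act g u) * ennreal (norm (g *v u) powr - real CARD('m)) \<partial>sphere_measure)
    = (\<integral>\<^sup>+u. F u \<partial>sphere_measure)"
proof -
  let ?S = "unit_sphere :: (real^'m) set" and ?B = "ball 0 1 :: (real^'m) set"
  note nz = SL_mult_vec_nonzero[OF g]
  have act: "sphere_act g \<in> restrict_space borel unit_sphere \<rightarrow>\<^sub>M restrict_space borel unit_sphere"
    using borel_measurable_continuous_on_restrict[OF continuous_on_sphere_act[OF g]] norm_sphere_act[OF g]
    by (intro measurable_restrict_space2) (auto simp: space_restrict_space)
  let ?r = "\<lambda>u. ennreal (1 / norm (g *v u))"
  have g_meas[measurable]: "(*v) g \<in> borel \<rightarrow>\<^sub>M borel"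
    by (intro borel_measurable_continuous_onI continuous_intros)
  have sgn_meas[measurable]: "sgn \<in> borel \<rightarrow>\<^sub>M (borel :: (real^'m) measure)"
    by (simp add: sgn_div_norm[abs_def])
  have F'[measurable]: "(\<lambda>u. F u * indicator ?S u) \<in> borel_measurable borel"
    using F by (subst (asm) borel_measurable_restrict_space_iff_ennreal) auto
  have Fa: "(\<lambda>u. F (sphere_act g u)) \<in> borel_measurable (restrict_space borel ?S)"
    by (rule measurable_compose[OF act F])
  have Fa'[measurable]: "(\<lambda>u. F (sphere_act g u) * indicator ?S u) \<in> borel_measurable borel"
    using Fa by (subst (asm) borel_measurable_restrict_space_iff_ennreal) auto
  have r_power: "?r u ^ DIM(real^'m) = ennreal (norm (g *v u) powr - real CARD('m))" if "u \<noteq> 0" for u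
    using nz[OF that] by (simp add: ennreal_power powr_minus powr_realpow power_one_over divide_simps)
  have dom: "ennreal (norm x) < ?r (sgn x) \<longleftrightarrow> g *v x \<in> ?B" if "x \<noteq> 0" for x
  proof -
    have "g *v sgn x = (1 / norm x) *\<^sub>R (g *v x)"
      by (simp add: sgn_div_norm matrix_vector_mult_scaleR divide_inverse)
    then have *: "1 / norm (g *v sgn x) = norm x / norm (g *v x)" using that by simp
    show ?thesis unfolding * using that nz[OF that] by (simp add: ennreal_less_iff pos_less_divide_eq)
  qed
  have act_sgn: "sphere_act g (sgn x) = sgn (g *v x)" if "x \<noteq> 0" for x
    using that nz[OF that] by (simp add: sphere_act_def sgn_div_norm matrix_vector_mult_scaleR inverse_eq_divide)
  have AE0: "AE x in lborel. x \<noteq> (0 :: real^'m)" by (rule AE_lborel_singleton)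
  have "(\<integral>\<^sup>+x. F (sphere_act g (sgn x)) * ennreal (norm (g *v sgn x) powr - real CARD('m)) * indicator ?S (sgn x) * indicator ?B x \<partial>lborel)
      = (\<integral>\<^sup>+x. F (sphere_act g (sgn x)) * indicator ?S (sgn x) * ?r (sgn x) ^ DIM(real^'m) * indicator ?B x \<partial>lborel)"
    using AE0 by (intro nn_integral_cong_AE) (auto elim!: eventually_mono simp: r_power sgn_zero_iff mult_ac simp del: DIM_cart)
  also have "\<dots> = (\<integral>\<^sup>+x. F (sphere_act g (sgn x)) * indicator ?S (sgn x) * indicator {x. ennreal (norm x) < ?r (sgn x)} x \<partial>lborel)"
    by (rule nn_integral_star_domain[symmetric, OF Fa']) measurable
  also have "\<dots> = (\<integral>\<^sup>+x. F (sgn (g *v x)) * indicator ?S (sgn (g *v x)) * indicator ?B (g *v x) \<partial>lborel)"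
    using AE0
  proof (intro nn_integral_cong_AE, eventually_elim)
    fix x :: "real^'m" assume x: "x \<noteq> 0"
    have "sgn x \<in> ?S" "sgn (g *v x) \<in> ?S" using x nz[OF x] by (auto simp: norm_sgn)
    then show "F (sphere_act g (sgn x)) * indicator ?S (sgn x) * indicator {x. ennreal (norm x) < ?r (sgn x)} x
        = F (sgn (g *v x)) * indicator ?S (sgn (g *v x)) * indicator ?B (g *v x)"
      using dom[OF x] act_sgn[OF x] by (simp add: indicator_def)
  qed
  also have "\<dots> = (\<integral>\<^sup>+x. F (sgn x) * indicator ?S (sgn x) * indicator ?B x \<partial>lborel)"
  proof -
    have "(\<lambda>x. F (sgn x) * indicator ?S (sgn x) * indicator ?B x) \<in> borel_measurable borel"
      by (rule borel_measurable_times_ennreal[OF measurable_compose[OF sgn_meas F'] borel_measurable_indicator]) simp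
    moreover have "det g = 1" using g by (simp add: SL_def)
    ultimately show ?thesis
      using nn_integral_lborel_linear[of g "\<lambda>x. F (sgn x) * indicator ?S (sgn x) * indicator ?B x"] by simp
  qed
  finally have eq: "(\<integral>\<^sup>+x. F (sphere_act g (sgn x)) * ennreal (norm (g *v sgn x) powr - real CARD('m)) * indicator ?S (sgn x) * indicator ?B x \<partial>lborel)
      = (\<integral>\<^sup>+x. F (sgn x) * indicator ?S (sgn x) * indicator ?B x \<partial>lborel)" .
  have m: "(\<lambda>u. F (sphere_act g u) * ennreal (norm (g *v u) powr - real CARD('m))) \<in> borel_measurable (restrict_space borel ?S)"
    by (rule borel_measurable_times_ennreal[OF Fa measurable_restrict_space1]) measurable
  show ?thesis
    unfolding nn_integral_sphere_measure[OF F] nn_integral_sphere_measure[OF m] eq ..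
qed

section \<open>Square-integrable functions and the twisted action\<close>

text \<open>The unitary representation of the group on the square-integrable functions on the sphere; \<open>hat_V\<close>
  applies it fibrewise.\<close>

definition twist :: "real^'m^'m \<Rightarrow> (real^'m \<Rightarrow> real) \<Rightarrow> real^'m \<Rightarrow> real" where
  "twist g \<phi> u = \<phi> (sphere_act g u) * norm (g *v u) powr (- (real CARD('m) / 2))"

text \<open>The square of the norm as an extended number: it is defined without integrability and allows Tonelli's
  theorem to be used freely.\<close>

definition sq_norm :: "'a measure \<Rightarrow> ('a \<Rightarrow> real) \<Rightarrow> ennreal" where
  "sq_norm M f = (\<integral>\<^sup>+x. ennreal ((f x)\<^sup>2) \<partial>M)"

lemma sets_sphere_measure [measurable_cong]:
  "sets (sphere_measure :: (real^'m) measure) = sets (restrict_space borel unit_sphere)"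
  unfolding sphere_measure_def by (rule sets_restrict_space_cong) simp

lemma space_sphere_measure: "space (sphere_measure :: (real^'m) measure) = unit_sphere"
  using sets_eq_imp_space_eq[OF sets_sphere_measure] by (simp add: space_restrict_space)

lemma sphere_measure_prob: "sphere_measure \<in> prob_measures_on (unit_sphere :: (real^'m) set)"
  using prob_space_sphere_measure sets_sphere_measure by (simp add: prob_measures_on_def)

lemma measurable_act:
  fixes g :: "'x \<Rightarrow> real^'m^'m"
  assumes g: "g \<in> X \<rightarrow>\<^sub>M restrict_space borel SL"
  shows "(\<lambda>z. g (fst z) *v snd z) \<in> borel_measurable (X \<Otimes>\<^sub>M sphere_measure)"
    and "(\<lambda>z. sphere_act (g (fst z)) (snd z)) \<in> X \<Otimes>\<^sub>M sphere_measure \<rightarrow>\<^sub>M sphere_measure"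
proof -
  have g': "g \<in> borel_measurable X" and gSL: "\<And>x. x \<in> space X \<Longrightarrow> g x \<in> SL"
    using g by (auto simp: measurable_restrict_space2_iff)
  have id: "(\<lambda>u. u) \<in> borel_measurable (sphere_measure :: (real^'m) measure)"
    by (simp add: measurable_cong_sets[OF sets_sphere_measure refl] measurable_restrict_space1)
  show mult: "(\<lambda>z. g (fst z) *v snd z) \<in> borel_measurable (X \<Otimes>\<^sub>M sphere_measure)"
    by (rule borel_measurable_continuous_Pair[OF measurable_compose[OF measurable_fst g'] measurable_compose[OF measurable_snd id]])
       (intro continuous_intros)
  have "(\<lambda>z. sphere_act (g (fst z)) (snd z)) \<in> borel_measurable (X \<Otimes>\<^sub>M sphere_measure)"
    unfolding sphere_act_def using mult by measurable
  then have "(\<lambda>z. sphere_act (g (fst z)) (snd z)) \<in> X \<Otimes>\<^sub>M sphere_measure \<rightarrow>\<^sub>M restrict_space borel unit_sphere"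
    by (rule measurable_restrict_space2[rotated])
       (auto simp: space_pair_measure space_sphere_measure gSL norm_sphere_act)
  then show "(\<lambda>z. sphere_act (g (fst z)) (snd z)) \<in> X \<Otimes>\<^sub>M sphere_measure \<rightarrow>\<^sub>M sphere_measure"
    by (simp add: measurable_cong_sets[OF refl sets_sphere_measure])
qed

lemma measurable_hat_V:
  fixes g :: "'x \<Rightarrow> real^'m^'m"
  assumes g: "g \<in> X \<rightarrow>\<^sub>M restrict_space borel SL" and f: "f \<in> borel_measurable (X \<Otimes>\<^sub>M sphere_measure)"
  shows "hat_V g f \<in> borel_measurable (X \<Otimes>\<^sub>M sphere_measure)"
proof -
  note [measurable] = measurable_act[OF g] f
  have "(\<lambda>z. f (fst z, sphere_act (g (fst z)) (snd z)) * norm (g (fst z) *v snd z) powr (- (real CARD('m) / 2)))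
      \<in> borel_measurable (X \<Otimes>\<^sub>M sphere_measure)" by measurable
  then show ?thesis by (simp add: hat_V_def case_prod_beta')
qed

lemma measurable_twist_pair:
  fixes \<phi> :: "real^'m \<Rightarrow> real"
  assumes \<phi>: "\<phi> \<in> borel_measurable sphere_measure" and N: "sets N = sets (restrict_space borel SL)"
  shows "(\<lambda>(g, u). twist g \<phi> u) \<in> borel_measurable (N \<Otimes>\<^sub>M sphere_measure)"
proof -
  have "(\<lambda>g :: real^'m^'m. g) \<in> N \<rightarrow>\<^sub>M restrict_space borel SL"
    using N by (simp add: measurable_cong_sets[OF N refl])
  from measurable_hat_V[OF this, of "\<lambda>z. \<phi> (snd z)"] \<phi> show ?thesis
    by (simp add: hat_V_def twist_def)
qed

lemma measurable_twist:
  fixes g :: "real^'m^'m"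
  assumes "g \<in> SL" "\<phi> \<in> borel_measurable sphere_measure"
  shows "twist g \<phi> \<in> borel_measurable sphere_measure"
proof -
  have "g \<in> space (restrict_space borel SL)" using assms by (simp add: space_restrict_space)
  from measurable_Pair2[OF measurable_twist_pair[OF assms(2) refl] this] show ?thesis by simp
qed

lemma measurable_sphere_act:
  fixes g :: "real^'m^'m"
  assumes "g \<in> SL"
  shows "sphere_act g \<in> sphere_measure \<rightarrow>\<^sub>M sphere_measure"
proof -
  have "(\<lambda>g :: real^'m^'m. g) \<in> restrict_space borel SL \<rightarrow>\<^sub>M restrict_space borel SL" by simp
  from measurable_Pair2[OF measurable_act(2)[OF this], of g] assms show ?thesis
    by (simp add: space_restrict_space)
qed

lemma twist_sq:
  fixes g :: "real^'m^'m"
  shows "(twist g \<phi> u)\<^sup>2 = (\<phi> (sphere_act g u))\<^sup>2 * norm (g *v u) powr - real CARD('m)"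
  by (simp add: twist_def power_mult_distrib power2_eq_square flip: powr_add)

lemma nn_integral_twist:
  fixes g :: "real^'m^'m" and F :: "real^'m \<Rightarrow> ennreal"
  assumes g: "g \<in> SL" and [measurable]: "\<phi> \<in> borel_measurable sphere_measure" "F \<in> borel_measurable sphere_measure"
  shows "(\<integral>\<^sup>+u. F (sphere_act g u) * ennreal ((twist g \<phi> u)\<^sup>2) \<partial>sphere_measure)
    = (\<integral>\<^sup>+u. F u * ennreal ((\<phi> u)\<^sup>2) \<partial>sphere_measure)"
proof -
  have "(\<lambda>u. F u * ennreal ((\<phi> u)\<^sup>2)) \<in> borel_measurable sphere_measure" by measurable
  then have "(\<lambda>u. F u * ennreal ((\<phi> u)\<^sup>2)) \<in> borel_measurable (restrict_space borel unit_sphere)"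
    by (simp add: measurable_cong_sets[OF sets_sphere_measure refl])
  from sphere_change_of_variables[OF g this] show ?thesis
    by (simp add: twist_sq ennreal_mult mult.assoc)
qed

lemma sq_norm_twist:
  fixes g :: "real^'m^'m"
  assumes g: "g \<in> SL" and \<phi>: "\<phi> \<in> borel_measurable sphere_measure"
  shows "sq_norm sphere_measure (twist g \<phi>) = sq_norm sphere_measure \<phi>"
  using nn_integral_twist[OF g \<phi>, of "\<lambda>_. 1"] by (simp add: sq_norm_def)

lemma L2_iff: "f \<in> L2 M \<longleftrightarrow> f \<in> borel_measurable M \<and> sq_norm M f < \<infinity>"
  unfolding L2_def sq_norm_def by (auto simp: integrable_iff_bounded)

lemma L2_measurable: "f \<in> L2 M \<Longrightarrow> f \<in> borel_measurable M"
  by (simp add: L2_def)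

lemma L2_integrable_sq: "f \<in> L2 M \<Longrightarrow> integrable M (\<lambda>x. (f x)\<^sup>2)"
  by (simp add: L2_def)

lemma sq_norm_L2: "f \<in> L2 M \<Longrightarrow> sq_norm M f = ennreal (\<integral>x. (f x)\<^sup>2 \<partial>M)"
  unfolding sq_norm_def by (rule nn_integral_eq_integral) (auto simp: L2_def)

lemma L2_integrable_mult:
  assumes "f \<in> L2 M" "h \<in> L2 M"
  shows "integrable M (\<lambda>x. f x * h x)"
proof (rule Bochner_Integration.integrable_bound)
  show "integrable M (\<lambda>x. (f x)\<^sup>2 + (h x)\<^sup>2)" using assms by (simp add: L2_def)
  show "(\<lambda>x. f x * h x) \<in> borel_measurable M" using assms by (auto simp: L2_def)
  have "\<bar>f x * h x\<bar> \<le> (f x)\<^sup>2 + (h x)\<^sup>2" for x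
  proof -
    have "2 * \<bar>f x\<bar> * \<bar>h x\<bar> \<le> \<bar>f x\<bar>\<^sup>2 + \<bar>h x\<bar>\<^sup>2" by (rule sum_squares_bound)
    moreover have "0 \<le> \<bar>f x\<bar> * \<bar>h x\<bar>" by simp
    ultimately have "\<bar>f x\<bar> * \<bar>h x\<bar> \<le> \<bar>f x\<bar>\<^sup>2 + \<bar>h x\<bar>\<^sup>2" by linarith
    then show ?thesis by (simp add: abs_mult)
  qed
  then show "AE x in M. norm (f x * h x) \<le> norm ((f x)\<^sup>2 + (h x)\<^sup>2)" by simp
qed

lemma L2_add: "f \<in> L2 M \<Longrightarrow> h \<in> L2 M \<Longrightarrow> (\<lambda>x. f x + h x) \<in> L2 M"
  using L2_integrable_mult[of f M h] by (auto simp: L2_def power2_sum mult.assoc)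

lemma L2_diff: "f \<in> L2 M \<Longrightarrow> h \<in> L2 M \<Longrightarrow> (\<lambda>x. f x - h x) \<in> L2 M"
  using L2_integrable_mult[of f M h] by (auto simp: L2_def power2_diff mult.assoc)

lemma twist_L2: "g \<in> SL \<Longrightarrow> \<phi> \<in> L2 sphere_measure \<Longrightarrow> twist g \<phi> \<in> L2 sphere_measure"
  by (simp add: L2_iff sq_norm_twist measurable_twist)

lemma integral_twist_sq:
  fixes g :: "real^'m^'m"
  assumes "g \<in> SL" "\<phi> \<in> L2 sphere_measure"
  shows "(\<integral>u. (twist g \<phi> u)\<^sup>2 \<partial>sphere_measure) = (\<integral>u. (\<phi> u)\<^sup>2 \<partial>sphere_measure)"
  using sq_norm_twist[OF assms(1) L2_measurable[OF assms(2)]] assms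
  by (simp add: sq_norm_L2 twist_L2)

text \<open>This ties the unitary action on functions to the action on measures: the measure with density
  \<open>(twist g \<phi>)\<^sup>2\<close> is the image under \<open>g\<inverse>\<close> of the measure with density \<open>\<phi>\<^sup>2\<close>.\<close>

lemma integral_mult_twist:
  fixes g :: "real^'m^'m" and f :: "real^'m \<Rightarrow> real"
  assumes g: "g \<in> SL" and \<phi>: "\<phi> \<in> borel_measurable sphere_measure" and f: "f \<in> borel_measurable sphere_measure"
  shows "(\<integral>u. f u * (twist g \<phi> u)\<^sup>2 \<partial>sphere_measure)
    = (\<integral>u. f (sphere_act (matrix_inv g) u) * (\<phi> u)\<^sup>2 \<partial>sphere_measure)"
proof -
  let ?P = "density sphere_measure (\<lambda>u. ennreal ((twist g \<phi> u)\<^sup>2))"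
  let ?Q = "density sphere_measure (\<lambda>u. ennreal ((\<phi> u)\<^sup>2))"
  note [measurable] = \<phi> f measurable_twist[OF g \<phi>] measurable_sphere_act[OF g]
    measurable_sphere_act[OF matrix_inv_SL(3)[OF g]]
  have eq: "distr ?P sphere_measure (sphere_act g) = ?Q"
  proof (rule measure_eqI)
    fix A assume "A \<in> sets (distr ?P sphere_measure (sphere_act g))"
    then have [measurable]: "A \<in> sets sphere_measure" by simp
    have "emeasure (distr ?P sphere_measure (sphere_act g)) A
        = (\<integral>\<^sup>+u. indicator A (sphere_act g u) * ennreal ((twist g \<phi> u)\<^sup>2) \<partial>sphere_measure)"
      by (subst nn_integral_indicator[symmetric], simp, subst nn_integral_distr)
         (simp_all add: nn_integral_density mult.commute)
    also have "\<dots> = (\<integral>\<^sup>+u. indicator A u * ennreal ((\<phi> u)\<^sup>2) \<partial>sphere_measure)"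
      by (rule nn_integral_twist[OF g]) simp_all
    also have "\<dots> = emeasure ?Q A" by (simp add: emeasure_density mult.commute)
    finally show "emeasure (distr ?P sphere_measure (sphere_act g)) A = emeasure ?Q A" .
  qed simp
  have "(\<integral>u. f u * (twist g \<phi> u)\<^sup>2 \<partial>sphere_measure) = (\<integral>u. f u \<partial>?P)"
    by (subst integral_density) (simp_all add: mult.commute)
  also have "\<dots> = (\<integral>u. f (sphere_act (matrix_inv g) (sphere_act g u)) \<partial>?P)"
    by (intro Bochner_Integration.integral_cong) (simp_all add: space_sphere_measure sphere_act_inv[OF g])
  also have "\<dots> = (\<integral>u. f (sphere_act (matrix_inv g) u) \<partial>distr ?P sphere_measure (sphere_act g))"
    by (subst integral_distr) simp_all
  also have "\<dots> = (\<integral>u. f (sphere_act (matrix_inv g) u) * (\<phi> u)\<^sup>2 \<partial>sphere_measure)"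
    unfolding eq by (subst integral_density) (simp_all add: mult.commute)
  finally show ?thesis .
qed

abbreviation energy :: "(real^'m \<Rightarrow> real) \<Rightarrow> real" where
  "energy \<phi> \<equiv> \<integral>u. (\<phi> u)\<^sup>2 \<partial>sphere_measure"

definition weighted :: "(real^'m \<Rightarrow> real) \<Rightarrow> (real^'m) measure" where
  "weighted \<phi> = density sphere_measure (\<lambda>u. ennreal ((\<phi> u)\<^sup>2 / energy \<phi>))"

lemma weighted_prob:
  fixes \<phi> :: "real^'m \<Rightarrow> real"
  assumes \<phi>: "\<phi> \<in> L2 sphere_measure" and pos: "0 < energy \<phi>"
  shows "weighted \<phi> \<in> prob_measures_on unit_sphere"
proof -
  have [measurable]: "\<phi> \<in> borel_measurable sphere_measure" by (rule L2_measurable[OF \<phi>])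
  have "emeasure (weighted \<phi>) (space (weighted \<phi>)) = (\<integral>\<^sup>+u. ennreal ((\<phi> u)\<^sup>2 / energy \<phi>) \<partial>sphere_measure)"
    by (simp add: weighted_def emeasure_density cong: nn_integral_cong)
  also have "\<dots> = 1"
    using L2_integrable_sq[OF \<phi>] pos by (subst nn_integral_eq_integral) auto
  finally show ?thesis
    using sets_sphere_measure by (auto simp: prob_measures_on_def weighted_def intro: prob_spaceI)
qed

lemma integral_weighted:
  fixes \<phi> :: "real^'m \<Rightarrow> real"
  assumes "\<phi> \<in> L2 sphere_measure" "f \<in> borel_measurable sphere_measure"
  shows "(\<integral>u. f u \<partial>weighted \<phi>) = (\<integral>u. f u * (\<phi> u)\<^sup>2 \<partial>sphere_measure) / energy \<phi>"
proof -
  have [measurable]: "\<phi> \<in> borel_measurable sphere_measure" by (rule L2_measurable[OF assms(1)])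
  show ?thesis
    unfolding weighted_def using assms(2) by (subst integral_density) (auto simp: mult.commute)
qed

text \<open>If a test function \<open>f\<close> tells the images of \<open>\<phi>\<^sup>2\<close> under \<open>g\<inverse>\<close> and \<open>h\<inverse>\<close> apart, then the functions
  \<open>p = twist g \<phi>\<close> and \<open>q = twist h \<phi>\<close> must be apart in norm, because
  \<open>p\<^sup>2 - q\<^sup>2 = (p - q) (p + q)\<close> and \<open>p + q\<close> has norm at most \<open>2 \<parallel>\<phi>\<parallel>\<close>.\<close>

lemma twist_separation:
  fixes g h :: "real^'m^'m" and f :: "real^'m \<Rightarrow> real"
  assumes g: "g \<in> SL" and h: "h \<in> SL" and \<phi>: "\<phi> \<in> L2 sphere_measure"
    and f: "continuous_on unit_sphere f" and B: "0 < B" "\<And>u. u \<in> unit_sphere \<Longrightarrow> \<bar>f u\<bar> \<le> B"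
    and pos: "0 < energy \<phi>" and \<delta>: "0 < \<delta>"
    and sep: "\<delta> < \<bar>\<integral>u. f (sphere_act (matrix_inv g) u) - f (sphere_act (matrix_inv h) u) \<partial>weighted \<phi>\<bar>"
  shows "\<delta>\<^sup>2 / (4 * B\<^sup>2) * energy \<phi>
    \<le> (\<integral>u. (twist g \<phi> u - twist h \<phi> u)\<^sup>2 \<partial>sphere_measure)"
proof -
  let ?a = "energy \<phi>"
  let ?p = "twist g \<phi>" and ?q = "twist h \<phi>"
  let ?fg = "\<lambda>u. f (sphere_act (matrix_inv g) u)" and ?fh = "\<lambda>u. f (sphere_act (matrix_inv h) u)"
  have f_meas[measurable]: "f \<in> borel_measurable sphere_measure"
    by (rule measurable_prob_measures_on[OF sphere_measure_prob f])
  have [measurable]: "\<phi> \<in> borel_measurable sphere_measure" by (rule L2_measurable[OF \<phi>])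
  note [measurable] = measurable_sphere_act[OF matrix_inv_SL(3)[OF g]] measurable_sphere_act[OF matrix_inv_SL(3)[OF h]]
  have p: "?p \<in> L2 sphere_measure" and q: "?q \<in> L2 sphere_measure" using g h \<phi> by (auto intro: twist_L2)
  have fi: "integrable sphere_measure (\<lambda>u. r u * (x u)\<^sup>2)"
    if "r \<in> borel_measurable sphere_measure" "\<And>u. u \<in> unit_sphere \<Longrightarrow> \<bar>r u\<bar> \<le> B" "x \<in> L2 sphere_measure" for r x :: "real^'m \<Rightarrow> real"
  proof (rule Bochner_Integration.integrable_bound)
    show "integrable sphere_measure (\<lambda>u. B * (x u)\<^sup>2)" using L2_integrable_sq[OF that(3)] by simp
    show "(\<lambda>u. r u * (x u)\<^sup>2) \<in> borel_measurable sphere_measure"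
      using that(1) L2_measurable[OF that(3)] by measurable
    show "AE u in sphere_measure. norm (r u * (x u)\<^sup>2) \<le> norm (B * (x u)\<^sup>2)"
      using that(2) B(1) by (intro AE_I2) (auto simp: abs_mult space_sphere_measure intro!: mult_right_mono)
  qed
  have fg_bd: "\<bar>?fg u\<bar> \<le> B" "\<bar>?fh u\<bar> \<le> B" if "u \<in> unit_sphere" for u
    using that B(2) g h by (auto simp: norm_sphere_act matrix_inv_SL)
  have "(\<integral>u. ?fg u - ?fh u \<partial>weighted \<phi>) * ?a = (\<integral>u. (?fg u - ?fh u) * (\<phi> u)\<^sup>2 \<partial>sphere_measure)"
    using pos by (subst integral_weighted[OF \<phi>]) auto
  also have "\<dots> = (\<integral>u. ?fg u * (\<phi> u)\<^sup>2 \<partial>sphere_measure) - (\<integral>u. ?fh u * (\<phi> u)\<^sup>2 \<partial>sphere_measure)"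
    unfolding left_diff_distrib
    by (rule Bochner_Integration.integral_diff; rule fi[OF _ _ \<phi>]) (use fg_bd in auto)
  also have "\<dots> = (\<integral>u. f u * (?p u)\<^sup>2 \<partial>sphere_measure) - (\<integral>u. f u * (?q u)\<^sup>2 \<partial>sphere_measure)"
    using integral_mult_twist[OF g, of \<phi> f] integral_mult_twist[OF h, of \<phi> f] by simp
  also have "\<dots> = (\<integral>u. f u * (?p u)\<^sup>2 - f u * (?q u)\<^sup>2 \<partial>sphere_measure)"
    by (rule Bochner_Integration.integral_diff[symmetric]; rule fi) (use B p q in auto)
  finally have eq: "(\<integral>u. ?fg u - ?fh u \<partial>weighted \<phi>) * ?a = (\<integral>u. f u * (?p u)\<^sup>2 - f u * (?q u)\<^sup>2 \<partial>sphere_measure)" .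
  have dI: "integrable sphere_measure (\<lambda>u. (?p u - ?q u)\<^sup>2)" and sI: "integrable sphere_measure (\<lambda>u. (?p u + ?q u)\<^sup>2)"
    using L2_integrable_sq[OF L2_diff[OF p q]] L2_integrable_sq[OF L2_add[OF p q]] by auto
  have "\<delta> * ?a < \<bar>\<integral>u. ?fg u - ?fh u \<partial>weighted \<phi>\<bar> * ?a" using sep pos by simp
  also have "\<dots> = \<bar>\<integral>u. f u * (?p u)\<^sup>2 - f u * (?q u)\<^sup>2 \<partial>sphere_measure\<bar>"
    unfolding eq[symmetric] using pos by (simp add: abs_mult)
  also have "\<dots> \<le> (\<integral>u. \<bar>f u * (?p u)\<^sup>2 - f u * (?q u)\<^sup>2\<bar> \<partial>sphere_measure)" by (rule integral_abs_bound)
  also have "\<dots> \<le> (\<integral>u. 2 * B\<^sup>2 / \<delta> * (?p u - ?q u)\<^sup>2 + \<delta> / 8 * (?p u + ?q u)\<^sup>2 \<partial>sphere_measure)"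
  proof (rule integral_mono)
    show "integrable sphere_measure (\<lambda>u. \<bar>f u * (?p u)\<^sup>2 - f u * (?q u)\<^sup>2\<bar>)"
      by (intro integrable_abs Bochner_Integration.integrable_diff fi) (use B p q in auto)
    show "integrable sphere_measure (\<lambda>u. 2 * B\<^sup>2 / \<delta> * (?p u - ?q u)\<^sup>2 + \<delta> / 8 * (?p u + ?q u)\<^sup>2)"
      using dI sI by simp
    fix u :: "real^'m" assume "u \<in> space sphere_measure"
    then have fB: "\<bar>f u\<bar> \<le> B" using B(2) by (simp add: space_sphere_measure)
    let ?x = "\<bar>?p u - ?q u\<bar>" and ?y = "\<bar>?p u + ?q u\<bar>"
    have "\<bar>f u * (?p u)\<^sup>2 - f u * (?q u)\<^sup>2\<bar> = \<bar>f u\<bar> * (?x * ?y)"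
      by (simp add: power2_eq_square algebra_simps flip: abs_mult)
    also have "\<dots> \<le> B * (?x * ?y)" using fB by (intro mult_right_mono) auto
    also have "\<dots> \<le> 2 * B\<^sup>2 / \<delta> * ?x\<^sup>2 + \<delta> / 8 * ?y\<^sup>2"
    proof -
      \<comment> \<open>The constants let half of \<open>\<delta> * ?a\<close> absorb the term with \<open>?p + ?q\<close>.\<close>
      have "0 \<le> (4 * B * ?x - \<delta> * ?y)\<^sup>2 / (8 * \<delta>)" using \<delta> by simp
      also have "(4 * B * ?x - \<delta> * ?y)\<^sup>2 / (8 * \<delta>) = 2 * B\<^sup>2 / \<delta> * ?x\<^sup>2 + \<delta> / 8 * ?y\<^sup>2 - B * (?x * ?y)"
        using \<delta> unfolding power2_diff by (simp add: field_simps power2_eq_square)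
      finally show ?thesis by simp
    qed
    finally show "\<bar>f u * (?p u)\<^sup>2 - f u * (?q u)\<^sup>2\<bar> \<le> 2 * B\<^sup>2 / \<delta> * (?p u - ?q u)\<^sup>2 + \<delta> / 8 * (?p u + ?q u)\<^sup>2" by simp
  qed
  also have "\<dots> = 2 * B\<^sup>2 / \<delta> * (\<integral>u. (?p u - ?q u)\<^sup>2 \<partial>sphere_measure) + \<delta> / 8 * (\<integral>u. (?p u + ?q u)\<^sup>2 \<partial>sphere_measure)"
    using dI sI by simp
  also have "(\<integral>u. (?p u + ?q u)\<^sup>2 \<partial>sphere_measure) \<le> (\<integral>u. 2 * (?p u)\<^sup>2 + 2 * (?q u)\<^sup>2 \<partial>sphere_measure)"
  proof (rule integral_mono[OF sI])
    show "integrable sphere_measure (\<lambda>u. 2 * (?p u)\<^sup>2 + 2 * (?q u)\<^sup>2)"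
      using L2_integrable_sq[OF p] L2_integrable_sq[OF q] by simp
    show "(?p u + ?q u)\<^sup>2 \<le> 2 * (?p u)\<^sup>2 + 2 * (?q u)\<^sup>2" for u
      using sum_squares_bound[of "?p u" "?q u"] by (simp add: power2_sum)
  qed
  also have "(\<integral>u. 2 * (?p u)\<^sup>2 + 2 * (?q u)\<^sup>2 \<partial>sphere_measure) = 4 * ?a"
    using L2_integrable_sq[OF p] L2_integrable_sq[OF q] integral_twist_sq[OF g \<phi>] integral_twist_sq[OF h \<phi>] by simp
  finally have "\<delta> * ?a < 2 * B\<^sup>2 / \<delta> * (\<integral>u. (?p u - ?q u)\<^sup>2 \<partial>sphere_measure) + \<delta> / 8 * (4 * ?a)"
    using \<delta> by simp
  then have "\<delta> * ?a / 2 \<le> 2 * B\<^sup>2 / \<delta> * (\<integral>u. (?p u - ?q u)\<^sup>2 \<partial>sphere_measure)" by simp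
  then have "\<delta> / (2 * B\<^sup>2) * (\<delta> * ?a / 2) \<le> \<delta> / (2 * B\<^sup>2) * (2 * B\<^sup>2 / \<delta> * (\<integral>u. (?p u - ?q u)\<^sup>2 \<partial>sphere_measure))"
    using \<delta> B(1) by (intro mult_left_mono) auto
  then show ?thesis using \<delta> B(1) by (simp add: power2_eq_square field_simps)
qed

section \<open>Averages over a measure on the group\<close>

lemma (in prob_space) L2_integrable: "f \<in> L2 M \<Longrightarrow> integrable M f"
  using L2_integrable_mult[of f M "\<lambda>_. 1"] by (simp add: L2_def)

lemma (in prob_space) second_moment_eq:
  assumes Y: "Y \<in> L2 M"
  shows "ennreal ((\<integral>x. Y x \<partial>M)\<^sup>2) + ennreal (1/2) * (\<integral>\<^sup>+x. \<integral>\<^sup>+y. ennreal ((Y x - Y y)\<^sup>2) \<partial>M \<partial>M) = sq_norm M Y"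
proof -
  let ?m = "\<integral>x. Y x \<partial>M" and ?q = "\<integral>x. (Y x)\<^sup>2 \<partial>M"
  note i = L2_integrable[OF Y] L2_integrable_sq[OF Y]
  have inner: "(\<integral>\<^sup>+y. ennreal ((Y x - Y y)\<^sup>2) \<partial>M) = ennreal ((Y x)\<^sup>2 - 2 * Y x * ?m + ?q)" for x
  proof -
    have "(\<integral>\<^sup>+y. ennreal ((Y x - Y y)\<^sup>2) \<partial>M) = ennreal (\<integral>y. (Y x - Y y)\<^sup>2 \<partial>M)"
    proof (rule nn_integral_eq_integral)
      show "integrable M (\<lambda>y. (Y x - Y y)\<^sup>2)" using i by (simp add: power2_diff)
    qed simp
    also have "(\<integral>y. (Y x - Y y)\<^sup>2 \<partial>M) = (Y x)\<^sup>2 - 2 * Y x * ?m + ?q"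
      using i by (simp add: power2_diff prob_space)
    finally show ?thesis .
  qed
  have pos: "0 \<le> (Y x)\<^sup>2 - 2 * Y x * ?m + ?q" for x
  proof -
    have "0 \<le> (\<integral>y. (Y x - Y y)\<^sup>2 \<partial>M)" by simp
    also have "\<dots> = (Y x)\<^sup>2 - 2 * Y x * ?m + ?q" using i by (simp add: power2_diff prob_space)
    finally show ?thesis .
  qed
  have "(\<integral>\<^sup>+x. \<integral>\<^sup>+y. ennreal ((Y x - Y y)\<^sup>2) \<partial>M \<partial>M) = ennreal (\<integral>x. (Y x)\<^sup>2 - 2 * Y x * ?m + ?q \<partial>M)"
    unfolding inner using i pos by (intro nn_integral_eq_integral) auto
  also have "(\<integral>x. (Y x)\<^sup>2 - 2 * Y x * ?m + ?q \<partial>M) = 2 * (?q - ?m\<^sup>2)"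
    using i by (simp add: prob_space power2_eq_square)
  finally have E: "(\<integral>\<^sup>+x. \<integral>\<^sup>+y. ennreal ((Y x - Y y)\<^sup>2) \<partial>M \<partial>M) = ennreal (2 * (?q - ?m\<^sup>2))" .
  have "0 \<le> ?q - ?m\<^sup>2" using variance_eq[OF i] variance_positive[of Y] by simp
  then have "ennreal (1/2) * ennreal (2 * (?q - ?m\<^sup>2)) = ennreal (?q - ?m\<^sup>2)"
    by (subst ennreal_mult[symmetric]) auto
  then show ?thesis
    unfolding E sq_norm_L2[OF Y] using \<open>0 \<le> ?q - ?m\<^sup>2\<close> by (simp only: ennreal_plus[symmetric] zero_le_power2) simp
qed

definition average :: "(real^'m^'m) measure \<Rightarrow> (real^'m \<Rightarrow> real) \<Rightarrow> real^'m \<Rightarrow> real" where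
  "average \<nu> \<phi> u = (\<integral>g. twist g \<phi> u \<partial>\<nu>)"

text \<open>By strict convexity of the Hilbert norm, averaging the vectors \<open>twist g \<phi>\<close>, all of the same norm, loses norm to the
  extent to which they differ: the second moment identity is integrated over the sphere.\<close>

lemma average_deficit:
  fixes \<nu> :: "(real^'m^'m) measure"
  assumes \<nu>: "\<nu> \<in> prob_measures_on SL" and \<phi>: "\<phi> \<in> L2 sphere_measure"
  shows "sq_norm sphere_measure (average \<nu> \<phi>)
    + ennreal (1/2) * (\<integral>\<^sup>+g. \<integral>\<^sup>+h. sq_norm sphere_measure (\<lambda>u. twist g \<phi> u - twist h \<phi> u) \<partial>\<nu> \<partial>\<nu>)
    = sq_norm sphere_measure \<phi>"
proof -
  interpret N: prob_space \<nu> using \<nu> by (simp add: prob_measures_on_def)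
  interpret S: prob_space "sphere_measure :: (real^'m) measure" by (rule prob_space_sphere_measure)
  interpret NS: pair_sigma_finite \<nu> "sphere_measure :: (real^'m) measure" ..
  have sets: "sets \<nu> = sets (restrict_space borel SL)" using \<nu> by (simp add: prob_measures_on_def)
  have sp: "space \<nu> = SL" by (rule space_prob_measures_on[OF \<nu>])
  have [measurable]: "(\<lambda>(g, u). twist g \<phi> u) \<in> borel_measurable (\<nu> \<Otimes>\<^sub>M sphere_measure)"
    by (rule measurable_twist_pair[OF L2_measurable[OF \<phi>] sets])
  have total: "(\<integral>\<^sup>+u. sq_norm \<nu> (\<lambda>g. twist g \<phi> u) \<partial>sphere_measure) = sq_norm sphere_measure \<phi>"
  proof -
    have "(\<integral>\<^sup>+u. sq_norm \<nu> (\<lambda>g. twist g \<phi> u) \<partial>sphere_measure) = (\<integral>\<^sup>+g. sq_norm sphere_measure (twist g \<phi>) \<partial>\<nu>)"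
      unfolding sq_norm_def by (rule NS.Fubini') measurable
    also have "\<dots> = (\<integral>\<^sup>+g. sq_norm sphere_measure \<phi> \<partial>\<nu>)"
      by (intro nn_integral_cong) (simp add: sp sq_norm_twist L2_measurable[OF \<phi>])
    finally show ?thesis by (simp add: N.emeasure_space_1)
  qed
  have m1[measurable]: "(\<lambda>u. sq_norm \<nu> (\<lambda>g. twist g \<phi> u)) \<in> borel_measurable sphere_measure"
    unfolding sq_norm_def by measurable
  have "sq_norm sphere_measure \<phi> < \<infinity>" using \<phi> by (simp add: L2_iff)
  then have "AE u in sphere_measure. sq_norm \<nu> (\<lambda>g. twist g \<phi> u) \<noteq> \<infinity>"
    by (intro nn_integral_PInf_AE) (auto simp: total)
  then have AE: "AE u in sphere_measure. (\<lambda>g. twist g \<phi> u) \<in> L2 \<nu>"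
    by (rule AE_mp) (auto intro!: AE_I2 simp: L2_iff less_top)
  let ?D = "\<lambda>u. \<integral>\<^sup>+g. \<integral>\<^sup>+h. ennreal ((twist g \<phi> u - twist h \<phi> u)\<^sup>2) \<partial>\<nu> \<partial>\<nu>"
  have D[measurable]: "?D \<in> borel_measurable sphere_measure" by measurable
  have "sq_norm sphere_measure \<phi> = (\<integral>\<^sup>+u. ennreal ((average \<nu> \<phi> u)\<^sup>2) + ennreal (1/2) * ?D u \<partial>sphere_measure)"
    unfolding total[symmetric]
  proof (rule nn_integral_cong_AE)
    show "AE u in sphere_measure. sq_norm \<nu> (\<lambda>g. twist g \<phi> u) = ennreal ((average \<nu> \<phi> u)\<^sup>2) + ennreal (1/2) * ?D u"
      using AE
    proof eventually_elim
      case (elim u)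
      from N.second_moment_eq[OF this] show ?case unfolding average_def by (rule sym)
    qed
  qed
  also have "\<dots> = sq_norm sphere_measure (average \<nu> \<phi>) + (\<integral>\<^sup>+u. ennreal (1/2) * ?D u \<partial>sphere_measure)"
    unfolding sq_norm_def average_def by (rule nn_integral_add) measurable
  also have "(\<integral>\<^sup>+u. ennreal (1/2) * ?D u \<partial>sphere_measure) = ennreal (1/2) * (\<integral>\<^sup>+u. ?D u \<partial>sphere_measure)"
    by (rule nn_integral_cmult) measurable
  also have "(\<integral>\<^sup>+u. ?D u \<partial>sphere_measure)
      = (\<integral>\<^sup>+g. \<integral>\<^sup>+u. \<integral>\<^sup>+h. ennreal ((twist g \<phi> u - twist h \<phi> u)\<^sup>2) \<partial>\<nu> \<partial>sphere_measure \<partial>\<nu>)"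
    by (rule NS.Fubini') measurable
  also have "\<dots> = (\<integral>\<^sup>+g. \<integral>\<^sup>+h. \<integral>\<^sup>+u. ennreal ((twist g \<phi> u - twist h \<phi> u)\<^sup>2) \<partial>sphere_measure \<partial>\<nu> \<partial>\<nu>)"
  proof (rule nn_integral_cong)
    fix g assume "g \<in> space \<nu>"
    then have [measurable]: "twist g \<phi> \<in> borel_measurable sphere_measure"
      using measurable_twist L2_measurable[OF \<phi>] by (simp add: sp)
    show "(\<integral>\<^sup>+u. \<integral>\<^sup>+h. ennreal ((twist g \<phi> u - twist h \<phi> u)\<^sup>2) \<partial>\<nu> \<partial>sphere_measure)
        = (\<integral>\<^sup>+h. \<integral>\<^sup>+u. ennreal ((twist g \<phi> u - twist h \<phi> u)\<^sup>2) \<partial>sphere_measure \<partial>\<nu>)"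
      by (rule NS.Fubini') measurable
  qed
  finally show ?thesis unfolding sq_norm_def by simp
qed

lemma average_deficit_lower:
  fixes \<nu> :: "(real^'m^'m) measure"
  assumes \<nu>: "\<nu> \<in> prob_measures_on SL" and \<phi>: "\<phi> \<in> L2 sphere_measure"
    and UV: "U \<in> sets \<nu>" "V \<in> sets \<nu>" "p \<le> measure \<nu> U" "q \<le> measure \<nu> V" "0 \<le> p" "0 \<le> q" "0 \<le> d"
    and d: "\<And>g h. g \<in> U \<Longrightarrow> h \<in> V \<Longrightarrow> d \<le> (\<integral>u. (twist g \<phi> u - twist h \<phi> u)\<^sup>2 \<partial>sphere_measure)"
  shows "sq_norm sphere_measure (average \<nu> \<phi>) + ennreal (p * q * d / 2) \<le> sq_norm sphere_measure \<phi>"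
proof -
  interpret N: prob_space \<nu> using \<nu> by (simp add: prob_measures_on_def)
  have sp: "space \<nu> = SL" by (rule space_prob_measures_on[OF \<nu>])
  have US: "U \<subseteq> SL" "V \<subseteq> SL" using UV(1,2) sets.sets_into_space by (auto simp: sp[symmetric])
  let ?s = "\<lambda>g h. sq_norm sphere_measure (\<lambda>u. twist g \<phi> u - twist h \<phi> u)"
  have s: "ennreal d \<le> ?s g h" if "g \<in> U" "h \<in> V" for g h
    using that US d[OF that] by (subst sq_norm_L2) (auto intro!: L2_diff twist_L2 \<phi> ennreal_leI)
  have "ennreal (p * q * d) \<le> ennreal (measure \<nu> U * measure \<nu> V * d)"
    using UV by (intro ennreal_leI mult_mono) auto
  also have "\<dots> = (\<integral>\<^sup>+g. \<integral>\<^sup>+h. ennreal d * indicator V h * indicator U g \<partial>\<nu> \<partial>\<nu>)"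
    using UV by (simp add: nn_integral_cmult nn_integral_multc N.emeasure_eq_measure ennreal_mult mult_ac)
  also have "\<dots> \<le> (\<integral>\<^sup>+g. \<integral>\<^sup>+h. ?s g h \<partial>\<nu> \<partial>\<nu>)"
    using s by (intro nn_integral_mono) (auto simp: indicator_def)
  finally have "ennreal (p * q * d) \<le> (\<integral>\<^sup>+g. \<integral>\<^sup>+h. ?s g h \<partial>\<nu> \<partial>\<nu>)" .
  then have "ennreal (1/2) * ennreal (p * q * d) \<le> ennreal (1/2) * (\<integral>\<^sup>+g. \<integral>\<^sup>+h. ?s g h \<partial>\<nu> \<partial>\<nu>)" by (rule mult_left_mono) simp
  moreover have "ennreal (1/2) * ennreal (p * q * d) = ennreal (p * q * d / 2)"
    using UV by (subst ennreal_mult[symmetric]) auto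
  ultimately show ?thesis
    unfolding average_deficit[OF \<nu> \<phi>, symmetric] by (simp add: add_left_mono)
qed

text \<open>The measure of an open set is bounded below by the integral of a bump function, which is weakly
  continuous.\<close>

lemma weak_nhd_charging_open:
  fixes \<nu> :: "'a::metric_space measure"
  assumes \<nu>: "\<nu> \<in> prob_measures_on S" and x: "x \<in> supp \<nu>" "x \<in> U" and U: "open U"
  shows "\<exists>W p. openin (weak_topology S) W \<and> \<nu> \<in> W \<and> 0 < p \<and> (\<forall>\<nu>'\<in>W. p \<le> measure \<nu>' (U \<inter> S))"
proof -
  from open_positivity_function[OF U] obtain d :: "'a \<Rightarrow> real"
    where d: "continuous_on UNIV d" "\<And>x. 0 \<le> d x" "\<And>x. 0 < d x \<longleftrightarrow> x \<in> U" by blast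
  define b where "b x = min (d x) 1" for x
  have cb: "continuous_on S b"
    unfolding b_def by (intro continuous_intros continuous_on_subset[OF d(1)]) auto
  have b01: "0 \<le> b x" "b x \<le> 1" for x using d(2) by (auto simp: b_def)
  have bU: "0 < b x \<longleftrightarrow> x \<in> U" for x using d(3) by (auto simp: b_def)
  have le: "(\<integral>x. b x \<partial>\<nu>') \<le> measure \<nu>' (U \<inter> S)" and int: "integrable \<nu>' b" if n: "\<nu>' \<in> prob_measures_on S" for \<nu>'
  proof -
    interpret prob_space \<nu>' using n by (simp add: prob_measures_on_def)
    have sp: "space \<nu>' = S" by (rule space_prob_measures_on[OF n])
    have US: "U \<inter> S \<in> events" using n U by (auto simp: prob_measures_on_def sets_restrict_space)
    show i: "integrable \<nu>' b"
      using b01 by (intro integrable_const_bound[of _ 1] measurable_prob_measures_on[OF n cb]) auto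
    have "b x \<le> indicator (U \<inter> S) x" if "x \<in> S" for x
      using b01[of x] bU[of x] that by (auto simp: indicator_def)
    then have "(\<integral>x. b x \<partial>\<nu>') \<le> (\<integral>x. indicator (U \<inter> S) x \<partial>\<nu>')"
      using US by (intro integral_mono i) (auto simp: sp emeasure_eq_measure)
    then show "(\<integral>x. b x \<partial>\<nu>') \<le> measure \<nu>' (U \<inter> S)" using US by simp
  qed
  interpret prob_space \<nu> using \<nu> by (simp add: prob_measures_on_def)
  have sp: "space \<nu> = S" by (rule space_prob_measures_on[OF \<nu>])
  define p where "p = (\<integral>x. b x \<partial>\<nu>) / 2"
  have "(\<integral>x. b x \<partial>\<nu>) \<noteq> 0"
  proof
    assume "(\<integral>x. b x \<partial>\<nu>) = 0"
    then have "AE x in \<nu>. b x = 0"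
      using integral_nonneg_eq_0_iff_AE[OF int[OF \<nu>]] b01 by simp
    then have "AE x in \<nu>. x \<notin> U" by (rule AE_mp) (auto simp flip: bU)
    then have "AE x in \<nu>. x \<notin> U \<inter> space \<nu>" by (rule AE_mp) auto
    moreover have "U \<inter> space \<nu> \<in> sets \<nu>"
      using \<nu> U by (auto simp: sp prob_measures_on_def sets_restrict_space)
    ultimately have "emeasure \<nu> (U \<inter> space \<nu>) = 0"
      by (simp only: AE_iff_null_sets[symmetric] null_setsD1)
    with x U show False by (auto simp: supp_def)
  qed
  moreover have "0 \<le> (\<integral>x. b x \<partial>\<nu>)" using b01 by simp
  ultimately have p: "0 < p" "p < (\<integral>x. b x \<partial>\<nu>)" by (auto simp: p_def)
  let ?W = "{\<nu>' \<in> prob_measures_on S. (\<integral>x. b x \<partial>\<nu>') \<in> {p<..}}"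
  have "bounded (b ` S)" using b01 by (auto simp: bounded_iff intro!: exI[of _ 1])
  then have "openin (weak_topology S) ?W"
    unfolding weak_topology_def using cb
    by (intro topology_generated_by_Basis CollectI exI[of _ b] exI[of _ "{p<..}"]) auto
  moreover have "\<nu> \<in> ?W" using \<nu> p by simp
  moreover have "p \<le> measure \<nu>' (U \<inter> S)" if "\<nu>' \<in> ?W" for \<nu>' using that le[of \<nu>'] by simp
  ultimately show ?thesis using p(1) by blast
qed

abbreviation contracts :: "(real^'m^'m) measure \<Rightarrow> (real^'m \<Rightarrow> real) \<Rightarrow> real \<Rightarrow> bool" where
  "contracts \<nu> \<phi> \<eta> \<equiv>
    sq_norm sphere_measure (average \<nu> \<phi>) + ennreal (\<eta> * energy \<phi>) \<le> sq_norm sphere_measure \<phi>"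

text \<open>For \<open>g'\<close> near \<open>g\<close> and \<open>h'\<close> near \<open>h\<close> the test still succeeds with margin \<open>\<epsilon> / 2\<close>, whatever \<open>\<phi>\<close>
  is, since \<open>f (g\<inverse>.u)\<close> depends on \<open>g\<close> continuously, uniformly in \<open>u\<close>. Every \<open>\<nu>'\<close> weakly near
  \<open>\<nu>\<close> gives both neighbourhoods a mass bounded below, because \<open>g\<close> and \<open>h\<close> lie in the support of
  \<open>\<nu>\<close>.\<close>

lemma local_contraction:
  fixes \<nu> :: "(real^'m^'m) measure" and f :: "real^'m \<Rightarrow> real"
  assumes \<nu>: "\<nu> \<in> prob_measures_on SL" and gh: "g \<in> supp \<nu>" "h \<in> supp \<nu>"
    and f: "continuous_on unit_sphere f" and e: "0 < \<epsilon>"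
  shows "\<exists>W \<eta>. openin (weak_topology SL) W \<and> \<nu> \<in> W \<and> 0 < \<eta> \<and>
    (\<forall>\<nu>'\<in>W. \<forall>\<phi>\<in>L2 sphere_measure. 0 < energy \<phi> \<longrightarrow>
      \<epsilon> < \<bar>\<integral>u. f (sphere_act (matrix_inv g) u) - f (sphere_act (matrix_inv h) u) \<partial>weighted \<phi>\<bar> \<longrightarrow>
      contracts \<nu>' \<phi> \<eta>)"
proof -
  let ?S = "unit_sphere :: (real^'m) set"
  let ?F = "\<lambda>g u. f (sphere_act (matrix_inv g) u)"
  have SL: "g \<in> SL" "h \<in> SL" using gh space_prob_measures_on[OF \<nu>] by (auto simp: supp_def)
  obtain B where B: "0 < B" "\<And>u. u \<in> ?S \<Longrightarrow> \<bar>f u\<bar> \<le> B"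
    using compact_imp_bounded[OF compact_continuous_image[OF f compact_sphere]]
    by (auto simp: bounded_pos)
  have e4: "0 < \<epsilon> / 4" using e by simp
  obtain U where U: "open U" "g \<in> U" "\<forall>g'\<in>U \<inter> SL. \<forall>u\<in>?S. \<bar>?F g' u - ?F g u\<bar> \<le> \<epsilon> / 4"
    using uniform_on_compact_fibre[OF continuous_on_inverse_act[OF f] compact_sphere SL(1) e4] by (elim exE conjE)
  obtain V where V: "open V" "h \<in> V" "\<forall>h'\<in>V \<inter> SL. \<forall>u\<in>?S. \<bar>?F h' u - ?F h u\<bar> \<le> \<epsilon> / 4"
    using uniform_on_compact_fibre[OF continuous_on_inverse_act[OF f] compact_sphere SL(2) e4] by (elim exE conjE)
  obtain W1 p where W1: "openin (weak_topology SL) W1" "\<nu> \<in> W1" "0 < p" "\<forall>\<nu>'\<in>W1. p \<le> measure \<nu>' (U \<inter> SL)"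
    using weak_nhd_charging_open[OF \<nu> gh(1) U(2,1)] by (elim exE conjE)
  obtain W2 q where W2: "openin (weak_topology SL) W2" "\<nu> \<in> W2" "0 < q" "\<forall>\<nu>'\<in>W2. q \<le> measure \<nu>' (V \<inter> SL)"
    using weak_nhd_charging_open[OF \<nu> gh(2) V(2,1)] by (elim exE conjE)
  define \<delta> where "\<delta> = (\<epsilon> / 2)\<^sup>2 / (4 * B\<^sup>2)"
  define \<eta> where "\<eta> = p * q * \<delta> / 2"
  have \<delta>: "0 < \<delta>" using e B(1) by (simp add: \<delta>_def)
  have "contracts \<nu>' \<phi> \<eta>"
    if n: "\<nu>' \<in> W1 \<inter> W2" and \<phi>: "\<phi> \<in> L2 sphere_measure" and pos: "0 < energy \<phi>"
      and sep: "\<epsilon> < \<bar>\<integral>u. ?F g u - ?F h u \<partial>weighted \<phi>\<bar>" for \<nu>' \<phi>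
  proof -
    let ?a = "energy \<phi>"
    have n': "\<nu>' \<in> prob_measures_on SL"
      using n openin_subset[OF W1(1)] by (auto simp: topspace_weak_topology)
    have UV: "U \<inter> SL \<in> sets \<nu>'" "V \<inter> SL \<in> sets \<nu>'"
      using n' U(1) V(1) by (auto simp: prob_measures_on_def sets_restrict_space)
    have w: "weighted \<phi> \<in> prob_measures_on ?S" by (rule weighted_prob[OF \<phi> pos])
    interpret K: prob_space "weighted \<phi>" using w by (simp add: prob_measures_on_def)
    have spw: "space (weighted \<phi>) = ?S" by (rule space_prob_measures_on[OF w])
    have cF: "continuous_on ?S (?F g')" if "g' \<in> SL" for g' :: "real^'m^'m"
      by (rule continuous_on_compose_act[OF matrix_inv_SL(3)[OF that] f])
    note iF = integrable_prob_measures_on[OF w compact_sphere cF]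
    have close: "\<bar>(\<integral>u. ?F x u \<partial>weighted \<phi>) - (\<integral>u. ?F y u \<partial>weighted \<phi>)\<bar> \<le> \<epsilon> / 4"
      if "x \<in> SL" "y \<in> SL" "\<forall>u\<in>?S. \<bar>?F x u - ?F y u\<bar> \<le> \<epsilon> / 4" for x y :: "real^'m^'m"
    proof -
      have "\<bar>\<integral>u. ?F x u - ?F y u \<partial>weighted \<phi>\<bar> \<le> (\<integral>u. \<bar>?F x u - ?F y u\<bar> \<partial>weighted \<phi>)" by (rule integral_abs_bound)
      also have "\<dots> \<le> (\<integral>u. \<epsilon> / 4 \<partial>weighted \<phi>)"
        using that iF by (intro integral_mono) (auto simp: spw)
      finally show ?thesis using that iF K.prob_space by simp
    qed
    have "\<delta> * ?a \<le> (\<integral>u. (twist g' \<phi> u - twist h' \<phi> u)\<^sup>2 \<partial>sphere_measure)"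
      if g': "g' \<in> U \<inter> SL" and h': "h' \<in> V \<inter> SL" for g' h'
    proof -
      have "\<bar>(\<integral>u. ?F g' u \<partial>weighted \<phi>) - (\<integral>u. ?F g u \<partial>weighted \<phi>)\<bar> \<le> \<epsilon> / 4"
        using g' U(3) SL(1) by (intro close) auto
      moreover have "\<bar>(\<integral>u. ?F h' u \<partial>weighted \<phi>) - (\<integral>u. ?F h u \<partial>weighted \<phi>)\<bar> \<le> \<epsilon> / 4"
        using h' V(3) SL(2) by (intro close) auto
      moreover have "\<epsilon> < \<bar>(\<integral>u. ?F g u \<partial>weighted \<phi>) - (\<integral>u. ?F h u \<partial>weighted \<phi>)\<bar>"
        using sep iF SL by simp
      ultimately have "\<epsilon> / 2 < \<bar>(\<integral>u. ?F g' u \<partial>weighted \<phi>) - (\<integral>u. ?F h' u \<partial>weighted \<phi>)\<bar>" by argo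
      then have "\<epsilon> / 2 < \<bar>\<integral>u. ?F g' u - ?F h' u \<partial>weighted \<phi>\<bar>" using iF g' h' by simp
      then show ?thesis
        unfolding \<delta>_def using g' h' e by (intro twist_separation[OF _ _ \<phi> f B pos]) auto
    qed
    then have "sq_norm sphere_measure (average \<nu>' \<phi>) + ennreal (p * q * (\<delta> * ?a) / 2) \<le> sq_norm sphere_measure \<phi>"
      using n W1(3,4) W2(3,4) \<delta> pos by (intro average_deficit_lower[OF n' \<phi> UV]) auto
    then show ?thesis by (simp add: \<eta>_def mult.assoc)
  qed
  moreover have "0 < \<eta>" using \<delta> W1 W2 by (simp add: \<eta>_def)
  moreover have "openin (weak_topology SL) (W1 \<inter> W2)" using W1 W2 by auto
  ultimately show ?thesis using W1(2) W2(2) by (intro exI[of _ "W1 \<inter> W2"] exI[of _ \<eta>]) blast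
qed

lemma neighbourhood_contraction:
  fixes \<nu> :: "(real^'m^'m) measure"
  assumes \<nu>: "\<nu> \<in> prob_measures_on SL"
    and no: "\<not> (\<exists>\<kappa>\<in>prob_measures_on unit_sphere. \<forall>h\<in>G_of \<nu>. preserves h \<kappa>)"
  shows "\<exists>W \<eta>. openin (weak_topology SL) W \<and> \<nu> \<in> W \<and> 0 < \<eta> \<and>
    (\<forall>\<nu>'\<in>W. \<forall>\<phi>\<in>L2 sphere_measure. 0 < energy \<phi> \<longrightarrow> contracts \<nu>' \<phi> \<eta>)"
proof -
  from finite_separating_tests[OF \<nu> no]
  obtain T :: "((real^'m^'m) \<times> (real^'m^'m) \<times> (real^'m \<Rightarrow> real)) set" and \<epsilon> :: real
    where T: "finite T" "T \<subseteq> supp \<nu> \<times> supp \<nu> \<times> {f. continuous_on unit_sphere f}" "0 < \<epsilon>"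
    and sep: "\<And>\<kappa>. \<kappa> \<in> prob_measures_on unit_sphere \<Longrightarrow> \<exists>(g, h, f)\<in>T.
       \<epsilon> < \<bar>\<integral>u. f (sphere_act (matrix_inv g) u) - f (sphere_act (matrix_inv h) u) \<partial>\<kappa>\<bar>"
    by (elim exE conjE) blast
  let ?D = "\<lambda>(g, h, f) \<phi>. \<integral>u. f (sphere_act (matrix_inv g) u) - f (sphere_act (matrix_inv h) u) \<partial>weighted \<phi> :: real"
  let ?G = "\<lambda>t W \<eta>. openin (weak_topology SL) W \<and> \<nu> \<in> W \<and> 0 < \<eta> \<and>
    (\<forall>\<nu>'\<in>W. \<forall>\<phi>\<in>L2 sphere_measure. 0 < energy \<phi> \<longrightarrow> \<epsilon> < \<bar>?D t \<phi>\<bar> \<longrightarrow> contracts \<nu>' \<phi> \<eta>)"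
  have "\<forall>t\<in>T. \<exists>W \<eta>. ?G t W \<eta>"
  proof
    fix t assume "t \<in> T"
    then obtain g h f where t: "t = (g, h, f)" "g \<in> supp \<nu>" "h \<in> supp \<nu>" "continuous_on unit_sphere f"
      using T(2) by blast
    show "\<exists>W \<eta>. ?G t W \<eta>"
      unfolding t(1) prod.case by (rule local_contraction[OF \<nu> t(2-4) T(3)])
  qed
  from bchoice[OF this] obtain W where "\<forall>t\<in>T. \<exists>\<eta>. ?G t (W t) \<eta>" by (elim exE)
  from bchoice[OF this] obtain \<eta> where W\<eta>: "\<forall>t\<in>T. ?G t (W t) (\<eta> t)" by (elim exE)
  have ne: "T \<noteq> {}" using sep[OF sphere_measure_prob] by auto
  define \<eta>0 where "\<eta>0 = Min (\<eta> ` T)"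
  have \<eta>0: "0 < \<eta>0" using W\<eta> T(1) ne by (simp add: \<eta>0_def)
  have "contracts \<nu>' \<phi> \<eta>0" if n: "\<nu>' \<in> (\<Inter>t\<in>T. W t)" and \<phi>: "\<phi> \<in> L2 sphere_measure" and pos: "0 < energy \<phi>" for \<nu>' \<phi>
  proof -
    obtain t where t: "t \<in> T" "\<epsilon> < \<bar>?D t \<phi>\<bar>"
      using sep[OF weighted_prob[OF \<phi> pos]] by auto
    then have P: "contracts \<nu>' \<phi> (\<eta> t)" using W\<eta> n \<phi> pos by blast
    have "\<eta>0 \<le> \<eta> t" using T(1) t(1) by (simp add: \<eta>0_def)
    then have "ennreal (\<eta>0 * energy \<phi>) \<le> ennreal (\<eta> t * energy \<phi>)"
      using pos by (intro ennreal_leI mult_right_mono) auto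
    then show ?thesis using P by (meson add_left_mono order_trans)
  qed
  moreover have "openin (weak_topology SL) (\<Inter>t\<in>T. W t)"
    using W\<eta> T(1) ne by (intro openin_INT2) auto
  moreover have "\<nu> \<in> (\<Inter>t\<in>T. W t)" using W\<eta> by blast
  ultimately show ?thesis using \<eta>0 by (intro exI[of _ "\<Inter>t\<in>T. W t"] exI[of _ \<eta>0]) blast
qed

text \<open>The analytic core: a spectral gap for the averaging operators, uniform over a weakly compact set of
  measures without invariant probability measure. Each measure has a neighbourhood with a common
  gap, and finitely many of these cover \<open>M\<close>.\<close>

theorem uniform_contraction:
  fixes M :: "(real^'m^'m) measure set"
  assumes M: "compactin (weak_topology SL) M"
    and no: "\<And>\<rho>. \<rho> \<in> M \<Longrightarrow> \<not> (\<exists>\<kappa>\<in>prob_measures_on unit_sphere. \<forall>h\<in>G_of \<rho>. preserves h \<kappa>)"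
  shows "\<exists>\<beta>. 0 \<le> \<beta> \<and> \<beta> < 1 \<and> (\<forall>\<nu>\<in>M. \<forall>\<phi>\<in>L2 sphere_measure.
    sq_norm sphere_measure (average \<nu> \<phi>) \<le> ennreal (\<beta> * energy \<phi>))"
proof -
  have MP: "M \<subseteq> prob_measures_on SL"
    using compactin_subset_topspace[OF M] by (simp add: topspace_weak_topology)
  let ?a = "\<lambda>\<phi>. \<integral>u. (\<phi> u)\<^sup>2 \<partial>(sphere_measure :: (real^'m) measure)"
  let ?good = "\<lambda>W \<eta>. openin (weak_topology SL) W \<and> 0 < \<eta> \<and>
    (\<forall>\<nu>'\<in>W. \<forall>\<phi>\<in>L2 sphere_measure. 0 < ?a \<phi> \<longrightarrow>
      sq_norm sphere_measure (average \<nu>' \<phi>) + ennreal (\<eta> * ?a \<phi>) \<le> sq_norm sphere_measure \<phi>)"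
  have cover: "\<exists>W \<eta>. \<nu> \<in> W \<and> ?good W \<eta>" if "\<nu> \<in> M" for \<nu>
    using neighbourhood_contraction[of \<nu>] MP that no[OF that] by blast
  let ?\<W> = "{W. \<exists>\<eta>. ?good W \<eta>}"
  have "M \<subseteq> \<Union>?\<W>" using cover by blast
  moreover have "\<And>W. W \<in> ?\<W> \<Longrightarrow> openin (weak_topology SL) W" by blast
  ultimately obtain F where F: "finite F" "F \<subseteq> ?\<W>" "M \<subseteq> \<Union>F"
    using M unfolding compactin_def by meson
  have "\<forall>W\<in>F. \<exists>\<eta>. ?good W \<eta>" using F(2) by blast
  from bchoice[OF this] obtain \<eta> where \<eta>: "\<forall>W\<in>F. ?good W (\<eta> W)" by (elim exE)
  define \<eta>0 where "\<eta>0 = Min (insert 1 (\<eta> ` F))"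
  have \<eta>0: "0 < \<eta>0" "\<eta>0 \<le> 1" using \<eta> F(1) by (auto simp: \<eta>0_def)
  have "sq_norm sphere_measure (average \<nu> \<phi>) \<le> ennreal ((1 - \<eta>0) * ?a \<phi>)" if \<nu>: "\<nu> \<in> M" and \<phi>: "\<phi> \<in> L2 sphere_measure" for \<nu> \<phi>
  proof (cases "0 < ?a \<phi>")
    case True
    obtain W where W: "W \<in> F" "\<nu> \<in> W" using F(3) \<nu> by blast
    have "\<eta>0 \<le> \<eta> W" using F(1) W(1) by (simp add: \<eta>0_def)
    then have "ennreal (\<eta>0 * ?a \<phi>) \<le> ennreal (\<eta> W * ?a \<phi>)"
      using True by (intro ennreal_leI mult_right_mono) auto
    moreover have "sq_norm sphere_measure (average \<nu> \<phi>) + ennreal (\<eta> W * ?a \<phi>) \<le> sq_norm sphere_measure \<phi>"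
      using \<eta> W True \<phi> by blast
    ultimately have "sq_norm sphere_measure (average \<nu> \<phi>) + ennreal (\<eta>0 * ?a \<phi>) \<le> ennreal (?a \<phi>)"
      unfolding sq_norm_L2[OF \<phi>] by (meson add_left_mono order_trans)
    moreover have "ennreal (?a \<phi>) = ennreal ((1 - \<eta>0) * ?a \<phi>) + ennreal (\<eta>0 * ?a \<phi>)"
      using \<eta>0 True by (simp add: left_diff_distrib flip: ennreal_plus)
    ultimately show ?thesis 
      using ennreal_add_left_cancel_le[of "ennreal (\<eta>0 * ?a \<phi>)"] by (simp add: add.commute)
  next
    case False
    then have "?a \<phi> = 0" by (simp add: order_antisym)
    moreover have "sq_norm sphere_measure (average \<nu> \<phi>) \<le> sq_norm sphere_measure \<phi>"
    proof -
      have "\<nu> \<in> prob_measures_on SL" using MP \<nu> by blast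
      from average_deficit[OF this \<phi>, symmetric] show ?thesis by simp
    qed
    ultimately show ?thesis by (simp add: sq_norm_L2[OF \<phi>])
  qed
  then show ?thesis using \<eta>0 by (intro exI[of _ "1 - \<eta>0"]) auto
qed

section \<open>One step of the Markov chain\<close>

lemma sq_norm_cong_AE:
  "AE x in M. f x = h x \<Longrightarrow> sq_norm M f = sq_norm M h"
  unfolding sq_norm_def by (rule nn_integral_cong_AE) (auto elim: eventually_mono)

lemma sq_norm_scale: "f \<in> borel_measurable M \<Longrightarrow> sq_norm M (\<lambda>x. r * f x) = ennreal (r\<^sup>2) * sq_norm M f"
  unfolding sq_norm_def by (subst nn_integral_cmult[symmetric]) (auto simp: power_mult_distrib ennreal_mult)

lemma l2norm_le_iff:
  assumes "0 \<le> r"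
  shows "l2norm M f \<le> ereal r \<longleftrightarrow> f \<in> borel_measurable M \<and> sq_norm M f \<le> ennreal (r\<^sup>2)"
proof (cases "f \<in> L2 M")
  case True
  then have "l2norm M f \<le> ereal r \<longleftrightarrow> (\<integral>x. (f x)\<^sup>2 \<partial>M) \<le> r\<^sup>2"
    using assms by (simp add: l2norm_def real_sqrt_le_iff' real_le_lsqrt sqrt_le_D)
  then show ?thesis using True by (simp add: sq_norm_L2 L2_measurable)
next
  case False
  then have "\<not> (f \<in> borel_measurable M \<and> sq_norm M f \<le> ennreal (r\<^sup>2))"
    using le_less_trans[of "sq_norm M f" "ennreal (r\<^sup>2)" \<infinity>] by (auto simp: L2_iff)
  with False show ?thesis by (simp add: l2norm_def)
qed

lemma (in prob_space) square_mean_le: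
  assumes "f \<in> L2 M"
  shows "ennreal ((\<integral>x. f x \<partial>M)\<^sup>2) \<le> sq_norm M f"
  using second_moment_eq[OF assms, symmetric] by simp

lemma (in prob_space) variance_decomposition:
  assumes f: "f \<in> L2 M"
  shows "sq_norm M f = ennreal ((\<integral>x. f x \<partial>M)\<^sup>2) + sq_norm M (\<lambda>x. f x - (\<integral>y. f y \<partial>M))"
proof -
  let ?m = "\<integral>x. f x \<partial>M"
  have c: "(\<lambda>x. f x - ?m) \<in> L2 M"
    by (rule L2_diff[OF f]) (simp add: L2_def)
  have "(\<integral>x. (f x - ?m)\<^sup>2 \<partial>M) = (\<integral>x. (f x)\<^sup>2 \<partial>M) - ?m\<^sup>2"
    by (rule variance_eq[OF L2_integrable[OF f] L2_integrable_sq[OF f]])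
  then have "ennreal (\<integral>x. (f x)\<^sup>2 \<partial>M) = ennreal (?m\<^sup>2 + (\<integral>x. (f x - ?m)\<^sup>2 \<partial>M))" by simp
  also have "\<dots> = ennreal (?m\<^sup>2) + ennreal (\<integral>x. (f x - ?m)\<^sup>2 \<partial>M)"
    by (rule ennreal_plus) auto
  finally show ?thesis unfolding sq_norm_L2[OF f] sq_norm_L2[OF c] .
qed

text \<open>The chain enters the estimates only through consecutive distributions and the kernel between them.\<close>

locale kernel_step =
  fixes X :: "'x measure" and \<mu> \<mu>' :: "'x measure" and k :: "'x \<Rightarrow> 'x measure"
  assumes sets_mu [measurable_cong]: "sets \<mu> = sets X" and sets_mu' [measurable_cong]: "sets \<mu>' = sets X"
    and prob_mu: "prob_space \<mu>" and prob_mu': "prob_space \<mu>'"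
    and k: "k \<in> X \<rightarrow>\<^sub>M prob_algebra X"
    and step: "\<mu>' = \<mu> \<bind> k"
begin

sublocale mu: prob_space \<mu> by (rule prob_mu)
sublocale mu': prob_space \<mu>' by (rule prob_mu')

lemma k_subprob [measurable]: "k \<in> X \<rightarrow>\<^sub>M subprob_algebra X"
  by (rule measurable_prob_algebraD[OF k])

lemma kernel_prob: "x \<in> space \<mu> \<Longrightarrow> prob_space (k x)" "x \<in> space \<mu> \<Longrightarrow> sets (k x) = sets X"
  using measurable_space[OF k] sets_eq_imp_space_eq[OF sets_mu] by (auto simp: space_prob_algebra)

lemma nn_integral_step: "f \<in> borel_measurable \<mu>' \<Longrightarrow> (\<integral>\<^sup>+y. f y \<partial>\<mu>') = (\<integral>\<^sup>+x. \<integral>\<^sup>+y. f y \<partial>k x \<partial>\<mu>)"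
  unfolding step
  by (rule nn_integral_bind[where B = X])
     (auto simp: step[symmetric] measurable_cong_sets[OF sets_mu' refl] measurable_cong_sets[OF sets_mu refl])

lemma K_op_measurable: "f \<in> borel_measurable \<mu>' \<Longrightarrow> K_op k f \<in> borel_measurable \<mu>"
  unfolding K_op_def
  using measurable_compose[OF k_subprob integral_measurable_subprob_algebra[of f X]]
  by (simp add: measurable_cong_sets[OF sets_mu refl] measurable_cong_sets[OF sets_mu' refl])

lemma AE_kernel_L2:
  assumes f: "f \<in> L2 \<mu>'"
  shows "AE x in \<mu>. f \<in> L2 (k x)"
proof -
  have m: "f \<in> borel_measurable X"
    using L2_measurable[OF f] by (simp add: measurable_cong_sets[OF sets_mu' refl])
  have meas: "(\<lambda>x. sq_norm (k x) f) \<in> borel_measurable \<mu>"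
    unfolding sq_norm_def using m measurable_compose[OF k_subprob nn_integral_measurable_subprob_algebra[of _ X]]
    by (simp add: measurable_cong_sets[OF sets_mu refl])
  have "(\<integral>\<^sup>+x. sq_norm (k x) f \<partial>\<mu>) = sq_norm \<mu>' f"
    unfolding sq_norm_def using L2_measurable[OF f] by (subst nn_integral_step) auto
  also have "\<dots> < \<infinity>" using f by (simp add: L2_iff)
  finally have "AE x in \<mu>. sq_norm (k x) f \<noteq> \<infinity>" by (intro nn_integral_PInf_AE meas) auto
  then show ?thesis
    by (rule AE_mp) (auto intro!: AE_I2 simp: L2_iff less_top measurable_cong_sets[OF kernel_prob(2) refl] m)
qed

lemma AE_kernel_integrable:
  assumes f: "f \<in> L2 \<mu>'"
  shows "AE x in \<mu>. integrable (k x) f"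
proof (rule AE_mp[OF AE_kernel_L2[OF f]], rule AE_I2, rule impI)
  fix x assume x: "x \<in> space \<mu>" and fx: "f \<in> L2 (k x)"
  interpret prob_space "k x" by (rule kernel_prob(1)[OF x])
  show "integrable (k x) f" by (rule L2_integrable[OF fx])
qed

lemma sq_norm_K_op_le:
  assumes f: "f \<in> L2 \<mu>'"
  shows "sq_norm \<mu> (K_op k f) \<le> sq_norm \<mu>' f"
proof -
  have "sq_norm \<mu> (K_op k f) \<le> (\<integral>\<^sup>+x. sq_norm (k x) f \<partial>\<mu>)"
    unfolding sq_norm_def[of \<mu>]
  proof (rule nn_integral_mono_AE, rule AE_mp[OF AE_kernel_L2[OF f]], rule AE_I2, rule impI)
    fix x assume x: "x \<in> space \<mu>" and fx: "f \<in> L2 (k x)"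
    interpret prob_space "k x" by (rule kernel_prob(1)[OF x])
    show "ennreal ((K_op k f x)\<^sup>2) \<le> sq_norm (k x) f"
      unfolding K_op_def by (rule square_mean_le[OF fx])
  qed
  also have "\<dots> = sq_norm \<mu>' f"
    unfolding sq_norm_def using L2_measurable[OF f] by (subst nn_integral_step) auto
  finally show ?thesis .
qed

lemma K_op_L2: "f \<in> L2 \<mu>' \<Longrightarrow> K_op k f \<in> L2 \<mu>"
  using sq_norm_K_op_le[of f] K_op_measurable[of f] by (auto simp: L2_iff)

text \<open>Although \<open>\<mu>'\<close> is the mixture of the \<open>k x\<close>, \<open>f\<close> need not be integrable for every \<open>k x\<close>, where the
  Bochner integral is 0 by convention. Positive and negative part are therefore treated separately,
  up to null sets.\<close>

lemma integral_K_op: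
  assumes f: "f \<in> L2 \<mu>'"
  shows "(\<integral>x. K_op k f x \<partial>\<mu>) = (\<integral>y. f y \<partial>\<mu>')"
proof -
  have nonneg: "(\<integral>x. K_op k h x \<partial>\<mu>) = (\<integral>y. h y \<partial>\<mu>')" if h: "h \<in> L2 \<mu>'" "\<And>y. 0 \<le> h y" for h
  proof -
    have "(\<integral>\<^sup>+x. ennreal (K_op k h x) \<partial>\<mu>) = (\<integral>\<^sup>+x. \<integral>\<^sup>+y. ennreal (h y) \<partial>k x \<partial>\<mu>)"
    proof (rule nn_integral_cong_AE, rule AE_mp[OF AE_kernel_integrable[OF h(1)]], rule AE_I2, rule impI)
      fix x assume "integrable (k x) h"
      then show "ennreal (K_op k h x) = (\<integral>\<^sup>+y. ennreal (h y) \<partial>k x)"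
        unfolding K_op_def using h(2) by (subst nn_integral_eq_integral) auto
    qed
    also have "\<dots> = (\<integral>\<^sup>+y. ennreal (h y) \<partial>\<mu>')"
      using L2_measurable[OF h(1)] by (subst nn_integral_step) auto
    finally have "(\<integral>\<^sup>+x. ennreal (K_op k h x) \<partial>\<mu>) = (\<integral>\<^sup>+y. ennreal (h y) \<partial>\<mu>')" .
    moreover have "0 \<le> K_op k h x" for x unfolding K_op_def using h(2) by simp
    ultimately show ?thesis
      using h K_op_measurable[OF L2_measurable[OF h(1)]] L2_measurable[OF h(1)]
      by (subst (1 2) integral_eq_nn_integral) auto
  qed
  let ?p = "\<lambda>y. max (f y) 0" and ?n = "\<lambda>y. max (- f y) 0"
  have fm[measurable]: "f \<in> borel_measurable \<mu>'" by (rule L2_measurable[OF f])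
  have L2: "?p \<in> L2 \<mu>'" "?n \<in> L2 \<mu>'"
  proof -
    have "integrable \<mu>' (\<lambda>y. (?p y)\<^sup>2)" "integrable \<mu>' (\<lambda>y. (?n y)\<^sup>2)"
      by (rule Bochner_Integration.integrable_bound[OF L2_integrable_sq[OF f]]; auto simp: max_def)+
    then show "?p \<in> L2 \<mu>'" "?n \<in> L2 \<mu>'" by (auto simp: L2_def)
  qed
  have split: "f = (\<lambda>y. ?p y - ?n y)" by (auto simp: fun_eq_iff max_def)
  have "AE x in \<mu>. K_op k f x = K_op k ?p x - K_op k ?n x"
    using AE_kernel_integrable[OF L2(1)] AE_kernel_integrable[OF L2(2)]
  proof eventually_elim
    case (elim x)
    then show ?case unfolding K_op_def by (subst split) simp
  qed
  then have "(\<integral>x. K_op k f x \<partial>\<mu>) = (\<integral>x. K_op k ?p x - K_op k ?n x \<partial>\<mu>)"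
    using L2 fm by (intro integral_cong_AE) (auto intro!: borel_measurable_diff K_op_measurable)
  also have "\<dots> = (\<integral>y. ?p y \<partial>\<mu>') - (\<integral>y. ?n y \<partial>\<mu>')"
    using mu.L2_integrable[OF K_op_L2[OF L2(1)]] mu.L2_integrable[OF K_op_L2[OF L2(2)]]
    by (simp add: nonneg[OF L2(1)] nonneg[OF L2(2)])
  also have "\<dots> = (\<integral>y. ?p y - ?n y \<partial>\<mu>')"
    using mu'.L2_integrable[OF L2(1)] mu'.L2_integrable[OF L2(2)] by simp
  finally show ?thesis using split by simp
qed

text \<open>The supremum defining \<open>op_norm\<close> only sees functions of norm at most 1; other functions are
  rescaled, and functions of norm 0 are covered by Jensen's inequality.\<close>

lemma op_norm_contraction:
  assumes op: "op_norm \<mu>' (L2_zero \<mu>') \<mu> (K_op k) \<le> ereal c"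
  shows "0 \<le> c" and "f \<in> L2_zero \<mu>' \<Longrightarrow> sq_norm \<mu> (K_op k f) \<le> ennreal (c\<^sup>2) * sq_norm \<mu>' f"
proof -
  have unit: "l2norm \<mu> (K_op k h) \<le> ereal c" if "h \<in> L2_zero \<mu>'" "l2norm \<mu>' h \<le> 1" for h
  proof -
    have "l2norm \<mu> (K_op k h) \<le> op_norm \<mu>' (L2_zero \<mu>') \<mu> (K_op k)"
      unfolding op_norm_def using that by (intro SUP_upper) auto
    with op show ?thesis by (rule order_trans[rotated])
  qed
  have "l2norm \<mu> (K_op k (\<lambda>_. 0)) \<le> ereal c"
    by (rule unit) (auto simp: L2_zero_def L2_def l2norm_def)
  then show c0: "0 \<le> c" by (simp add: K_op_def L2_def l2norm_def)
  assume f0: "f \<in> L2_zero \<mu>'"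
  then have f: "f \<in> L2 \<mu>'" by (simp add: L2_zero_def)
  let ?s = "\<integral>y. (f y)\<^sup>2 \<partial>\<mu>'"
  have fm: "f \<in> borel_measurable \<mu>'" by (rule L2_measurable[OF f])
  show "sq_norm \<mu> (K_op k f) \<le> ennreal (c\<^sup>2) * sq_norm \<mu>' f"
  proof (cases "?s = 0")
    case True
    then show ?thesis using sq_norm_K_op_le[OF f] by (simp add: sq_norm_L2[OF f])
  next
    case False
    then have s: "0 < ?s" by (simp add: less_le)
    define r where "r = sqrt ?s"
    have r: "0 < r" "r\<^sup>2 = ?s" using s by (auto simp: r_def)
    let ?h = "\<lambda>y. (1 / r) * f y"
    have h: "?h \<in> L2 \<mu>'" using f by (auto simp: L2_def power_divide)
    have inv_r: "ennreal ((1 / r)\<^sup>2) * ennreal (r\<^sup>2) = 1"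
      using r(1) by (simp add: power_divide flip: ennreal_mult)
    have "sq_norm \<mu>' ?h = 1"
      by (simp only: sq_norm_scale[OF fm] sq_norm_L2[OF f] inv_r r(2)[symmetric])
    then have "l2norm \<mu>' ?h \<le> ereal 1"
      using fm l2norm_le_iff[of 1 \<mu>' ?h] by simp
    moreover have "?h \<in> L2_zero \<mu>'" using h f0 by (simp add: L2_zero_def)
    ultimately have "l2norm \<mu> (K_op k ?h) \<le> ereal c" by (intro unit) (auto simp: one_ereal_def)
    moreover have "K_op k ?h = (\<lambda>x. (1 / r) * K_op k f x)" by (simp add: K_op_def fun_eq_iff)
    ultimately have "l2norm \<mu> (\<lambda>x. (1 / r) * K_op k f x) \<le> ereal c" by (simp only:)
    then have "sq_norm \<mu> (\<lambda>x. (1 / r) * K_op k f x) \<le> ennreal (c\<^sup>2)"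
      by (rule conjunct2[OF iffD1[OF l2norm_le_iff[OF c0]]])
    then have "ennreal ((1 / r)\<^sup>2) * sq_norm \<mu> (K_op k f) \<le> ennreal (c\<^sup>2)"
      by (simp only: sq_norm_scale[OF K_op_measurable[OF fm]])
    then have "ennreal (r\<^sup>2) * (ennreal ((1 / r)\<^sup>2) * sq_norm \<mu> (K_op k f)) \<le> ennreal (r\<^sup>2) * ennreal (c\<^sup>2)"
      by (rule mult_left_mono) simp
    moreover have "ennreal (r\<^sup>2) * (ennreal ((1 / r)\<^sup>2) * sq_norm \<mu> (K_op k f)) = sq_norm \<mu> (K_op k f)"
      using inv_r by (simp only: mult.assoc[symmetric] mult.commute[of "ennreal (r\<^sup>2)"] mult_1_left)
    moreover have "ennreal (r\<^sup>2) * ennreal (c\<^sup>2) = ennreal (c\<^sup>2) * sq_norm \<mu>' f"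
      unfolding sq_norm_L2[OF f] r(2) by (rule mult.commute)
    ultimately show ?thesis by (simp only:)
  qed
qed

lemma K_op_centered:
  assumes op: "op_norm \<mu>' (L2_zero \<mu>') \<mu> (K_op k) \<le> ereal c" and f: "f \<in> L2 \<mu>'"
  defines "m \<equiv> \<integral>y. f y \<partial>\<mu>'"
  shows "sq_norm \<mu> (\<lambda>x. K_op k f x - m) \<le> ennreal (c\<^sup>2) * sq_norm \<mu>' (\<lambda>y. f y - m)"
proof -
  have fm: "(\<lambda>y. f y - m) \<in> L2 \<mu>'" by (rule L2_diff[OF f]) (simp add: L2_def)
  have "(\<lambda>y. f y - m) \<in> L2_zero \<mu>'"
    using fm mu'.L2_integrable[OF f] by (simp add: L2_zero_def m_def mu'.prob_space)
  from op_norm_contraction(2)[OF op this]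
  have "sq_norm \<mu> (K_op k (\<lambda>y. f y - m)) \<le> ennreal (c\<^sup>2) * sq_norm \<mu>' (\<lambda>y. f y - m)" .
  moreover have "AE x in \<mu>. K_op k (\<lambda>y. f y - m) x = K_op k f x - m"
  proof (rule AE_mp[OF AE_kernel_integrable[OF f]], rule AE_I2, rule impI)
    fix x assume x: "x \<in> space \<mu>" and fx: "integrable (k x) f"
    interpret prob_space "k x" by (rule kernel_prob(1)[OF x])
    show "K_op k (\<lambda>y. f y - m) x = K_op k f x - m" using fx by (simp add: K_op_def prob_space)
  qed
  ultimately show ?thesis by (simp add: sq_norm_cong_AE)
qed

end

text \<open>The Markov property enters only here: integrating the conditional probabilities shows that the
  distribution of \<open>\<xi> (n + 1)\<close> is the mixture of the kernel over that of \<open>\<xi> n\<close>.\<close>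

lemma markov_chain_step:
  assumes chain: "markov_chain \<Omega> X \<xi> k" and n: "1 \<le> n"
  shows "kernel_step X (distr \<Omega> X (\<xi> n)) (distr \<Omega> X (\<xi> (n + 1))) (k n)"
proof -
  interpret prob_space \<Omega> using chain by (simp add: markov_chain_def)
  have \<xi>[measurable]: "\<xi> i \<in> \<Omega> \<rightarrow>\<^sub>M X" if "1 \<le> i" for i using chain that by (simp add: markov_chain_def)
  have k: "k n \<in> X \<rightarrow>\<^sub>M prob_algebra X" using chain n by (simp add: markov_chain_def)
  have ks[measurable]: "k n \<in> X \<rightarrow>\<^sub>M subprob_algebra X" by (rule measurable_prob_algebraD[OF k])
  have sub: "subalgebra \<Omega> (past \<Omega> X \<xi> n)"
    unfolding subalgebra_def past_def
  proof (intro conjI)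
    let ?E = "{\<xi> i -` B \<inter> space \<Omega> | i B. i \<in> {1..n} \<and> B \<in> sets X}"
    have E: "?E \<subseteq> sets \<Omega>" using \<xi> by (auto intro: measurable_sets)
    then have "?E \<subseteq> Pow (space \<Omega>)" using sets.sets_into_space by blast
    then show "space (sigma (space \<Omega>) ?E) = space \<Omega>" "sets (sigma (space \<Omega>) ?E) \<subseteq> sets \<Omega>"
      using E by (auto simp: sets.sigma_sets_subset)
  qed
  interpret F: finite_measure_subalgebra \<Omega> "past \<Omega> X \<xi> n"
    by unfold_locales (rule sub)
  have \<xi>n: "\<xi> n \<in> \<Omega> \<rightarrow>\<^sub>M X" "\<xi> (n + 1) \<in> \<Omega> \<rightarrow>\<^sub>M X" using n by (auto intro: \<xi>)
  have ne: "space (distr \<Omega> X (\<xi> n)) \<noteq> {}"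
    using not_empty measurable_space[OF \<xi>n(1)] by auto
  have step: "distr \<Omega> X (\<xi> (n + 1)) = distr \<Omega> X (\<xi> n) \<bind> k n"
  proof (rule measure_eqI)
    show "sets (distr \<Omega> X (\<xi> (n + 1))) = sets (distr \<Omega> X (\<xi> n) \<bind> k n)"
      using ne by (subst sets_bind[where N = X]) (auto simp: sets_kernel[OF ks])
    fix B assume "B \<in> sets (distr \<Omega> X (\<xi> (n + 1)))"
    then have B[measurable]: "B \<in> sets X" by simp
    let ?A = "\<xi> (n + 1) -` B \<inter> space \<Omega>"
    have A: "?A \<in> events" using \<xi>n(2) by (rule measurable_sets) simp
    have kp: "prob_space (k n (\<xi> n \<omega>))" if "\<omega> \<in> space \<Omega>" for \<omega>
      using measurable_space[OF k measurable_space[OF \<xi>n(1) that]] by (simp add: space_prob_algebra)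
    have mk: "(\<lambda>\<omega>. measure (k n (\<xi> n \<omega>)) B) \<in> borel_measurable \<Omega>"
      using \<xi>n(1) by measurable
    have AE: "AE \<omega> in \<Omega>. real_cond_exp \<Omega> (past \<Omega> X \<xi> n) (indicator ?A) \<omega> = measure (k n (\<xi> n \<omega>)) B"
      using chain n B unfolding markov_chain_def by blast
    have "measure \<Omega> ?A = (\<integral>\<omega>. indicator ?A \<omega> \<partial>\<Omega>)" using A by simp
    also have "\<dots> = (\<integral>\<omega>. real_cond_exp \<Omega> (past \<Omega> X \<xi> n) (indicator ?A) \<omega> \<partial>\<Omega>)"
      using A by (intro F.real_cond_exp_int(2)[symmetric]) (auto simp: emeasure_eq_measure)
    also have "\<dots> = (\<integral>\<omega>. measure (k n (\<xi> n \<omega>)) B \<partial>\<Omega>)"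
      using AE mk by (intro integral_cong_AE) auto
    finally have eq: "measure \<Omega> ?A = (\<integral>\<omega>. measure (k n (\<xi> n \<omega>)) B \<partial>\<Omega>)" .
    have "emeasure (distr \<Omega> X (\<xi> n) \<bind> k n) B = (\<integral>\<^sup>+x. emeasure (k n x) B \<partial>distr \<Omega> X (\<xi> n))"
      using ne by (intro emeasure_bind[where N = X]) auto
    also have "\<dots> = (\<integral>\<^sup>+\<omega>. emeasure (k n (\<xi> n \<omega>)) B \<partial>\<Omega>)"
      using \<xi>n(1) by (subst nn_integral_distr) auto
    also have "\<dots> = (\<integral>\<^sup>+\<omega>. ennreal (measure (k n (\<xi> n \<omega>)) B) \<partial>\<Omega>)"
      using kp by (intro nn_integral_cong) (simp add: finite_measure.emeasure_eq_measure prob_space.finite_measure)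
    also have "\<dots> = ennreal (\<integral>\<omega>. measure (k n (\<xi> n \<omega>)) B \<partial>\<Omega>)"
      using kp mk
      by (intro nn_integral_eq_integral integrable_const_bound[of _ 1]) (auto simp: prob_space.prob_le_1)
    also have "\<dots> = emeasure \<Omega> ?A" unfolding eq[symmetric] by (simp add: emeasure_eq_measure)
    finally show "emeasure (distr \<Omega> X (\<xi> (n + 1))) B = emeasure (distr \<Omega> X (\<xi> n) \<bind> k n) B"
      using \<xi>n(2) by (simp add: emeasure_distr)
  qed
  show ?thesis
    by (intro kernel_step.intro prob_space_distr \<xi>n k step) simp_all
qed

section \<open>Mean and fluctuation on the product space\<close>

lemma measurable_pair_cong:
  assumes "sets \<mu> = sets X"
  shows "borel_measurable (\<mu> \<Otimes>\<^sub>M S) = borel_measurable (X \<Otimes>\<^sub>M S)"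
  using assms by (intro measurable_cong_sets sets_pair_measure_cong) auto

lemma AE_slice_L2:
  fixes S :: "'b measure"
  assumes "prob_space \<mu>" "prob_space S" and f: "f \<in> L2 (\<mu> \<Otimes>\<^sub>M S)"
  shows "AE u in S. (\<lambda>x. f (x, u)) \<in> L2 \<mu>"
    and "(\<integral>\<^sup>+u. sq_norm \<mu> (\<lambda>x. f (x, u)) \<partial>S) = sq_norm (\<mu> \<Otimes>\<^sub>M S) f"
proof -
  interpret M: prob_space \<mu> by fact
  interpret S: prob_space S by fact
  interpret pair_sigma_finite \<mu> S ..
  have [measurable]: "f \<in> borel_measurable (\<mu> \<Otimes>\<^sub>M S)" by (rule L2_measurable[OF f])
  have m: "(\<lambda>u. sq_norm \<mu> (\<lambda>x. f (x, u))) \<in> borel_measurable S" unfolding sq_norm_def by measurable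
  show eq: "(\<integral>\<^sup>+u. sq_norm \<mu> (\<lambda>x. f (x, u)) \<partial>S) = sq_norm (\<mu> \<Otimes>\<^sub>M S) f"
    unfolding sq_norm_def by (rule nn_integral_snd[where f = "\<lambda>z. ennreal ((f z)\<^sup>2)"]) measurable
  have "sq_norm (\<mu> \<Otimes>\<^sub>M S) f < \<infinity>" using f by (simp add: L2_iff)
  then have "AE u in S. sq_norm \<mu> (\<lambda>x. f (x, u)) \<noteq> \<infinity>" by (intro nn_integral_PInf_AE m) (auto simp: eq)
  then show "AE u in S. (\<lambda>x. f (x, u)) \<in> L2 \<mu>"
    by (rule AE_mp) (auto intro!: AE_I2 simp: L2_iff less_top)
qed

lemma sq_norm_slices:
  fixes S :: "'b measure"
  assumes "prob_space \<mu>" "prob_space S" and f: "f \<in> borel_measurable (\<mu> \<Otimes>\<^sub>M S)"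
  shows "sq_norm (\<mu> \<Otimes>\<^sub>M S) f = (\<integral>\<^sup>+u. sq_norm \<mu> (\<lambda>x. f (x, u)) \<partial>S)"
proof -
  interpret M: prob_space \<mu> by fact
  interpret S: prob_space S by fact
  interpret pair_sigma_finite \<mu> S ..
  show ?thesis
    unfolding sq_norm_def using f by (subst nn_integral_snd[symmetric]) auto
qed

text \<open>Orthogonal decomposition of the functions of \<open>(x, u)\<close>: \<open>space_mean\<close> integrates out \<open>x\<close> and
  \<open>fluctuation\<close> is the remainder. The operators \<open>hat_K\<close> fix the first part and contract the second one.\<close>

definition space_mean :: "'a measure \<Rightarrow> ('a \<times> 'b \<Rightarrow> real) \<Rightarrow> 'b \<Rightarrow> real" where
  "space_mean \<mu> f u = (\<integral>x. f (x, u) \<partial>\<mu>)"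

definition fluctuation :: "'a measure \<Rightarrow> ('a \<times> 'b \<Rightarrow> real) \<Rightarrow> 'a \<times> 'b \<Rightarrow> real" where
  "fluctuation \<mu> f = (\<lambda>(x, u). f (x, u) - space_mean \<mu> f u)"

lemma measurable_space_mean:
  assumes "prob_space \<mu>" "f \<in> borel_measurable (\<mu> \<Otimes>\<^sub>M S)"
  shows "space_mean \<mu> f \<in> borel_measurable S"
proof -
  interpret prob_space \<mu> by fact
  have "(\<lambda>z. f (snd z, fst z)) \<in> borel_measurable (S \<Otimes>\<^sub>M \<mu>)"
    by (rule measurable_compose[OF _ assms(2)]) measurable
  then have "(\<lambda>u. \<integral>x. f (x, u) \<partial>\<mu>) \<in> borel_measurable S"
    by (intro borel_measurable_lebesgue_integral) (simp add: case_prod_beta')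
  then show ?thesis unfolding space_mean_def[abs_def] .
qed

lemma measurable_fluctuation:
  assumes "prob_space \<mu>" and f: "f \<in> borel_measurable (\<mu> \<Otimes>\<^sub>M S)"
  shows "fluctuation \<mu> f \<in> borel_measurable (\<mu> \<Otimes>\<^sub>M S)"
proof -
  have "(\<lambda>z. space_mean \<mu> f (snd z)) \<in> borel_measurable (\<mu> \<Otimes>\<^sub>M S)"
    by (rule measurable_compose[OF measurable_snd measurable_space_mean[OF assms]])
  then show ?thesis
    unfolding fluctuation_def case_prod_beta' using f by simp
qed

lemma pythagoras:
  fixes S :: "'b measure"
  assumes \<mu>: "prob_space \<mu>" and S: "prob_space S" and f: "f \<in> L2 (\<mu> \<Otimes>\<^sub>M S)"
  shows "sq_norm (\<mu> \<Otimes>\<^sub>M S) f = sq_norm S (space_mean \<mu> f) + sq_norm (\<mu> \<Otimes>\<^sub>M S) (fluctuation \<mu> f)"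
proof -
  interpret M: prob_space \<mu> by fact
  interpret SS: prob_space S by fact
  interpret pair_sigma_finite \<mu> S ..
  note fm = L2_measurable[OF f]
  note [measurable] = fm measurable_space_mean[OF \<mu> fm] measurable_fluctuation[OF \<mu> fm]
  have m: "(\<lambda>u. sq_norm \<mu> (\<lambda>x. fluctuation \<mu> f (x, u))) \<in> borel_measurable S" unfolding sq_norm_def by measurable
  have "sq_norm (\<mu> \<Otimes>\<^sub>M S) f = (\<integral>\<^sup>+u. sq_norm \<mu> (\<lambda>x. f (x, u)) \<partial>S)" by (rule sq_norm_slices[OF \<mu> S fm])
  also have "\<dots> = (\<integral>\<^sup>+u. ennreal ((space_mean \<mu> f u)\<^sup>2) + sq_norm \<mu> (\<lambda>x. fluctuation \<mu> f (x, u)) \<partial>S)"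
  proof (rule nn_integral_cong_AE, rule AE_mp[OF AE_slice_L2(1)[OF \<mu> S f]], rule AE_I2, rule impI)
    fix u assume "(\<lambda>x. f (x, u)) \<in> L2 \<mu>"
    from M.variance_decomposition[OF this]
    show "sq_norm \<mu> (\<lambda>x. f (x, u)) = ennreal ((space_mean \<mu> f u)\<^sup>2) + sq_norm \<mu> (\<lambda>x. fluctuation \<mu> f (x, u))"
      by (simp add: space_mean_def fluctuation_def)
  qed
  also have "\<dots> = sq_norm S (space_mean \<mu> f) + (\<integral>\<^sup>+u. sq_norm \<mu> (\<lambda>x. fluctuation \<mu> f (x, u)) \<partial>S)"
    unfolding sq_norm_def[of S] using m by (intro nn_integral_add) measurable
  also have "(\<integral>\<^sup>+u. sq_norm \<mu> (\<lambda>x. fluctuation \<mu> f (x, u)) \<partial>S) = sq_norm (\<mu> \<Otimes>\<^sub>M S) (fluctuation \<mu> f)"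
    by (rule sq_norm_slices[OF \<mu> S measurable_fluctuation[OF \<mu> fm], symmetric])
  finally show ?thesis .
qed

lemma space_mean_L2:
  assumes "prob_space \<mu>" "prob_space S" "f \<in> L2 (\<mu> \<Otimes>\<^sub>M S)"
  shows "space_mean \<mu> f \<in> L2 S" "fluctuation \<mu> f \<in> L2 (\<mu> \<Otimes>\<^sub>M S)"
  using pythagoras[OF assms] assms(3) measurable_space_mean[OF assms(1) L2_measurable[OF assms(3)]]
    measurable_fluctuation[OF assms(1) L2_measurable[OF assms(3)]]
  by (auto simp: L2_iff)

context kernel_step
begin

lemma measurable_hat_K:
  fixes f :: "'x \<times> (real^'m) \<Rightarrow> real"
  assumes f: "f \<in> borel_measurable (\<mu>' \<Otimes>\<^sub>M sphere_measure)"
  shows "hat_K k f \<in> borel_measurable (\<mu> \<Otimes>\<^sub>M sphere_measure)"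
proof -
  let ?S = "sphere_measure :: (real^'m) measure"
  have f': "f \<in> borel_measurable (X \<Otimes>\<^sub>M ?S)" using f by (simp add: measurable_pair_cong[OF sets_mu'])
  have "(\<lambda>z. distr (k (fst z)) (X \<Otimes>\<^sub>M ?S) (\<lambda>y. (y, snd z))) \<in> X \<Otimes>\<^sub>M ?S \<rightarrow>\<^sub>M subprob_algebra (X \<Otimes>\<^sub>M ?S)"
    by (rule measurable_distr2[where M = X]) measurable
  from measurable_compose[OF this integral_measurable_subprob_algebra[OF f']]
  have "(\<lambda>z. \<integral>w. f w \<partial>distr (k (fst z)) (X \<Otimes>\<^sub>M ?S) (\<lambda>y. (y, snd z))) \<in> borel_measurable (X \<Otimes>\<^sub>M ?S)" .
  moreover have "(\<integral>w. f w \<partial>distr (k (fst z)) (X \<Otimes>\<^sub>M ?S) (\<lambda>y. (y, snd z))) = hat_K k f z"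
    if z: "z \<in> space (X \<Otimes>\<^sub>M ?S)" for z
  proof -
    have "fst z \<in> space \<mu>" "snd z \<in> space ?S"
      using z unfolding sets_eq_imp_space_eq[OF sets_mu] by (auto simp: space_pair_measure)
    then have "(\<lambda>y. (y, snd z)) \<in> k (fst z) \<rightarrow>\<^sub>M X \<Otimes>\<^sub>M ?S"
      unfolding measurable_cong_sets[OF kernel_prob(2)[OF \<open>fst z \<in> space \<mu>\<close>] refl] by (intro measurable_Pair2')
    from integral_distr[OF this f'] show ?thesis by (simp add: hat_K_def case_prod_beta')
  qed
  ultimately have "hat_K k f \<in> borel_measurable (X \<Otimes>\<^sub>M ?S)" by (simp cong: measurable_cong)
  then show ?thesis by (simp add: measurable_pair_cong[OF sets_mu])
qed

lemma hat_K_slice: "(\<lambda>x. hat_K k f (x, u)) = K_op k (\<lambda>y. f (y, u))"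
  by (simp add: hat_K_def K_op_def)

lemma hat_K_properties:
  fixes f :: "'x \<times> (real^'m) \<Rightarrow> real"
  assumes op: "op_norm \<mu>' (L2_zero \<mu>') \<mu> (K_op k) \<le> ereal c" and f: "f \<in> L2 (\<mu>' \<Otimes>\<^sub>M sphere_measure)"
  shows "AE u in sphere_measure. space_mean \<mu> (hat_K k f) u = space_mean \<mu>' f u"
    and "sq_norm (\<mu> \<Otimes>\<^sub>M sphere_measure) (fluctuation \<mu> (hat_K k f))
      \<le> ennreal (c\<^sup>2) * sq_norm (\<mu>' \<Otimes>\<^sub>M sphere_measure) (fluctuation \<mu>' f)"
    and "hat_K k f \<in> L2 (\<mu> \<Otimes>\<^sub>M sphere_measure)"
proof -
  let ?S = "sphere_measure :: (real^'m) measure"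
  have S: "prob_space ?S" by (rule prob_space_sphere_measure)
  note fm = L2_measurable[OF f]
  note Km = measurable_hat_K[OF fm]
  have AE: "AE u in ?S. (\<lambda>y. f (y, u)) \<in> L2 \<mu>'" by (rule AE_slice_L2(1)[OF prob_mu' S f])
  have mean: "space_mean \<mu> (hat_K k f) u = space_mean \<mu>' f u" if "(\<lambda>y. f (y, u)) \<in> L2 \<mu>'" for u
    using integral_K_op[OF that] by (simp add: space_mean_def hat_K_slice)
  show "AE u in ?S. space_mean \<mu> (hat_K k f) u = space_mean \<mu>' f u"
    using AE by eventually_elim (rule mean)
  interpret S: prob_space ?S by (rule S)
  interpret P': pair_sigma_finite \<mu>' ?S ..
  have [measurable]: "fluctuation \<mu>' f \<in> borel_measurable (\<mu>' \<Otimes>\<^sub>M ?S)" by (rule measurable_fluctuation[OF prob_mu' fm])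
  have "sq_norm (\<mu> \<Otimes>\<^sub>M ?S) (fluctuation \<mu> (hat_K k f)) = (\<integral>\<^sup>+u. sq_norm \<mu> (\<lambda>x. fluctuation \<mu> (hat_K k f) (x, u)) \<partial>?S)"
    by (rule sq_norm_slices[OF prob_mu S measurable_fluctuation[OF prob_mu Km]])
  also have "\<dots> \<le> (\<integral>\<^sup>+u. ennreal (c\<^sup>2) * sq_norm \<mu>' (\<lambda>y. fluctuation \<mu>' f (y, u)) \<partial>?S)"
  proof (rule nn_integral_mono_AE, rule AE_mp[OF AE], rule AE_I2, rule impI)
    fix u assume u: "(\<lambda>y. f (y, u)) \<in> L2 \<mu>'"
    have "(\<lambda>x. fluctuation \<mu> (hat_K k f) (x, u)) = (\<lambda>x. K_op k (\<lambda>y. f (y, u)) x - (\<integral>y. f (y, u) \<partial>\<mu>'))"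
      using mean[OF u] hat_K_slice[of f u] by (simp add: fluctuation_def space_mean_def fun_eq_iff)
    then show "sq_norm \<mu> (\<lambda>x. fluctuation \<mu> (hat_K k f) (x, u)) \<le> ennreal (c\<^sup>2) * sq_norm \<mu>' (\<lambda>y. fluctuation \<mu>' f (y, u))"
      using K_op_centered[OF op u] by (simp add: fluctuation_def space_mean_def)
  qed
  also have "\<dots> = ennreal (c\<^sup>2) * (\<integral>\<^sup>+u. sq_norm \<mu>' (\<lambda>y. fluctuation \<mu>' f (y, u)) \<partial>?S)"
    unfolding sq_norm_def by (rule nn_integral_cmult) measurable
  also have "(\<integral>\<^sup>+u. sq_norm \<mu>' (\<lambda>y. fluctuation \<mu>' f (y, u)) \<partial>?S) = sq_norm (\<mu>' \<Otimes>\<^sub>M ?S) (fluctuation \<mu>' f)"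
    by (rule sq_norm_slices[OF prob_mu' S measurable_fluctuation[OF prob_mu' fm], symmetric])
  finally show "sq_norm (\<mu> \<Otimes>\<^sub>M ?S) (fluctuation \<mu> (hat_K k f)) \<le> ennreal (c\<^sup>2) * sq_norm (\<mu>' \<Otimes>\<^sub>M ?S) (fluctuation \<mu>' f)" .
  have "sq_norm (\<mu> \<Otimes>\<^sub>M ?S) (hat_K k f) = (\<integral>\<^sup>+u. sq_norm \<mu> (\<lambda>x. hat_K k f (x, u)) \<partial>?S)"
    by (rule sq_norm_slices[OF prob_mu S Km])
  also have "\<dots> \<le> (\<integral>\<^sup>+u. sq_norm \<mu>' (\<lambda>y. f (y, u)) \<partial>?S)"
    unfolding hat_K_slice
    by (rule nn_integral_mono_AE, rule AE_mp[OF AE], rule AE_I2, rule impI, rule sq_norm_K_op_le)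
  also have "\<dots> = sq_norm (\<mu>' \<Otimes>\<^sub>M ?S) f" by (rule sq_norm_slices[OF prob_mu' S fm, symmetric])
  also have "\<dots> < \<infinity>" using f by (simp add: L2_iff)
  finally show "hat_K k f \<in> L2 (\<mu> \<Otimes>\<^sub>M ?S)" using Km by (simp add: L2_iff)
qed

end

lemma hat_V_slice: "hat_V g f (x, u) = twist (g x) (\<lambda>w. f (x, w)) u"
  by (simp add: hat_V_def twist_def)

lemma sq_norm_hat_V:
  fixes g :: "'x \<Rightarrow> real^'m^'m"
  assumes \<mu>: "prob_space \<mu>" and g: "g \<in> \<mu> \<rightarrow>\<^sub>M restrict_space borel SL"
    and f: "f \<in> borel_measurable (\<mu> \<Otimes>\<^sub>M sphere_measure)"
  shows "sq_norm (\<mu> \<Otimes>\<^sub>M sphere_measure) (hat_V g f) = sq_norm (\<mu> \<Otimes>\<^sub>M sphere_measure) f"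
proof -
  let ?S = "sphere_measure :: (real^'m) measure"
  interpret S: prob_space ?S by (rule prob_space_sphere_measure)
  note [measurable] = f measurable_hat_V[OF g f]
  have slices: "sq_norm (\<mu> \<Otimes>\<^sub>M ?S) h = (\<integral>\<^sup>+x. sq_norm ?S (\<lambda>u. h (x, u)) \<partial>\<mu>)"
    if "h \<in> borel_measurable (\<mu> \<Otimes>\<^sub>M ?S)" for h
    unfolding sq_norm_def using that by (subst S.nn_integral_fst[symmetric]) auto
  have "(\<integral>\<^sup>+x. sq_norm ?S (\<lambda>u. hat_V g f (x, u)) \<partial>\<mu>) = (\<integral>\<^sup>+x. sq_norm ?S (\<lambda>u. f (x, u)) \<partial>\<mu>)"
  proof (rule nn_integral_cong)
    fix x assume x: "x \<in> space \<mu>"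
    then have "g x \<in> SL" using g by (auto simp: measurable_restrict_space2_iff)
    moreover have "(\<lambda>u. f (x, u)) \<in> borel_measurable ?S" using x by measurable
    ultimately show "sq_norm ?S (\<lambda>u. hat_V g f (x, u)) = sq_norm ?S (\<lambda>u. f (x, u))"
      unfolding hat_V_slice by (rule sq_norm_twist)
  qed
  then show ?thesis using slices[OF f] slices[OF measurable_hat_V[OF g f]] by simp
qed

lemma hat_V_L2:
  fixes g :: "'x \<Rightarrow> real^'m^'m"
  assumes "prob_space \<mu>" "g \<in> \<mu> \<rightarrow>\<^sub>M restrict_space borel SL" "f \<in> L2 (\<mu> \<Otimes>\<^sub>M sphere_measure)"
  shows "hat_V g f \<in> L2 (\<mu> \<Otimes>\<^sub>M sphere_measure)"
  using assms sq_norm_hat_V[OF assms(1,2)] measurable_hat_V[OF assms(2)] by (simp add: L2_iff)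

text \<open>For small \<open>s\<close> the first summand is hardly enlarged. It will be the one that is contracted, and the
  second one an error term.\<close>

lemma sq_norm_sum_le:
  assumes "f \<in> borel_measurable M" "h \<in> borel_measurable M" "0 < s"
  shows "sq_norm M (\<lambda>x. f x + h x) \<le> ennreal (1 + s) * sq_norm M f + ennreal (1 + 1 / s) * sq_norm M h"
proof -
  note [measurable] = assms(1,2)
  have "(a + b)\<^sup>2 \<le> (1 + s) * a\<^sup>2 + (1 + 1 / s) * b\<^sup>2" for a b :: real
  proof -
    have "0 \<le> (s * a - b)\<^sup>2 / s" using assms(3) by simp
    also have "(s * a - b)\<^sup>2 / s = s * a\<^sup>2 - 2 * a * b + b\<^sup>2 / s"
      using assms(3) by (simp add: power2_eq_square field_simps)
    finally show ?thesis by (simp add: power2_sum algebra_simps)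
  qed
  then have "sq_norm M (\<lambda>x. f x + h x) \<le> (\<integral>\<^sup>+x. ennreal (1 + s) * ennreal ((f x)\<^sup>2) + ennreal (1 + 1 / s) * ennreal ((h x)\<^sup>2) \<partial>M)"
    unfolding sq_norm_def using assms(3)
    by (intro nn_integral_mono) (simp flip: ennreal_mult ennreal_plus)
  also have "\<dots> = ennreal (1 + s) * sq_norm M f + ennreal (1 + 1 / s) * sq_norm M h"
    unfolding sq_norm_def by (simp add: nn_integral_add nn_integral_cmult)
  finally show ?thesis .
qed

text \<open>On a function of \<open>u\<close> alone, \<open>hat_V\<close> followed by the mean over \<open>x\<close> is the averaging operator of the
  distribution of \<open>g\<close>. The fluctuation of \<open>W\<close> is carried along as an error.\<close>

lemma sq_norm_space_mean_hat_V:
  fixes g :: "'x \<Rightarrow> real^'m^'m" and W :: "'x \<times> (real^'m) \<Rightarrow> real"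
  assumes \<mu>: "prob_space \<mu>" and g: "g \<in> \<mu> \<rightarrow>\<^sub>M restrict_space borel SL"
    and W: "W \<in> L2 (\<mu> \<Otimes>\<^sub>M sphere_measure)" and s: "0 < s"
  shows "sq_norm sphere_measure (space_mean \<mu> (hat_V g W))
    \<le> ennreal (1 + s) * sq_norm sphere_measure (average (distr \<mu> (restrict_space borel SL) g) (space_mean \<mu> W))
      + ennreal (1 + 1 / s) * sq_norm (\<mu> \<Otimes>\<^sub>M sphere_measure) (fluctuation \<mu> W)"
proof -
  let ?S = "sphere_measure :: (real^'m) measure" and ?\<nu> = "distr \<mu> (restrict_space borel SL) g"
  interpret M: prob_space \<mu> by fact
  interpret S: prob_space ?S by (rule prob_space_sphere_measure)
  interpret MS: pair_prob_space \<mu> ?S ..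
  let ?\<phi> = "space_mean \<mu> W" and ?h = "fluctuation \<mu> W"
  let ?\<Phi> = "\<lambda>z :: 'x \<times> (real^'m). ?\<phi> (snd z)"
  have \<phi>: "?\<phi> \<in> L2 ?S" and h: "?h \<in> L2 (\<mu> \<Otimes>\<^sub>M ?S)" using space_mean_L2[OF \<mu> prob_space_sphere_measure W] by auto
  have \<Phi>m: "?\<Phi> \<in> borel_measurable (\<mu> \<Otimes>\<^sub>M ?S)"
    using measurable_compose[OF measurable_snd L2_measurable[OF \<phi>]] .
  have "sq_norm (\<mu> \<Otimes>\<^sub>M ?S) ?\<Phi> = sq_norm ?S ?\<phi>"
    by (subst sq_norm_slices[OF \<mu> prob_space_sphere_measure \<Phi>m]) (simp add: sq_norm_def M.emeasure_space_1)
  then have \<Phi>: "?\<Phi> \<in> L2 (\<mu> \<Otimes>\<^sub>M ?S)" using \<Phi>m \<phi> by (simp add: L2_iff)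
  have V\<Phi>: "hat_V g ?\<Phi> \<in> L2 (\<mu> \<Otimes>\<^sub>M ?S)" and Vh: "hat_V g ?h \<in> L2 (\<mu> \<Otimes>\<^sub>M ?S)"
    using hat_V_L2[OF \<mu> g] \<Phi> h by auto
  have sum: "hat_V g W (x, u) = hat_V g ?\<Phi> (x, u) + hat_V g ?h (x, u)" for x u
    by (simp add: hat_V_def fluctuation_def algebra_simps)
  have avg: "space_mean \<mu> (hat_V g ?\<Phi>) u = average ?\<nu> ?\<phi> u" if u: "u \<in> space ?S" for u
  proof -
    have "(\<lambda>g. twist g ?\<phi> u) \<in> borel_measurable (restrict_space borel SL)"
      using measurable_Pair1[OF measurable_twist_pair[OF L2_measurable[OF \<phi>] refl] u] by simp
    then show ?thesis
      unfolding space_mean_def average_def hat_V_slice using g by (subst integral_distr) auto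
  qed
  have "AE u in ?S. space_mean \<mu> (hat_V g W) u = average ?\<nu> ?\<phi> u + space_mean \<mu> (hat_V g ?h) u"
    using AE_slice_L2(1)[OF \<mu> prob_space_sphere_measure V\<Phi>] AE_slice_L2(1)[OF \<mu> prob_space_sphere_measure Vh] AE_space
  proof eventually_elim
    case (elim u)
    then have "space_mean \<mu> (hat_V g W) u = space_mean \<mu> (hat_V g ?\<Phi>) u + space_mean \<mu> (hat_V g ?h) u"
      unfolding space_mean_def sum by (intro Bochner_Integration.integral_add M.L2_integrable)
    with avg[OF elim(3)] show ?case by simp
  qed
  then have "sq_norm ?S (space_mean \<mu> (hat_V g W)) = sq_norm ?S (\<lambda>u. average ?\<nu> ?\<phi> u + space_mean \<mu> (hat_V g ?h) u)"
    by (rule sq_norm_cong_AE)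
  also have "\<dots> \<le> ennreal (1 + s) * sq_norm ?S (average ?\<nu> ?\<phi>) + ennreal (1 + 1 / s) * sq_norm ?S (space_mean \<mu> (hat_V g ?h))"
  proof (rule sq_norm_sum_le[OF _ _ s])
    show "average ?\<nu> ?\<phi> \<in> borel_measurable ?S"
      using measurable_space_mean[OF \<mu> L2_measurable[OF V\<Phi>]] avg by (simp cong: measurable_cong)
    show "space_mean \<mu> (hat_V g ?h) \<in> borel_measurable ?S" by (rule measurable_space_mean[OF \<mu> L2_measurable[OF Vh]])
  qed
  also have "sq_norm ?S (space_mean \<mu> (hat_V g ?h)) \<le> sq_norm (\<mu> \<Otimes>\<^sub>M ?S) (hat_V g ?h)"
    using pythagoras[OF \<mu> prob_space_sphere_measure Vh] by simp
  also have "\<dots> = sq_norm (\<mu> \<Otimes>\<^sub>M ?S) ?h" by (rule sq_norm_hat_V[OF \<mu> g L2_measurable[OF h]])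
  finally show ?thesis by (simp add: mult_left_mono add_left_mono)
qed

section \<open>The contraction over two steps\<close>

text \<open>The numerical end of the argument. Here \<open>a\<close> and \<open>b\<close> are the squared norms of mean and fluctuation
  after the first kernel step, \<open>P\<close> that of the mean after twisting, and \<open>R\<close> that of the final result.
  If \<open>a\<close> is near 1, then \<open>b\<close> is small and \<open>P\<close> is bounded away from 1; otherwise \<open>a + b\<close> is. The
  convex combination with weight \<open>\<theta>\<close> of these two bounds on \<open>R\<close> covers both cases, and
  \<open>\<theta> = 1 / (2 * C)\<close> is small enough to absorb the constant \<open>C\<close>.\<close>

lemma two_step_bound:
  fixes a b q \<beta> C P R :: real
  assumes "0 \<le> a" "a \<le> 1" "0 \<le> b" "b \<le> q * (1 - a)" "0 \<le> q" "q < 1" "0 \<le> \<beta>" "\<beta> < 1" "1 \<le> C"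
    and P: "P \<le> \<beta> * a + C * b" "P \<le> a + b" and R: "R \<le> P + q * (a + b - P)"
  shows "R \<le> 1 - (1 - q) * (1 - \<beta>) / (2 * C)"
proof -
  let ?\<gamma> = "1 - q"
  define \<theta> where "\<theta> = 1 / (2 * C)"
  have R1: "R \<le> ?\<gamma> * (\<beta> * a + C * b) + q * (a + b)"
  proof -
    have "?\<gamma> * P \<le> ?\<gamma> * (\<beta> * a + C * b)" using P(1) assms(6) by (intro mult_left_mono) auto
    with R show ?thesis by (simp add: algebra_simps)
  qed
  have R2: "R \<le> a + b"
  proof -
    have "?\<gamma> * P \<le> ?\<gamma> * (a + b)" using P(2) assms(6) by (intro mult_left_mono) auto
    with R show ?thesis by (simp add: algebra_simps)
  qed
  have \<theta>: "0 < \<theta>" "\<theta> \<le> 1" "\<theta> * C = 1 / 2" using assms(9) by (auto simp: \<theta>_def)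
  have "R = \<theta> * R + (1 - \<theta>) * R" by (simp add: algebra_simps)
  also have "\<dots> \<le> \<theta> * (?\<gamma> * (\<beta> * a + C * b) + q * (a + b)) + (1 - \<theta>) * (a + b)"
    using R1 R2 \<theta> by (intro add_mono mult_left_mono) auto
  also have "\<dots> = a * (1 - \<theta> * ?\<gamma> * (1 - \<beta>)) + b * (1 + ?\<gamma> * (\<theta> * C) - \<theta> * ?\<gamma>)"
    by (simp add: algebra_simps)
  also have "\<dots> \<le> a * (1 - \<theta> * ?\<gamma> * (1 - \<beta>)) + b * (1 + ?\<gamma> / 2)"
  proof -
    have "0 \<le> \<theta> * ?\<gamma>" using \<theta>(1) assms(6) by simp
    then have "1 + ?\<gamma> * (\<theta> * C) - \<theta> * ?\<gamma> \<le> 1 + ?\<gamma> / 2" unfolding \<theta>(3) by linarith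
    then show ?thesis using assms(3) by (intro add_left_mono mult_left_mono)
  qed
  also have "\<dots> \<le> a * (1 - \<theta> * ?\<gamma> * (1 - \<beta>)) + q * (1 - a) * (1 + ?\<gamma> / 2)"
    using assms(4,6) by (intro add_left_mono mult_right_mono) auto
  also have "\<dots> = a * (1 - \<theta> * ?\<gamma> * (1 - \<beta>)) + (1 - a) * (q * (1 + ?\<gamma> / 2))" by (simp add: mult_ac)
  also have "\<dots> \<le> a * (1 - \<theta> * ?\<gamma> * (1 - \<beta>)) + (1 - a) * (1 - ?\<gamma> / 2)"
  proof -
    have "q * ?\<gamma> \<le> 1 * ?\<gamma>" using assms(6) by (intro mult_right_mono) auto
    then have "q * (1 + ?\<gamma> / 2) \<le> 1 - ?\<gamma> / 2" by (simp add: field_simps)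
    then show ?thesis using assms(2) by (intro add_left_mono mult_left_mono) auto
  qed
  also have "\<dots> \<le> a * (1 - \<theta> * ?\<gamma> * (1 - \<beta>)) + (1 - a) * (1 - \<theta> * ?\<gamma> * (1 - \<beta>))"
  proof -
    have "\<theta> \<le> 1 / 2" using assms(9) by (simp add: \<theta>_def)
    then have "(\<theta> * ?\<gamma>) * (1 - \<beta>) \<le> (1 / 2 * ?\<gamma>) * 1"
      using \<theta>(1) assms(6-8) by (intro mult_mono mult_right_mono) auto
    then have "1 - ?\<gamma> / 2 \<le> 1 - \<theta> * ?\<gamma> * (1 - \<beta>)" by linarith
    then show ?thesis using assms(2) by (intro add_left_mono mult_left_mono) auto
  qed
  also have "\<dots> = 1 - \<theta> * ?\<gamma> * (1 - \<beta>)" by (simp add: algebra_simps)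
  also have "\<theta> * ?\<gamma> * (1 - \<beta>) = ?\<gamma> * (1 - \<beta>) / (2 * C)" by (simp add: \<theta>_def)
  finally show ?thesis .
qed

text \<open>The roles of the two kernel steps: the one from \<open>\<mu>\<^sub>3\<close> to \<open>\<mu>\<^sub>2\<close> forces the fluctuation to be small
  unless norm is lost, the twist by \<open>g\<^sub>2\<close> then shortens the mean, and the one from \<open>\<mu>\<^sub>2\<close> to \<open>\<mu>\<^sub>1\<close>
  discards a part of what the twist has moved from mean to fluctuation. The twist by \<open>g\<^sub>3\<close> is an
  isometry in front of all this.\<close>

lemma two_step_contraction:
  fixes X :: "'x measure" and k\<^sub>1 k\<^sub>2 :: "'x \<Rightarrow> 'x measure" and g\<^sub>2 g\<^sub>3 :: "'x \<Rightarrow> real^'m^'m"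
  assumes k1: "kernel_step X \<mu>\<^sub>1 \<mu>\<^sub>2 k\<^sub>1" and k2: "kernel_step X \<mu>\<^sub>2 \<mu>\<^sub>3 k\<^sub>2"
    and op1: "op_norm \<mu>\<^sub>2 (L2_zero \<mu>\<^sub>2) \<mu>\<^sub>1 (K_op k\<^sub>1) \<le> ereal c"
    and op2: "op_norm \<mu>\<^sub>3 (L2_zero \<mu>\<^sub>3) \<mu>\<^sub>2 (K_op k\<^sub>2) \<le> ereal c"
    and c: "c < 1"
    and g2: "g\<^sub>2 \<in> \<mu>\<^sub>2 \<rightarrow>\<^sub>M restrict_space borel SL" and g3: "g\<^sub>3 \<in> \<mu>\<^sub>3 \<rightarrow>\<^sub>M restrict_space borel SL"
    and avg: "\<And>\<phi> :: real^'m \<Rightarrow> real. \<phi> \<in> L2 sphere_measure \<Longrightarrow>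
      sq_norm sphere_measure (average (distr \<mu>\<^sub>2 (restrict_space borel SL) g\<^sub>2) \<phi>)
        \<le> ennreal (\<beta> * energy \<phi>)"
    and \<beta>: "0 < \<beta>" "\<beta> < 1"
    and f: "f \<in> L2 (\<mu>\<^sub>3 \<Otimes>\<^sub>M sphere_measure)" "sq_norm (\<mu>\<^sub>3 \<Otimes>\<^sub>M sphere_measure) f \<le> 1"
  defines "\<rho> \<equiv> 1 - (1 - c\<^sup>2) * (1 - \<beta>)\<^sup>2 / (4 * (1 + \<beta>))"
  shows "sq_norm (\<mu>\<^sub>1 \<Otimes>\<^sub>M sphere_measure) (hat_K k\<^sub>1 (hat_V g\<^sub>2 (hat_K k\<^sub>2 (hat_V g\<^sub>3 f)))) \<le> ennreal \<rho>"
    and "hat_K k\<^sub>1 (hat_V g\<^sub>2 (hat_K k\<^sub>2 (hat_V g\<^sub>3 f))) \<in> L2 (\<mu>\<^sub>1 \<Otimes>\<^sub>M sphere_measure)"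
proof -
  let ?S = "sphere_measure :: (real^'m) measure"
  have S: "prob_space ?S" by (rule prob_space_sphere_measure)
  interpret K1: kernel_step X \<mu>\<^sub>1 \<mu>\<^sub>2 k\<^sub>1 by (rule k1)
  interpret K2: kernel_step X \<mu>\<^sub>2 \<mu>\<^sub>3 k\<^sub>2 by (rule k2)
  \<comment> \<open>The factor \<open>1 + s\<close> moves \<open>\<beta>\<close> half of the way to 1.\<close>
  define s where "s = (1 - \<beta>) / (2 * \<beta>)"
  have s: "0 < s" using \<beta> by (simp add: s_def)
  have s\<beta>: "(1 + s) * \<beta> = (1 + \<beta>) / 2" using \<beta>(1) by (simp add: s_def field_simps)
  have c0: "0 \<le> c" by (rule K1.op_norm_contraction(1)[OF op1])
  define q where "q = c\<^sup>2"
  have q: "0 \<le> q" "q < 1" using c c0 by (auto simp: q_def power_less_one_iff)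
  define F where "F = hat_V g\<^sub>3 f"
  define W where "W = hat_K k\<^sub>2 F"
  define G where "G = hat_V g\<^sub>2 W"
  define R where "R = hat_K k\<^sub>1 G"
  let ?n3 = "sq_norm (\<mu>\<^sub>3 \<Otimes>\<^sub>M ?S)" and ?n2 = "sq_norm (\<mu>\<^sub>2 \<Otimes>\<^sub>M ?S)" and ?n1 = "sq_norm (\<mu>\<^sub>1 \<Otimes>\<^sub>M ?S)" and ?n = "sq_norm ?S"
  have F: "F \<in> L2 (\<mu>\<^sub>3 \<Otimes>\<^sub>M ?S)" "?n3 F \<le> 1"
    using hat_V_L2[OF K2.prob_mu' g3 f(1)] sq_norm_hat_V[OF K2.prob_mu' g3 L2_measurable[OF f(1)]] f(2)
    by (auto simp: F_def)
  have W: "W \<in> L2 (\<mu>\<^sub>2 \<Otimes>\<^sub>M ?S)" unfolding W_def by (rule K2.hat_K_properties(3)[OF op2 F(1)])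
  have G: "G \<in> L2 (\<mu>\<^sub>2 \<Otimes>\<^sub>M ?S)" unfolding G_def by (rule hat_V_L2[OF K1.prob_mu' g2 W])
  have R: "R \<in> L2 (\<mu>\<^sub>1 \<Otimes>\<^sub>M ?S)" unfolding R_def by (rule K1.hat_K_properties(3)[OF op1 G])
  then show "hat_K k\<^sub>1 (hat_V g\<^sub>2 (hat_K k\<^sub>2 (hat_V g\<^sub>3 f))) \<in> L2 (\<mu>\<^sub>1 \<Otimes>\<^sub>M ?S)"
    by (simp add: R_def G_def W_def F_def)
  note mF = space_mean_L2[OF K2.prob_mu' S F(1)] and mW = space_mean_L2[OF K2.prob_mu S W]
    and mG = space_mean_L2[OF K1.prob_mu' S G] and mR = space_mean_L2[OF K1.prob_mu S R]
  have real: "\<exists>r\<ge>0. sq_norm N h = ennreal r" if "h \<in> L2 N" for N :: "'z measure" and h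
    unfolding sq_norm_L2[OF that] by (intro exI[of _ "\<integral>x. (h x)\<^sup>2 \<partial>N"]) simp
  define a where "a = (\<integral>u. (space_mean \<mu>\<^sub>2 W u)\<^sup>2 \<partial>?S)"
  have a: "0 \<le> a" "?n (space_mean \<mu>\<^sub>2 W) = ennreal a"
    using sq_norm_L2[OF mW(1)] by (auto simp: a_def)
  obtain b where b: "0 \<le> b" "?n2 (fluctuation \<mu>\<^sub>2 W) = ennreal b" using real[OF mW(2)] by blast
  obtain d where d: "0 \<le> d" "?n3 (fluctuation \<mu>\<^sub>3 F) = ennreal d" using real[OF mF(2)] by blast
  obtain P where P: "0 \<le> P" "?n (space_mean \<mu>\<^sub>2 G) = ennreal P" using real[OF mG(1)] by blast
  obtain e where e: "0 \<le> e" "?n2 (fluctuation \<mu>\<^sub>2 G) = ennreal e" using real[OF mG(2)] by blast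
  obtain r where r: "0 \<le> r" "?n1 R = ennreal r" using real[OF R] by blast
  obtain e' where e': "0 \<le> e'" "?n1 (fluctuation \<mu>\<^sub>1 R) = ennreal e'" using real[OF mR(2)] by blast
  have "?n (space_mean \<mu>\<^sub>3 F) = ennreal a"
    using sq_norm_cong_AE[OF K2.hat_K_properties(1)[OF op2 F(1)]] a(2) by (simp add: W_def)
  then have "ennreal (a + d) \<le> 1"
    using pythagoras[OF K2.prob_mu' S F(1)] F(2) a d by simp
  then have ad: "a + d \<le> 1" by (simp flip: ennreal_1)
  have "ennreal b \<le> ennreal (q * d)"
    using K2.hat_K_properties(2)[OF op2 F(1)] b d q by (simp add: W_def q_def ennreal_mult)
  then have bd: "b \<le> q * d" using q d by (simp add: ennreal_le_iff)
  have nW: "?n2 W = ennreal (a + b)" using pythagoras[OF K2.prob_mu S W] a b by simp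
  have "ennreal (P + e) = ennreal (a + b)"
    using pythagoras[OF K1.prob_mu' S G] sq_norm_hat_V[OF K1.prob_mu' g2 L2_measurable[OF W]] nW P e by (simp add: G_def)
  then have Pe: "P + e = a + b" using P e a b by (subst (asm) ennreal_inj) auto
  have "ennreal P \<le> ennreal (1 + s) * ennreal (\<beta> * a) + ennreal (1 + 1 / s) * ennreal b"
  proof -
    have "ennreal P \<le> ennreal (1 + s) * ?n (average (distr \<mu>\<^sub>2 (restrict_space borel SL) g\<^sub>2) (space_mean \<mu>\<^sub>2 W))
        + ennreal (1 + 1 / s) * ?n2 (fluctuation \<mu>\<^sub>2 W)"
      using sq_norm_space_mean_hat_V[OF K1.prob_mu' g2 W s] P by (simp add: G_def)
    also have "\<dots> \<le> ennreal (1 + s) * ennreal (\<beta> * a) + ennreal (1 + 1 / s) * ?n2 (fluctuation \<mu>\<^sub>2 W)"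
      using avg[OF mW(1)] by (intro add_right_mono mult_left_mono) (auto simp: a_def)
    finally show ?thesis by (simp add: b)
  qed
  also have "\<dots> = ennreal ((1 + \<beta>) / 2 * a + (1 + 1 / s) * b)"
    unfolding s\<beta>[symmetric] using s \<beta> a b by (simp add: mult.assoc flip: ennreal_mult ennreal_plus)
  finally have P1: "P \<le> (1 + \<beta>) / 2 * a + (1 + 1 / s) * b"
    using s \<beta> a b by (subst (asm) ennreal_le_iff) auto
  have "ennreal e' \<le> ennreal (q * e)"
    using K1.hat_K_properties(2)[OF op1 G] e e' q by (simp add: R_def q_def ennreal_mult)
  then have e'e: "e' \<le> q * e" using q e by (simp add: ennreal_le_iff)
  have "?n (space_mean \<mu>\<^sub>1 R) = ennreal P"
    using sq_norm_cong_AE[OF K1.hat_K_properties(1)[OF op1 G]] P(2) by (simp add: R_def)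
  then have "ennreal r = ennreal (P + e')"
    using pythagoras[OF K1.prob_mu S R] r P e' by simp
  then have rP: "r = P + e'" using r P e' by (subst (asm) ennreal_inj) auto
  have "r \<le> 1 - (1 - q) * (1 - (1 + \<beta>) / 2) / (2 * (1 + 1 / s))"
  proof (rule two_step_bound)
    show "b \<le> q * (1 - a)" using bd mult_left_mono[of d "1 - a" q] ad q by linarith
    show "P \<le> (1 + \<beta>) / 2 * a + (1 + 1 / s) * b" by (rule P1)
    show "r \<le> P + q * (a + b - P)" 
    proof -
      have "e = a + b - P" using Pe by simp
      then show ?thesis using rP e'e by simp
    qed
  qed (use a b d ad q \<beta> s Pe e in auto)
  also have "(1 - q) * (1 - (1 + \<beta>) / 2) / (2 * (1 + 1 / s)) = (1 - c\<^sup>2) * (1 - \<beta>)\<^sup>2 / (4 * (1 + \<beta>))"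
  proof -
    have eqs: "1 + 1 / s = (1 + \<beta>) / (1 - \<beta>)" "1 - (1 + \<beta>) / 2 = (1 - \<beta>) / 2"
      using \<beta> by (simp_all add: s_def field_simps)
    show ?thesis unfolding eqs q_def power2_eq_square[of "1 - \<beta>"] using \<beta> by simp
  qed
  finally have "r \<le> \<rho>" unfolding \<rho>_def .
  then show "sq_norm (\<mu>\<^sub>1 \<Otimes>\<^sub>M sphere_measure) (hat_K k\<^sub>1 (hat_V g\<^sub>2 (hat_K k\<^sub>2 (hat_V g\<^sub>3 f)))) \<le> ennreal \<rho>"
    using r by (simp add: R_def G_def W_def F_def ennreal_leI)
qed

theorem theorem5p5:
  fixes X :: "'x measure" and \<Omega> :: "'w measure"
    and \<xi> :: "nat \<Rightarrow> 'w \<Rightarrow> 'x" and k :: "nat \<Rightarrow> 'x \<Rightarrow> 'x measure"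
    and \<mu> :: "nat \<Rightarrow> 'x measure"
    and g :: "nat \<Rightarrow> 'x \<Rightarrow> real^'m^'m" and \<nu> :: "nat \<Rightarrow> (real^'m^'m) measure"
    and M :: "(real^'m^'m) measure set" and c :: real
  assumes chain: "markov_chain \<Omega> X \<xi> k"
    and mu: "\<And>n. n \<ge> 1 \<Longrightarrow> \<mu> n = distr \<Omega> X (\<xi> n)"
    and g_meas: "\<And>n. n \<ge> 1 \<Longrightarrow> g n \<in> X \<rightarrow>\<^sub>M restrict_space borel SL"
    and nu: "\<And>n. n \<ge> 1 \<Longrightarrow> \<nu> n = distr \<Omega> (restrict_space borel SL) (\<lambda>\<omega>. g n (\<xi> n \<omega>))"
    and c: "c < 1"
    and I: "\<And>n. n \<ge> 1 \<Longrightarrow>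
      op_norm (\<mu> (n + 1)) (L2_zero (\<mu> (n + 1))) (\<mu> n) (K_op (k n)) \<le> ereal c"
    and II_compact: "compactin (weak_topology SL) M"
    and II_a: "\<And>n. n \<ge> 1 \<Longrightarrow> \<nu> n \<in> M"
    and II_b: "\<And>\<rho>. \<rho> \<in> M \<Longrightarrow>
      \<not> (\<exists>\<kappa>\<in>prob_measures_on unit_sphere. \<forall>h\<in>G_of \<rho>. preserves h \<kappa>)"
  shows "\<exists>\<alpha>::real. 0 < \<alpha> \<and> \<alpha> < 1 \<and> (\<forall>n\<ge>2.
    op_norm (ext_measure (\<mu> (n + 1))) (L2 (ext_measure (\<mu> (n + 1)))) (ext_measure (\<mu> (n - 1)))
      (hat_K (k (n - 1)) \<circ> hat_V (g n) \<circ> hat_K (k n) \<circ> hat_V (g (n + 1))) \<le> ereal \<alpha>)"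
proof -
  from uniform_contraction[OF II_compact II_b] obtain \<beta>0 where \<beta>0: "0 \<le> \<beta>0" "\<beta>0 < 1"
    and avg0: "\<And>\<nu>' \<phi>. \<nu>' \<in> M \<Longrightarrow> \<phi> \<in> L2 sphere_measure \<Longrightarrow>
      sq_norm sphere_measure (average \<nu>' \<phi>) \<le> ennreal (\<beta>0 * energy \<phi>)"
    by blast
  \<comment> \<open>The weight \<open>s\<close> in the two-step estimate divides by \<open>\<beta>\<close>, so \<open>\<beta>\<close> has to be positive.\<close>
  define \<beta> where "\<beta> = max \<beta>0 (1/2)"
  have \<beta>: "0 < \<beta>" "\<beta> < 1" using \<beta>0 by (auto simp: \<beta>_def)
  have avg: "sq_norm sphere_measure (average \<nu>' \<phi>) \<le> ennreal (\<beta> * energy \<phi>)"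
    if "\<nu>' \<in> M" "\<phi> \<in> L2 sphere_measure" for \<nu>' and \<phi> :: "real^'m \<Rightarrow> real"
  proof -
    have "\<beta>0 * energy \<phi> \<le> \<beta> * energy \<phi>"
      by (rule mult_right_mono) (auto simp: \<beta>_def)
    then show ?thesis using avg0[OF that] by (meson ennreal_leI order_trans)
  qed
  have step: "kernel_step X (\<mu> n) (\<mu> (n + 1)) (k n)" if "1 \<le> n" for n
    using markov_chain_step[OF chain that] mu[of n] mu[of "n + 1"] that by simp
  have c0: "0 \<le> c" by (rule kernel_step.op_norm_contraction(1)[OF step[of 1] I]) simp_all
  then have c2: "c\<^sup>2 < 1" using c by (simp add: power_less_one_iff)
  define \<rho> where "\<rho> = 1 - (1 - c\<^sup>2) * (1 - \<beta>)\<^sup>2 / (4 * (1 + \<beta>))"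
  have \<rho>: "0 < \<rho>" "\<rho> < 1"
  proof -
    have "(1 - c\<^sup>2) * (1 - \<beta>)\<^sup>2 \<le> 1 * 1"
      using c2 \<beta> by (intro mult_mono) (auto simp: power_le_one)
    also have "\<dots> < 4 * (1 + \<beta>)" using \<beta> by simp
    finally have "(1 - c\<^sup>2) * (1 - \<beta>)\<^sup>2 < 4 * (1 + \<beta>)" .
    then show "0 < \<rho>" using \<beta> by (simp add: \<rho>_def)
    have "0 < (1 - c\<^sup>2) * (1 - \<beta>)\<^sup>2 / (4 * (1 + \<beta>))"
      using c2 \<beta> by (intro divide_pos_pos mult_pos_pos) auto
    then show "\<rho> < 1" by (simp add: \<rho>_def)
  qed
  have bound: "op_norm (ext_measure (\<mu> (n + 1))) (L2 (ext_measure (\<mu> (n + 1)))) (ext_measure (\<mu> (n - 1)))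
      (hat_K (k (n - 1)) \<circ> hat_V (g n) \<circ> hat_K (k n) \<circ> hat_V (g (n + 1))) \<le> ereal (sqrt \<rho>)" if n: "2 \<le> n" for n
    unfolding op_norm_def
  proof (rule SUP_least)
    fix f :: "'x \<times> (real^'m) \<Rightarrow> real"
    assume "f \<in> {f \<in> L2 (ext_measure (\<mu> (n + 1))). l2norm (ext_measure (\<mu> (n + 1))) f \<le> 1}"
    then have f: "f \<in> L2 (\<mu> (n + 1) \<Otimes>\<^sub>M sphere_measure)" "l2norm (\<mu> (n + 1) \<Otimes>\<^sub>M sphere_measure) f \<le> ereal 1"
      by (auto simp: ext_measure_def one_ereal_def)
    have f1: "sq_norm (\<mu> (n + 1) \<Otimes>\<^sub>M sphere_measure) f \<le> 1"
      using conjunct2[OF iffD1[OF l2norm_le_iff f(2)]] by simp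
    have n1: "1 \<le> n - 1" "1 \<le> n" "n - 1 + 1 = n" using n by auto
    note st1 = step[OF n1(1), unfolded n1(3)] and I1 = I[OF n1(1), unfolded n1(3)]
    have sets: "sets (\<mu> i) = sets X" if "1 \<le> i" for i using mu[OF that] by simp
    have gm: "g i \<in> \<mu> i \<rightarrow>\<^sub>M restrict_space borel SL" if "1 \<le> i" for i
      using g_meas[OF that] by (simp add: measurable_cong_sets[OF sets[OF that] refl])
    have "\<nu> n = distr (\<mu> n) (restrict_space borel SL) (g n)"
      using chain n1(2) g_meas[OF n1(2)] unfolding nu[OF n1(2)] mu[OF n1(2)] markov_chain_def
      by (subst distr_distr) (auto simp: o_def)
    then have A: "sq_norm sphere_measure (average (distr (\<mu> n) (restrict_space borel SL) (g n)) \<phi>)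
        \<le> ennreal (\<beta> * energy \<phi>)"
      if "\<phi> \<in> L2 sphere_measure" for \<phi> :: "real^'m \<Rightarrow> real"
      using avg[OF II_a[OF n1(2)] that] by simp
    have gm': "g (n + 1) \<in> \<mu> (n + 1) \<rightarrow>\<^sub>M restrict_space borel SL" by (rule gm) simp
    let ?R = "hat_K (k (n - 1)) (hat_V (g n) (hat_K (k n) (hat_V (g (n + 1)) f)))"
    note two = two_step_contraction[OF st1 step[OF n1(2)] I1 I[OF n1(2)] c gm[OF n1(2)] gm' _ \<beta> f(1) f1]
    have "sq_norm (\<mu> (n - 1) \<Otimes>\<^sub>M sphere_measure) ?R \<le> ennreal \<rho>"
      unfolding \<rho>_def by (rule two(1)) (rule A)
    moreover have "?R \<in> L2 (\<mu> (n - 1) \<Otimes>\<^sub>M sphere_measure)"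
      by (rule two(2)) (rule A)
    ultimately have "l2norm (\<mu> (n - 1) \<Otimes>\<^sub>M sphere_measure) (hat_K (k (n - 1)) (hat_V (g n) (hat_K (k n) (hat_V (g (n + 1)) f)))) \<le> ereal (sqrt \<rho>)"
      using \<rho> by (subst l2norm_le_iff) (auto simp: L2_measurable)
    then show "l2norm (ext_measure (\<mu> (n - 1))) ((hat_K (k (n - 1)) \<circ> hat_V (g n) \<circ> hat_K (k n) \<circ> hat_V (g (n + 1))) f) \<le> ereal (sqrt \<rho>)"
      by (simp add: ext_measure_def)
  qed
  show ?thesis
    using \<rho> bound by (intro exI[of _ "sqrt \<rho>"]) auto
qed

end
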